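(* Let $Y$ be a malleable nonsingular real algebraic variety. Let $X$ be a real algebraic variety (possibly singular), $f:D\to Y$ a continuous map defined on an arbitrary subset $D$ of $X$, and $A$ a Zariski closed subvariety of $X$. Assume that there exists a regular map $f_0:X\to Y$ with $f_0|_{D\cap A}=f|_{D\cap A}$ and with $f_0|_D$ homotopic to $f$ relative to $D\cap A$. Then $f$ can be approximated in the compact-open topology by regular maps from $X$ to $Y$ whose restrictions to $A$ are equal to $f_0|_A$.
   Context: A real algebraic variety is a ringed space with structure sheaf of $\mathbb{R}$-algebras of $\mathbb{R}$-valued functions which is isomorphic to a Zariski locally closed subset of some real projective space $\mathbb{P}^n(\mathbb{R})$, with the Zariski topology and the sheaf of regular functions; each such variety is affine, i.e. isomorphic to an algebraic subset of some $\mathbb{R}^n$. Morphisms are called regular maps: for algebraic sets $X\subset\mathbb{R}^n$, $Y\subset\mathbb{R}^p$ and $U\subset X$ Zariski open, a function $U\to\mathbb{R}$ is regular iff it equals $P/Q$ on $U$ for polynomials $P,Q$ with $Q$ nowhere zero on $U$, and a map $U\to Y$ is regular iff its components are. Unless stated otherwise, topological notions (continuity, homotopy, ...) refer to the Euclidean topology. $\mathcal{C}(D,Y)$ is the space of continuous maps $D\to Y$ with the compact-open topology. A continuous map $f:D\to Y$ can be approximated in the compact-open topology by regular maps from $X$ to $Y$ (having some property) if for every open neighborhood $\mathcal{U}\subset\mathcal{C}(D,Y)$ of $f$ there is a regular map $g:X\to Y$ (with that property) with $g|_D\in\mathcal{U}$. Vector bundles are real; algebraic vector bundles over $Y$ are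 those algebraically isomorphic to algebraic subbundles of product bundles $Y\times\mathbb{R}^n$ (Bochnak–Coste–Roy). For a vector bundle $p:E\to Y$, $E_y=p^{-1}(y)$ and $0_y$ is the zero vector of $E_y$. A spray $(E,p,s)$ for $Y$ consists of an algebraic vector bundle $p:E\to Y$ and a regular map $s:E\to Y$ such that $s(0_y)=y$ for all $y\in Y$. It is dominating if for every $y\in Y$ the map $E_y\to Y$, $v\mapsto s(v)$ is a submersion at $0_y$. $Y$ is malleable if it admits a dominating spray. *)

theory Defs
  imports "HOL-Analysis.Analysis"
begin

section \<open>Spaces with a sheaf of real-valued functions\<close>

text \<open>
  A ringed space whose structure sheaf consists of real-valued functions.  The underlying set is
  the \<open>topspace\<close> of the Zariski topology.  A section over an open set \<open>U\<close> is represented by any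
  total function with the right values on \<open>U\<close> (values outside \<open>U\<close> are irrelevant), and
  \<open>sections X U\<close> contains all the representatives.  Only open \<open>U\<close> are ever relevant.
\<close>

record 'a fspace =
  zariski :: "'a topology"
  sections :: "'a set \<Rightarrow> ('a \<Rightarrow> real) set"

abbreviation points :: "('a, 'm) fspace_scheme \<Rightarrow> 'a set" where
  "points X \<equiv> topspace (zariski X)"

definition sheaf_of_real_functions :: "'a fspace \<Rightarrow> bool" where
  "sheaf_of_real_functions X \<longleftrightarrow>
     (\<forall>U f g. openin (zariski X) U \<and> f \<in> sections X U \<and> (\<forall>x\<in>U. g x = f x) \<longrightarrow> g \<in> sections X U) \<and>
     (\<forall>U c. openin (zariski X) U \<longrightarrow> (\<lambda>_. c) \<in> sections X U) \<and>
     (\<forall>U f g. openin (zariski X) U \<and> f \<in> sections X U \<and> g \<in> sections X U \<longrightarrow>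
        (\<lambda>x. f x + g x) \<in> sections X U \<and> (\<lambda>x. f x * g x) \<in> sections X U) \<and>
     (\<forall>U V f. openin (zariski X) U \<and> openin (zariski X) V \<and> V \<subseteq> U \<and> f \<in> sections X U \<longrightarrow>
        f \<in> sections X V) \<and>
     (\<forall>U f. openin (zariski X) U \<and>
        (\<forall>x\<in>U. \<exists>V. openin (zariski X) V \<and> x \<in> V \<and> V \<subseteq> U \<and> f \<in> sections X V) \<longrightarrow>
        f \<in> sections X U)"

definition regular_map :: "'a fspace \<Rightarrow> 'b fspace \<Rightarrow> ('a \<Rightarrow> 'b) \<Rightarrow> bool" where
  "regular_map X Y \<phi> \<longleftrightarrow>
     continuous_map (zariski X) (zariski Y) \<phi> \<and>
     (\<forall>U f. openin (zariski Y) U \<and> f \<in> sections Y U \<longrightarrow>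
        f \<circ> \<phi> \<in> sections X {x \<in> points X. \<phi> x \<in> U})"

definition biregular :: "'a fspace \<Rightarrow> 'b fspace \<Rightarrow> ('a \<Rightarrow> 'b) \<Rightarrow> bool" where
  "biregular X Y \<phi> \<longleftrightarrow>
     regular_map X Y \<phi> \<and>
     (\<exists>\<psi>. regular_map Y X \<psi> \<and>
        (\<forall>x\<in>points X. \<psi> (\<phi> x) = x) \<and> (\<forall>y\<in>points Y. \<phi> (\<psi> y) = y))"

definition isomorphic :: "'a fspace \<Rightarrow> 'b fspace \<Rightarrow> bool" where
  "isomorphic X Y \<longleftrightarrow> (\<exists>\<phi>. biregular X Y \<phi>)"

text \<open>The structure induced on a subset: the sections are locally restrictions of sections.\<close>

definition subspace_of :: "'a fspace \<Rightarrow> 'a set \<Rightarrow> 'a fspace" where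
  "subspace_of X S =
     \<lparr> zariski = subtopology (zariski X) S,
       sections = (\<lambda>U. {f. \<forall>x\<in>U. \<exists>W g. openin (zariski X) W \<and> x \<in> W \<and> g \<in> sections X W \<and>
                              (\<forall>z\<in>U \<inter> W. f z = g z)}) \<rparr>"

text \<open>
  The product \<open>X \<times> Y\<close>: regular functions are locally quotients of finite sums
  \<open>\<Sum>\<^sub>i f\<^sub>i(x) g\<^sub>i(y)\<close> with \<open>f\<^sub>i\<close>, \<open>g\<^sub>i\<close> regular on open subsets of the factors, and the
  non-vanishing loci of such sums form a basis of the Zariski topology.
\<close>

definition tensor_sections ::
    "'a fspace \<Rightarrow> 'a set \<Rightarrow> 'b fspace \<Rightarrow> 'b set \<Rightarrow> ('a \<times> 'b \<Rightarrow> real) set" where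
  "tensor_sections X U Y V =
     {h. \<exists>(k::nat) f g. (\<forall>i<k. f i \<in> sections X U \<and> g i \<in> sections Y V) \<and>
           h = (\<lambda>(x, y). \<Sum>i<k. f i x * g i y)}"

definition prod_fspace :: "'a fspace \<Rightarrow> 'b fspace \<Rightarrow> ('a \<times> 'b) fspace" where
  "prod_fspace X Y =
     \<lparr> zariski = topology_generated_by
         {{w \<in> U \<times> V. h w \<noteq> 0} | U V h. openin (zariski X) U \<and> openin (zariski Y) V \<and>
              h \<in> tensor_sections X U Y V},
       sections = (\<lambda>W. {f. \<forall>w\<in>W. \<exists>U V P Q.
              openin (zariski X) U \<and> openin (zariski Y) V \<and> w \<in> U \<times> V \<and>
              P \<in> tensor_sections X U Y V \<and> Q \<in> tensor_sections X U Y V \<and> Q w \<noteq> 0 \<and>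
              (\<forall>z\<in>W \<inter> U \<times> V. Q z \<noteq> 0 \<longrightarrow> f z = P z / Q z)}) \<rparr>"


section \<open>Affine and projective space\<close>

text \<open>\<open>\<real>\<^sup>n\<close> is the set of sequences supported on \<open>{..<n}\<close>, so that \<open>n\<close> can be quantified over.\<close>

definition Rn :: "nat \<Rightarrow> (nat \<Rightarrow> real) set" where
  "Rn n = {x. \<forall>i\<ge>n. x i = 0}"

inductive poly_fun :: "nat \<Rightarrow> ((nat \<Rightarrow> real) \<Rightarrow> real) \<Rightarrow> bool" for n where
  const: "poly_fun n (\<lambda>_. c)"
| coord: "i < n \<Longrightarrow> poly_fun n (\<lambda>x. x i)"
| add: "poly_fun n P \<Longrightarrow> poly_fun n Q \<Longrightarrow> poly_fun n (\<lambda>x. P x + Q x)"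
| mult: "poly_fun n P \<Longrightarrow> poly_fun n Q \<Longrightarrow> poly_fun n (\<lambda>x. P x * Q x)"

text \<open>Homogeneous polynomials of degree \<open>d\<close> in \<open>n\<close> variables (including \<open>0\<close>, for every \<open>d\<close>).\<close>

inductive hom_poly_fun :: "nat \<Rightarrow> nat \<Rightarrow> ((nat \<Rightarrow> real) \<Rightarrow> real) \<Rightarrow> bool" for n where
  zero: "hom_poly_fun n d (\<lambda>_. 0)"
| const: "hom_poly_fun n 0 (\<lambda>_. c)"
| coord: "i < n \<Longrightarrow> hom_poly_fun n 1 (\<lambda>x. x i)"
| add: "hom_poly_fun n d P \<Longrightarrow> hom_poly_fun n d Q \<Longrightarrow> hom_poly_fun n d (\<lambda>x. P x + Q x)"
| mult: "hom_poly_fun n d P \<Longrightarrow> hom_poly_fun n e Q \<Longrightarrow> hom_poly_fun n (d + e) (\<lambda>x. P x * Q x)"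

definition affine_space :: "nat \<Rightarrow> (nat \<Rightarrow> real) fspace" where
  "affine_space n =
     \<lparr> zariski = topology_generated_by {{x \<in> Rn n. P x \<noteq> 0} | P. poly_fun n P},
       sections = (\<lambda>U. {f. \<forall>x\<in>U. \<exists>P Q. poly_fun n P \<and> poly_fun n Q \<and> Q x \<noteq> 0 \<and>
                              (\<forall>z\<in>U. Q z \<noteq> 0 \<longrightarrow> f z = P z / Q z)}) \<rparr>"

text \<open>A point of \<open>\<P>\<^sup>n(\<real>)\<close> is a punctured line through the origin of \<open>\<real>\<^sup>n\<^sup>+\<^sup>1\<close>.\<close>

definition proj_points :: "nat \<Rightarrow> (nat \<Rightarrow> real) set set" where
  "proj_points n = {{(\<lambda>i. c * x i) | c. c \<noteq> 0} | x. x \<in> Rn (Suc n) \<and> x \<noteq> (\<lambda>_. 0)}"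

definition projective_space :: "nat \<Rightarrow> (nat \<Rightarrow> real) set fspace" where
  "projective_space n =
     \<lparr> zariski = topology_generated_by
         {{L \<in> proj_points n. \<forall>x\<in>L. P x \<noteq> 0} | P d. hom_poly_fun (Suc n) d P},
       sections = (\<lambda>U. {f. \<forall>L\<in>U. \<exists>d P Q. hom_poly_fun (Suc n) d P \<and> hom_poly_fun (Suc n) d Q \<and>
                              (\<forall>x\<in>L. Q x \<noteq> 0) \<and>
                              (\<forall>M\<in>U. \<forall>x\<in>M. Q x \<noteq> 0 \<longrightarrow> f M = P x / Q x)}) \<rparr>"


section \<open>Real algebraic varieties\<close>

definition real_algebraic_variety :: "'a fspace \<Rightarrow> bool" where
  "real_algebraic_variety X \<longleftrightarrow>
     sheaf_of_real_functions X \<and>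
     (\<exists>n U C. openin (zariski (projective_space n)) U \<and>
              closedin (zariski (projective_space n)) C \<and>
              isomorphic X (subspace_of (projective_space n) (U \<inter> C)))"

text \<open>
  The coarsest topology that refines the Zariski topology and makes all regular functions on
  Zariski open sets continuous; on a locally closed subset of affine or projective space it is the
  topology inherited from the usual one.
\<close>

definition euclidean_topology :: "'a fspace \<Rightarrow> 'a topology" where
  "euclidean_topology X = topology_generated_by
     {{x \<in> U. f x \<in> W} | U f W. openin (zariski X) U \<and> f \<in> sections X U \<and> open W}"

definition partial_deriv :: "nat \<Rightarrow> ((nat \<Rightarrow> real) \<Rightarrow> real) \<Rightarrow> (nat \<Rightarrow> real) \<Rightarrow> real" where
  "partial_deriv j P z = deriv (\<lambda>t. P (z(j := t))) (z j)"

text \<open>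
  A point \<open>z\<close> of an algebraic set \<open>V \<subseteq> \<real>\<^sup>n\<close> is nonsingular (of dimension \<open>n - k\<close>) if near \<open>z\<close> the
  set is cut out by \<open>k\<close> polynomials that vanish on \<open>V\<close> and have linearly independent gradients
  at \<open>z\<close>; the dimension may depend on the point.
\<close>

definition nonsingular_point :: "nat \<Rightarrow> (nat \<Rightarrow> real) set \<Rightarrow> (nat \<Rightarrow> real) \<Rightarrow> bool" where
  "nonsingular_point n V z \<longleftrightarrow>
     (\<exists>(k::nat) p U.
        (\<forall>i<k. poly_fun n (p i) \<and> (\<forall>x\<in>V. p i x = 0)) \<and>
        openin (zariski (affine_space n)) U \<and> z \<in> U \<and>
        V \<inter> U = {x \<in> U. \<forall>i<k. p i x = 0} \<and>
        (\<forall>c::nat \<Rightarrow> real. (\<forall>j<n. (\<Sum>i<k. c i * partial_deriv j (p i) z) = 0) \<longrightarrow>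
           (\<forall>i<k. c i = 0)))"

definition nonsingular :: "'a fspace \<Rightarrow> bool" where
  "nonsingular X \<longleftrightarrow>
     (\<exists>n V. closedin (zariski (affine_space n)) V \<and> isomorphic X (subspace_of (affine_space n) V) \<and>
            (\<forall>z\<in>V. nonsingular_point n V z))"


section \<open>Tangent spaces and submersions\<close>

definition regular_at :: "'a fspace \<Rightarrow> 'a \<Rightarrow> ('a \<Rightarrow> real) set" where
  "regular_at X x = {f. \<exists>U. openin (zariski X) U \<and> x \<in> U \<and> f \<in> sections X U}"

text \<open>
  Tangent vectors are the derivations at \<open>x\<close> of the local ring of germs of regular functions; the
  last condition says that \<open>D\<close> only depends on germs.  Values of \<open>D\<close> outside
  \<open>regular_at X x\<close> carry no meaning.
\<close>

definition tangent_vectors :: "'a fspace \<Rightarrow> 'a \<Rightarrow> (('a \<Rightarrow> real) \<Rightarrow> real) set" where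
  "tangent_vectors X x =
     {D. (\<forall>f\<in>regular_at X x. \<forall>g\<in>regular_at X x.
            D (\<lambda>z. f z + g z) = D f + D g \<and> D (\<lambda>z. f z * g z) = f x * D g + g x * D f) \<and>
         (\<forall>c. \<forall>f\<in>regular_at X x. D (\<lambda>z. c * f z) = c * D f) \<and>
         (\<forall>f\<in>regular_at X x. \<forall>g\<in>regular_at X x.
            (\<exists>U. openin (zariski X) U \<and> x \<in> U \<and> (\<forall>z\<in>U. f z = g z)) \<longrightarrow> D f = D g)}"

text \<open>
  Surjectivity of the differential \<open>\<delta> \<mapsto> (f \<mapsto> \<delta> (f \<circ> \<phi>))\<close> at \<open>x\<close>.  This is only used between
  nonsingular varieties, where these tangent spaces are those of the underlying manifolds.
\<close>

definition submersion_at :: "'a fspace \<Rightarrow> 'b fspace \<Rightarrow> ('a \<Rightarrow> 'b) \<Rightarrow> 'a \<Rightarrow> bool" where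
  "submersion_at X Y \<phi> x \<longleftrightarrow>
     (\<forall>D\<in>tangent_vectors Y (\<phi> x). \<exists>\<delta>\<in>tangent_vectors X x.
        \<forall>f\<in>regular_at Y (\<phi> x). D f = \<delta> (f \<circ> \<phi>))"


section \<open>Algebraic vector bundles and sprays\<close>

record ('e, 'y) vbundle =
  total :: "'e fspace"
  proj :: "'e \<Rightarrow> 'y"
  vzero :: "'y \<Rightarrow> 'e"
  vadd :: "'e \<Rightarrow> 'e \<Rightarrow> 'e"
  vscale :: "real \<Rightarrow> 'e \<Rightarrow> 'e"

definition fibre :: "('e, 'y) vbundle \<Rightarrow> 'y \<Rightarrow> 'e set" where
  "fibre B y = {v \<in> points (total B). proj B v = y}"

text \<open>
  \<open>F \<subseteq> Y \<times> \<real>\<^sup>n\<close> is an algebraic subbundle if, Zariski locally on \<open>Y\<close>, it has a regular frame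
  \<open>e\<^sub>0, \<dots>, e\<^sub>r\<^sub>-\<^sub>1\<close>: the fibre \<open>F\<^sub>z\<close> is a linear subspace with basis \<open>e\<^sub>0(z), \<dots>, e\<^sub>r\<^sub>-\<^sub>1(z)\<close>.
\<close>

definition algebraic_subbundle :: "'y fspace \<Rightarrow> nat \<Rightarrow> ('y \<times> (nat \<Rightarrow> real)) set \<Rightarrow> bool" where
  "algebraic_subbundle Y n F \<longleftrightarrow>
     F \<subseteq> points Y \<times> Rn n \<and>
     (\<forall>y\<in>points Y. \<exists>U (r::nat) (e :: nat \<Rightarrow> 'y \<Rightarrow> nat \<Rightarrow> real).
        openin (zariski Y) U \<and> y \<in> U \<and>
        (\<forall>i<r. \<forall>j<n. (\<lambda>z. e i z j) \<in> sections Y U) \<and>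
        (\<forall>z\<in>U. bij_betw (\<lambda>c j. \<Sum>i<r. c i * e i z j) (Rn r) {v. (z, v) \<in> F}))"

text \<open>
  The isomorphism \<open>\<phi>\<close> with a subbundle of \<open>Y \<times> \<real>\<^sup>n\<close> carries the operations on each fibre to those
  of a linear subspace of \<open>\<real>\<^sup>n\<close>, so the vector space axioms for the fibres and local triviality
  are implied.
\<close>

definition algebraic_vector_bundle :: "'y fspace \<Rightarrow> ('e, 'y) vbundle \<Rightarrow> bool" where
  "algebraic_vector_bundle Y B \<longleftrightarrow>
     real_algebraic_variety (total B) \<and>
     regular_map (total B) Y (proj B) \<and>
     (\<forall>y\<in>points Y. vzero B y \<in> fibre B y \<and>
        (\<forall>u\<in>fibre B y. \<forall>v\<in>fibre B y. vadd B u v \<in> fibre B y) \<and>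
        (\<forall>c. \<forall>v\<in>fibre B y. vscale B c v \<in> fibre B y)) \<and>
     (\<exists>n F \<phi>. algebraic_subbundle Y n F \<and>
        biregular (total B) (subspace_of (prod_fspace Y (affine_space n)) F) \<phi> \<and>
        (\<forall>v\<in>points (total B). fst (\<phi> v) = proj B v) \<and>
        (\<forall>y\<in>points Y. snd (\<phi> (vzero B y)) = (\<lambda>_. 0) \<and>
           (\<forall>u\<in>fibre B y. \<forall>v\<in>fibre B y.
              snd (\<phi> (vadd B u v)) = (\<lambda>j. snd (\<phi> u) j + snd (\<phi> v) j)) \<and>
           (\<forall>c. \<forall>v\<in>fibre B y. snd (\<phi> (vscale B c v)) = (\<lambda>j. c * snd (\<phi> v) j))))"

definition spray :: "'y fspace \<Rightarrow> ('e, 'y) vbundle \<Rightarrow> ('e \<Rightarrow> 'y) \<Rightarrow> bool" where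
  "spray Y B s \<longleftrightarrow>
     algebraic_vector_bundle Y B \<and> regular_map (total B) Y s \<and>
     (\<forall>y\<in>points Y. s (vzero B y) = y)"

definition dominating :: "'y fspace \<Rightarrow> ('e, 'y) vbundle \<Rightarrow> ('e \<Rightarrow> 'y) \<Rightarrow> bool" where
  "dominating Y B s \<longleftrightarrow>
     (\<forall>y\<in>points Y. submersion_at (subspace_of (total B) (fibre B y)) Y s (vzero B y))"

text \<open>
  The type argument is the type of the points of the total space of the bundle; a statement with
  hypothesis \<open>malleable TYPE('e) Y\<close> for a type variable \<open>'e\<close> covers bundles over all types.
\<close>

definition malleable :: "'e itself \<Rightarrow> 'y fspace \<Rightarrow> bool" where
  "malleable (_ :: 'e itself) Y \<longleftrightarrow>
     (\<exists>(B :: ('e, 'y) vbundle) s. spray Y B s \<and> dominating Y B s)"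


section \<open>Approximation in the compact-open topology\<close>

definition continuous_maps :: "'a topology \<Rightarrow> 'b topology \<Rightarrow> ('a \<Rightarrow> 'b) set" where
  "continuous_maps S T = {g \<in> extensional (topspace S). continuous_map S T g}"

definition compact_open_topology :: "'a topology \<Rightarrow> 'b topology \<Rightarrow> ('a \<Rightarrow> 'b) topology" where
  "compact_open_topology S T = topology_generated_by
     {{g \<in> continuous_maps S T. g ` K \<subseteq> W} | K W. compactin S K \<and> openin T W}"

definition approximable_by_regular_maps ::
    "'x fspace \<Rightarrow> 'y fspace \<Rightarrow> 'x set \<Rightarrow> ('x \<Rightarrow> 'y) \<Rightarrow> (('x \<Rightarrow> 'y) \<Rightarrow> bool) \<Rightarrow> bool" where
  "approximable_by_regular_maps X Y D f P \<longleftrightarrow>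
     (\<forall>\<U>. openin (compact_open_topology (subtopology (euclidean_topology X) D)
                   (euclidean_topology Y)) \<U> \<and> restrict f D \<in> \<U> \<longrightarrow>
        (\<exists>g. regular_map X Y g \<and> P g \<and> restrict g D \<in> \<U>))"

end

theory Submission
  imports Defs
begin

text \<open>
  Let \<open>K \<subseteq> D\<close> be compact, and call a regular map \<open>g : X \<rightarrow> Y\<close> admissible if it equals \<open>f\<^sub>0\<close> on \<open>A\<close>.
  Distances in \<open>Y\<close> are measured in an affine chart \<open>\<psi> : Y \<rightarrow> \<real>\<^sup>m\<close>.  The theorem follows from a
  bootstrap: for every compact \<open>C \<subseteq> Y\<close> there is \<open>r > 0\<close> such that a continuous map \<open>h : K \<rightarrow> C\<close>
  which equals \<open>f\<^sub>0\<close> on \<open>K \<inter> A\<close> and is \<open>r\<close>-close on \<open>K\<close> to one admissible map is, on \<open>K\<close>,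
  arbitrarily close to admissible maps (\<open>uniform_bootstrap\<close>).  Since \<open>r\<close> is the same for all
  stages of the homotopy, the set of parameters whose stage can be approximated is open and closed in
  \<open>[0,1]\<close>, and it contains \<open>0\<close> (\<open>homotopy_approximation\<close>).

  The bootstrap is a Newton iteration within regular maps.  Near a point \<open>y\<^sub>0\<close> the spray, composed
  with suitable global regular sections \<open>\<xi>\<^sub>0, \<dots>, \<xi>\<^sub>m\<^sub>-\<^sub>1\<close> of the bundle, gives a regular map
  \<open>\<sigma> : Y \<times> \<real>\<^sup>m \<rightarrow> Y\<close> with \<open>\<sigma>(y, 0) = y\<close> such that moving from \<open>y\<close> towards \<open>z\<close>, that is, passing
  to \<open>\<sigma>(y, t (\<psi> z - \<psi> y))\<close>, reduces the distance to \<open>z\<close> by the factor \<open>1 - t/2\<close> for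
  \<open>y\<close>, \<open>z\<close> near \<open>y\<^sub>0\<close> (\<open>correction_contracts\<close>).  Given an admissible \<open>g\<close> close to \<open>h\<close>, the map
  \<open>\<sigma>(g, a)\<close> is again admissible if \<open>a\<close> consists of regular functions vanishing on \<open>A\<close>; by a relative
  Stone-Weierstrass theorem (\<open>sections_approximation_relative\<close>) such an \<open>a\<close> can be taken close to
  \<open>t (\<psi> \<circ> h - \<psi> \<circ> g)\<close>, where \<open>t\<close> is a cutoff vanishing where \<open>h\<close> is far from \<open>y\<^sub>0\<close>.  Finitely many centres \<open>y\<^sub>0\<close>
  cover \<open>C\<close>, and performing the corresponding corrections one after another reduces the distance
  to \<open>h\<close> by the factor \<open>3/4\<close>.

  The sections \<open>\<xi>\<^sub>l\<close> come from domination.  Regular functions are strictly differentiable in the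
  chart, and their differentials are unique up to the null covectors, those that vanish to first order
  on differences \<open>\<psi> z - \<psi> y\<close>.  Hence a vector \<open>w\<close> annihilated by the null covectors
  defines a tangent vector of \<open>Y\<close> at \<open>y\<^sub>0\<close>.  Domination lifts it to a tangent vector of the fibre at
  \<open>0\<close>, which is a vector \<open>\<omega>\<close> of the fibre, and \<open>\<omega>\<close> is the value at \<open>y\<^sub>0\<close> of a global regular section
  (\<open>vector_field_extension\<close>).  The vectors \<open>w\<close> used are the columns of \<open>1 - \<mu>\<close>, where
  \<open>\<mu>\<close> projects onto the null covectors: on differences of points of \<open>Y\<close> near \<open>y\<^sub>0\<close>,
  the matrix \<open>1 - \<mu>\<close> is the identity to first order (\<open>tangent_frame\<close>, \<open>dominating_vector_fields\<close>).
\<close>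

section \<open>Spaces of real-valued functions\<close>

text \<open>
  Finite intersections of generators form a basis.  Since every open set is covered by
  generators, the intersection need not be the empty one.
\<close>
lemma generated_topology_nhd:
  assumes "openin (topology_generated_by S) U" and "p \<in> U"
  shows "\<exists>T. finite T \<and> T \<noteq> {} \<and> T \<subseteq> S \<and> p \<in> \<Inter>T \<and> \<Inter>T \<subseteq> U"
proof -
  have "generate_topology_on S U"
    using assms(1) by (simp add: openin_topology_generated_by_iff)
  then show ?thesis using assms(2)
  proof (induction)
    case Empty then show ?case by simp
  next
    case (Int a b)
    have "p \<in> a" "p \<in> b" using Int.prems by auto
    from Int.IH(1)[OF this(1)] obtain T1
      where 1: "finite T1 \<and> T1 \<noteq> {} \<and> T1 \<subseteq> S \<and> p \<in> \<Inter>T1 \<and> \<Inter>T1 \<subseteq> a" ..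
    from Int.IH(2)[OF \<open>p \<in> b\<close>] obtain T2
      where 2: "finite T2 \<and> T2 \<noteq> {} \<and> T2 \<subseteq> S \<and> p \<in> \<Inter>T2 \<and> \<Inter>T2 \<subseteq> b" ..
    show ?case
      using 1 2 by (intro exI[of _ "T1 \<union> T2"]) (simp add: Inter_Un_distrib, blast)
  next
    case (UN K)
    then obtain k where "k \<in> K" "p \<in> k" by blast
    from UN.IH[OF this] obtain T
      where "finite T \<and> T \<noteq> {} \<and> T \<subseteq> S \<and> p \<in> \<Inter>T \<and> \<Inter>T \<subseteq> k" ..
    with \<open>k \<in> K\<close> show ?case by (metis Sup_upper subset_trans)
  next
    case (Basis s)
    then show ?case by (intro exI[of _ "{s}"]) auto
  qed
qed

lemma openin_generator: "u \<in> S \<Longrightarrow> openin (topology_generated_by S) u"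
  by (rule topology_generated_by_Basis)

text \<open>
  The analogue of local rings for sheaves of real-valued functions: a section that does not vanish
  at a point is a unit near that point.
\<close>
definition nonvanishing_invertible :: "'a fspace \<Rightarrow> bool" where
  "nonvanishing_invertible Z \<longleftrightarrow>
     (\<forall>U f. openin (zariski Z) U \<and> f \<in> sections Z U \<longrightarrow>
        openin (zariski Z) {x \<in> U. f x \<noteq> 0} \<and>
        (\<lambda>x. inverse (f x)) \<in> sections Z {x \<in> U. f x \<noteq> 0})"

lemma sections_cong:
  assumes "sheaf_of_real_functions Z" "openin (zariski Z) U" "f \<in> sections Z U"
    "\<And>x. x \<in> U \<Longrightarrow> g x = f x"
  shows "g \<in> sections Z U"
  using assms(1)[unfolded sheaf_of_real_functions_def, THEN conjunct1, rule_format] assms(2-) by blast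

lemma sections_const:
  assumes "sheaf_of_real_functions Z" "openin (zariski Z) U"
  shows "(\<lambda>_. c) \<in> sections Z U"
  using assms(1)[unfolded sheaf_of_real_functions_def, THEN conjunct2, THEN conjunct1, rule_format] assms(2-) by blast

lemma sections_add:
  assumes "sheaf_of_real_functions Z" "openin (zariski Z) U" "f \<in> sections Z U" "g \<in> sections Z U"
  shows "(\<lambda>x. f x + g x) \<in> sections Z U"
  using assms(1)[unfolded sheaf_of_real_functions_def, THEN conjunct2, THEN conjunct2, THEN conjunct1, rule_format] assms(2-) by blast

lemma sections_mult:
  assumes "sheaf_of_real_functions Z" "openin (zariski Z) U" "f \<in> sections Z U" "g \<in> sections Z U"
  shows "(\<lambda>x. f x * g x) \<in> sections Z U"
  using assms(1)[unfolded sheaf_of_real_functions_def, THEN conjunct2, THEN conjunct2, THEN conjunct1, rule_format] assms(2-) by blast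

lemma sections_restrict:
  assumes "sheaf_of_real_functions Z" "openin (zariski Z) U" "openin (zariski Z) V" "V \<subseteq> U"
    "f \<in> sections Z U"
  shows "f \<in> sections Z V"
  using assms(1)[unfolded sheaf_of_real_functions_def, THEN conjunct2, THEN conjunct2, THEN conjunct2, THEN conjunct1, rule_format] assms(2-) by blast

lemma sections_glue:
  assumes "sheaf_of_real_functions Z" "openin (zariski Z) U"
    "\<And>x. x \<in> U \<Longrightarrow> \<exists>V. openin (zariski Z) V \<and> x \<in> V \<and> V \<subseteq> U \<and> f \<in> sections Z V"
  shows "f \<in> sections Z U"
  using assms(1)[unfolded sheaf_of_real_functions_def, THEN conjunct2, THEN conjunct2, THEN conjunct2, THEN conjunct2, rule_format] assms(2-) by blast

lemma sections_sum:
  assumes Z: "sheaf_of_real_functions Z" "openin (zariski Z) U"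
    and "\<And>i. i \<in> I \<Longrightarrow> f i \<in> sections Z U"
  shows "(\<lambda>x. \<Sum>i\<in>I. f i x) \<in> sections Z U"
  using assms(3)
proof (induction I rule: infinite_finite_induct)
  case (insert i I)
  then show ?case using sections_add[OF Z, of "f i" "\<lambda>x. \<Sum>i\<in>I. f i x"] by simp
qed (auto intro: sections_const Z)

lemma zariski_subspace [simp]: "zariski (subspace_of Z S) = subtopology (zariski Z) S"
  by (simp add: subspace_of_def)

lemma sections_subspace_iff:
  "f \<in> sections (subspace_of Z S) U \<longleftrightarrow>
    (\<forall>x\<in>U. \<exists>W g. openin (zariski Z) W \<and> x \<in> W \<and> g \<in> sections Z W \<and> (\<forall>z\<in>U \<inter> W. f z = g z))"
  by (simp add: subspace_of_def)

lemma sections_subspaceI: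
  assumes "openin (zariski Z) W" "g \<in> sections Z W" "U \<subseteq> W" "\<And>x. x \<in> U \<Longrightarrow> f x = g x"
  shows "f \<in> sections (subspace_of Z S) U"
  using assms unfolding sections_subspace_iff by (metis IntD1 subsetD)

lemma sections_subspaceE:
  assumes "f \<in> sections (subspace_of Z S) U" "x \<in> U"
  obtains W g where "openin (zariski Z) W" "x \<in> W" "g \<in> sections Z W" "\<forall>z\<in>U \<inter> W. f z = g z"
proof -
  obtain W g where "openin (zariski Z) W \<and> x \<in> W \<and> g \<in> sections Z W \<and> (\<forall>z\<in>U \<inter> W. f z = g z)"
    using assms(1)[unfolded sections_subspace_iff, rule_format, OF assms(2)] by (elim exE)
  then show thesis using that[of W g] by simp
qed

text \<open>
  Local representatives of the two sections have to be restricted to a common open set first.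
\<close>
lemma sections_subspace_binop:
  assumes Z: "sheaf_of_real_functions Z"
    and f: "f \<in> sections (subspace_of Z S) U" and g: "g \<in> sections (subspace_of Z S) U"
    and op: "\<And>W f g. openin (zariski Z) W \<Longrightarrow> f \<in> sections Z W \<Longrightarrow> g \<in> sections Z W \<Longrightarrow>
      (\<lambda>x. op (f x) (g x)) \<in> sections Z W"
  shows "(\<lambda>x. op (f x) (g x)) \<in> sections (subspace_of Z S) U"
  unfolding sections_subspace_iff
proof
  fix x assume x: "x \<in> U"
  obtain W f' where W: "openin (zariski Z) W" "x \<in> W" "f' \<in> sections Z W" "\<forall>z\<in>U \<inter> W. f z = f' z"
    using sections_subspaceE[OF f x] by blast
  obtain V g' where V: "openin (zariski Z) V" "x \<in> V" "g' \<in> sections Z V" "\<forall>z\<in>U \<inter> V. g z = g' z"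
    using sections_subspaceE[OF g x] by blast
  have o: "openin (zariski Z) (W \<inter> V)" using W V by blast
  have "(\<lambda>x. op (f' x) (g' x)) \<in> sections Z (W \<inter> V)"
    by (intro op o sections_restrict[OF Z W(1) o _ W(3)] sections_restrict[OF Z V(1) o _ V(3)]) auto
  then show "\<exists>W ga. openin (zariski Z) W \<and> x \<in> W \<and> ga \<in> sections Z W \<and> (\<forall>z\<in>U \<inter> W. op (f z) (g z) = ga z)"
    using o W V by (intro exI[of _ "W \<inter> V"] exI[of _ "\<lambda>x. op (f' x) (g' x)"]) auto
qed

lemma sheaf_subspace:
  assumes Z: "sheaf_of_real_functions Z"
  shows "sheaf_of_real_functions (subspace_of Z S)"
proof -
  let ?S = "subspace_of Z S"
  have 1: "g \<in> sections ?S U" if h: "f \<in> sections ?S U" "\<forall>x\<in>U. g x = f x" for U f g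
    unfolding sections_subspace_iff
  proof
    fix x assume x: "x \<in> U"
    obtain W k where "openin (zariski Z) W" "x \<in> W" "k \<in> sections Z W" "\<forall>z\<in>U \<inter> W. f z = k z"
      using sections_subspaceE[OF h(1) x] by blast
    then show "\<exists>W k. openin (zariski Z) W \<and> x \<in> W \<and> k \<in> sections Z W \<and> (\<forall>z\<in>U \<inter> W. g z = k z)"
      using that(2) by (intro exI[of _ W] exI[of _ k]) auto
  qed
  have 2: "(\<lambda>_. c) \<in> sections ?S U" if "openin (zariski ?S) U" for U and c :: real
  proof (rule sections_subspaceI)
    show "openin (zariski Z) (points Z)" by simp
    show "(\<lambda>_. c) \<in> sections Z (points Z)" by (rule sections_const[OF Z]) simp
    show "U \<subseteq> points Z" using openin_subset[OF that] by simp
  qed simp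
  have 3: "(\<lambda>x. f x + g x) \<in> sections ?S U" if "f \<in> sections ?S U" "g \<in> sections ?S U" for U f g
    by (rule sections_subspace_binop[where op = "(+)", OF Z that]) (rule sections_add[OF Z])
  have 4: "(\<lambda>x. f x * g x) \<in> sections ?S U" if "f \<in> sections ?S U" "g \<in> sections ?S U" for U f g
    by (rule sections_subspace_binop[where op = "(*)", OF Z that]) (rule sections_mult[OF Z])
  have 5: "f \<in> sections ?S V" if h: "V \<subseteq> U" "f \<in> sections ?S U" for U V f
    unfolding sections_subspace_iff
  proof
    fix x assume x: "x \<in> V"
    then obtain W g where "openin (zariski Z) W" "x \<in> W" "g \<in> sections Z W" "\<forall>z\<in>U \<inter> W. f z = g z"
      using sections_subspaceE[OF h(2), of x] h(1) by blast
    then show "\<exists>W g. openin (zariski Z) W \<and> x \<in> W \<and> g \<in> sections Z W \<and> (\<forall>z\<in>V \<inter> W. f z = g z)"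
      using that by (intro exI[of _ W] exI[of _ g]) auto
  qed
  have 6: "f \<in> sections ?S U" if U: "openin (zariski ?S) U"
    and loc: "\<forall>x\<in>U. \<exists>V. openin (zariski ?S) V \<and> x \<in> V \<and> V \<subseteq> U \<and> f \<in> sections ?S V" for U f
    unfolding sections_subspace_iff
  proof
    fix x assume x: "x \<in> U"
    then obtain V where V: "openin (zariski ?S) V" "x \<in> V" "V \<subseteq> U" "f \<in> sections ?S V" using loc by blast
    obtain W g where W: "openin (zariski Z) W" "x \<in> W" "g \<in> sections Z W" "\<forall>z\<in>V \<inter> W. f z = g z"
      using sections_subspaceE[OF V(4,2)] by blast
    obtain V' where V': "openin (zariski Z) V'" "V = V' \<inter> S" using V(1) by (auto simp: openin_subtopology)
    have US: "U \<subseteq> S" using openin_subset[OF U] by auto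
    have o: "openin (zariski Z) (W \<inter> V')" using W V' by blast
    show "\<exists>W g. openin (zariski Z) W \<and> x \<in> W \<and> g \<in> sections Z W \<and> (\<forall>z\<in>U \<inter> W. f z = g z)"
      using sections_restrict[OF Z W(1) o _ W(3)] W V V' o US
      by (intro exI[of _ "W \<inter> V'"] exI[of _ g]) auto
  qed
  show ?thesis
    unfolding sheaf_of_real_functions_def
    by (intro conjI allI impI; (elim conjE)?;
      ((rule 3; assumption) | (rule 4; assumption) | (rule 2; assumption) | (rule 1; assumption) |
       (rule 6; assumption) | (rule 5; assumption)))
qed

lemma nonvanishing_invertible_subspace:
  assumes Z: "nonvanishing_invertible Z"
  shows "nonvanishing_invertible (subspace_of Z S)"
  unfolding nonvanishing_invertible_def
proof (intro allI impI)
  let ?S = "subspace_of Z S"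
  fix U f assume h: "openin (zariski ?S) U \<and> f \<in> sections ?S U"
  let ?N = "{x \<in> U. f x \<noteq> 0}"
  have *: "\<exists>W g. openin (zariski Z) W \<and> x \<in> W \<and> g \<in> sections Z W \<and> (\<forall>z\<in>W. g z \<noteq> 0) \<and>
      (\<forall>z\<in>U \<inter> W. f z \<noteq> 0 \<and> inverse (f z) = g z)" if x: "x \<in> ?N" for x
  proof -
    obtain W g where W: "openin (zariski Z) W" "x \<in> W" "g \<in> sections Z W" "\<forall>z\<in>U \<inter> W. f z = g z"
      using sections_subspaceE[of f Z S U x] h x by blast
    show ?thesis
      using Z W x unfolding nonvanishing_invertible_def
      by (intro exI[of _ "{z \<in> W. g z \<noteq> 0}"] exI[of _ "\<lambda>z. inverse (g z)"]) auto
  qed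
  show "openin (zariski ?S) ?N \<and> (\<lambda>x. inverse (f x)) \<in> sections ?S ?N"
  proof
    show "openin (zariski ?S) ?N"
    proof (subst openin_subopen, intro ballI)
      fix x assume x: "x \<in> ?N"
      obtain W where W: "openin (zariski Z) W" "x \<in> W" "\<forall>z\<in>U \<inter> W. f z \<noteq> 0" using *[OF x] by blast
      have "openin (zariski ?S) (W \<inter> S)" using W(1) by (simp add: openin_subtopology_Int)
      then have "openin (zariski ?S) (U \<inter> (W \<inter> S))" using h by (blast intro: openin_Int)
      moreover have "U \<subseteq> S" using h openin_subset[of "zariski ?S" U] by auto
      ultimately show "\<exists>T. openin (zariski ?S) T \<and> x \<in> T \<and> T \<subseteq> ?N" using W x
        by (intro exI[of _ "U \<inter> (W \<inter> S)"]) auto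
    qed
    show "(\<lambda>x. inverse (f x)) \<in> sections ?S ?N"
      unfolding sections_subspace_iff using * by fastforce
  qed
qed

lemma regular_map_continuous: "regular_map X Y g \<Longrightarrow> continuous_map (zariski X) (zariski Y) g"
  by (simp add: regular_map_def)

lemma regular_map_points: "regular_map X Y g \<Longrightarrow> x \<in> points X \<Longrightarrow> g x \<in> points Y"
  by (auto simp: regular_map_def continuous_map_def)

lemma regular_map_openin:
  "regular_map X Y g \<Longrightarrow> openin (zariski Y) U \<Longrightarrow> openin (zariski X) {x \<in> points X. g x \<in> U}"
  by (simp add: regular_map_def continuous_map_def)

lemma regular_map_sections:
  "regular_map X Y g \<Longrightarrow> openin (zariski Y) U \<Longrightarrow> f \<in> sections Y U \<Longrightarrow>
    (\<lambda>x. f (g x)) \<in> sections X {x \<in> points X. g x \<in> U}"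
  by (auto simp add: regular_map_def o_def)

lemma regular_map_global_sections:
  assumes "regular_map X Y g" "f \<in> sections Y (points Y)"
  shows "(\<lambda>x. f (g x)) \<in> sections X (points X)"
proof -
  have "{x \<in> points X. g x \<in> points Y} = points X" using regular_map_points[OF assms(1)] by blast
  then show ?thesis using regular_map_sections[OF assms(1) _ assms(2)] by simp
qed

lemma regular_map_compose:
  assumes f: "regular_map X Y f" and g: "regular_map Y Z g"
  shows "regular_map X Z (\<lambda>x. g (f x))"
  unfolding regular_map_def
proof (intro conjI allI impI)
  show "continuous_map (zariski X) (zariski Z) (\<lambda>x. g (f x))"
    using continuous_map_compose[OF f[THEN regular_map_continuous] g[THEN regular_map_continuous]] by (simp add: o_def)
  fix U h assume h: "openin (zariski Z) U \<and> h \<in> sections Z U"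
  have "(\<lambda>x. h (g (f x))) \<in> sections X {x \<in> points X. f x \<in> {y \<in> points Y. g y \<in> U}}"
    using h by (intro regular_map_sections[OF f] regular_map_openin[OF g] regular_map_sections[OF g]) auto
  moreover have "{x \<in> points X. f x \<in> {y \<in> points Y. g y \<in> U}} = {x \<in> points X. g (f x) \<in> U}"
    using regular_map_points[OF f] by auto
  ultimately show "h \<circ> (\<lambda>x. g (f x)) \<in> sections X {x \<in> points X. g (f x) \<in> U}" by (simp add: o_def)
qed

lemma regular_map_into_subspace:
  assumes X: "sheaf_of_real_functions X" and g: "regular_map X Z g" and S: "\<And>x. x \<in> points X \<Longrightarrow> g x \<in> S"
  shows "regular_map X (subspace_of Z S) g"
  unfolding regular_map_def
proof (intro conjI allI impI)
  show c: "continuous_map (zariski X) (zariski (subspace_of Z S)) g"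
    using regular_map_continuous[OF g] S by (auto simp: continuous_map_in_subtopology)
  fix U f assume h: "openin (zariski (subspace_of Z S)) U \<and> f \<in> sections (subspace_of Z S) U"
  have U: "openin (zariski X) {x \<in> points X. g x \<in> U}" using h c by (simp add: continuous_map_def)
  show "f \<circ> g \<in> sections X {x \<in> points X. g x \<in> U}"
  proof (rule sections_glue[OF X U])
    fix x assume x: "x \<in> {x \<in> points X. g x \<in> U}"
    then obtain W k where W: "openin (zariski Z) W" "g x \<in> W" "k \<in> sections Z W" "\<forall>z\<in>U \<inter> W. f z = k z"
      using sections_subspaceE[of f Z S U "g x"] h by blast
    let ?V = "{x \<in> points X. g x \<in> U} \<inter> {x \<in> points X. g x \<in> W}"
    have o: "openin (zariski X) ?V" by (intro openin_Int U regular_map_openin[OF g] W)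
    have "(\<lambda>x. k (g x)) \<in> sections X ?V"
      by (rule sections_restrict[OF X regular_map_openin[OF g W(1)] o _ regular_map_sections[OF g W(1,3)]]) auto
    then have "f \<circ> g \<in> sections X ?V" by (rule sections_cong[OF X o]) (use W in auto)
    then show "\<exists>V. openin (zariski X) V \<and> x \<in> V \<and> V \<subseteq> {x \<in> points X. g x \<in> U} \<and> f \<circ> g \<in> sections X V"
      using o x W by (intro exI[of _ ?V]) auto
  qed
qed

text \<open>
  Sections of \<open>X\<close> are moved to \<open>Z\<close>, inverted there, and moved back.
\<close>
lemma nonvanishing_invertible_pullback:
  assumes X: "sheaf_of_real_functions X" and Z: "nonvanishing_invertible Z" and iso: "isomorphic X Z"
  shows "nonvanishing_invertible X"
  unfolding nonvanishing_invertible_def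
proof (intro allI impI)
  obtain \<phi> \<psi> where p: "regular_map X Z \<phi>" "regular_map Z X \<psi>" "\<And>x. x \<in> points X \<Longrightarrow> \<psi> (\<phi> x) = x"
    using iso unfolding isomorphic_def biregular_def by blast
  fix U f assume h: "openin (zariski X) U \<and> f \<in> sections X U"
  let ?V = "{z \<in> points Z. \<psi> z \<in> U}" and ?h = "\<lambda>z. f (\<psi> z)"
  have *: "openin (zariski Z) {z \<in> ?V. ?h z \<noteq> 0}" "(\<lambda>z. inverse (?h z)) \<in> sections Z {z \<in> ?V. ?h z \<noteq> 0}"
    using Z h regular_map_openin[OF p(2)] regular_map_sections[OF p(2)] unfolding nonvanishing_invertible_def by blast+
  have U: "U \<subseteq> points X" using h openin_subset by blast
  then have e: "{x \<in> points X. \<phi> x \<in> {z \<in> ?V. ?h z \<noteq> 0}} = {x \<in> U. f x \<noteq> 0}"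
    using p(3) regular_map_points[OF p(1)] by auto
  have o: "openin (zariski X) {x \<in> U. f x \<noteq> 0}" using regular_map_openin[OF p(1) *(1)] e by simp
  moreover have "(\<lambda>x. inverse (f x)) \<in> sections X {x \<in> U. f x \<noteq> 0}"
    using regular_map_sections[OF p(1) *(1) *(2), unfolded e] U p(3)
    by (elim sections_cong[OF X o]) auto
  ultimately show "openin (zariski X) {x \<in> U. f x \<noteq> 0} \<and> (\<lambda>x. inverse (f x)) \<in> sections X {x \<in> U. f x \<noteq> 0}" by blast
qed

section \<open>Global regular functions on real algebraic varieties\<close>

lemma hom_poly_fun_scale:
  "hom_poly_fun n d P \<Longrightarrow> P (\<lambda>i. c * x i) = c ^ d * P x"
  by (induction rule: hom_poly_fun.induct) (auto simp: power_add algebra_simps)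

lemma proj_pointsE:
  assumes "L \<in> proj_points n" "x \<in> L"
  shows "x \<in> Rn (Suc n)" "x \<noteq> (\<lambda>_. 0)" "L = {(\<lambda>i. c * x i) | c. c \<noteq> 0}"
proof -
  obtain y where y: "L = {(\<lambda>i. c * y i) | c. c \<noteq> 0}" "y \<in> Rn (Suc n)" "y \<noteq> (\<lambda>_. 0)"
    using assms(1) unfolding proj_points_def by blast
  obtain c where c: "x = (\<lambda>i. c * y i)" "c \<noteq> 0" using assms(2) y(1) by blast
  show "x \<in> Rn (Suc n)" using y(2) c by (simp add: Rn_def)
  obtain i where "y i \<noteq> 0" using y(3) by blast
  then have "x i \<noteq> 0" using c by simp
  then show "x \<noteq> (\<lambda>_. 0)" by auto
  show "L = {(\<lambda>i. c * x i) | c. c \<noteq> 0}"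
  proof (intro set_eqI iffI)
    fix z assume "z \<in> L"
    then obtain e where e: "z = (\<lambda>i. e * y i)" "e \<noteq> 0" using y(1) by blast
    have "z = (\<lambda>i. (e / c) * x i)" "e / c \<noteq> 0" using e c by auto
    then show "z \<in> {(\<lambda>i. c * x i) | c. c \<noteq> 0}" by blast
  next
    fix z assume "z \<in> {(\<lambda>i. c * x i) | c. c \<noteq> 0}"
    then obtain e where e: "z = (\<lambda>i. e * x i)" "e \<noteq> 0" by blast
    have "z = (\<lambda>i. (e * c) * y i)" "e * c \<noteq> 0" using e c by (auto simp: mult.assoc)
    then show "z \<in> L" unfolding y(1) by blast
  qed
qed

lemma proj_points_nonempty: "L \<in> proj_points n \<Longrightarrow> \<exists>x. x \<in> L"
proof -
  assume "L \<in> proj_points n"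
  then obtain y where y: "L = {(\<lambda>i. c * y i) | c. c \<noteq> 0}" unfolding proj_points_def by blast
  have "(\<lambda>i. 1 * y i) \<in> L" unfolding y by (rule CollectI) (intro exI[of _ 1], simp)
  then show ?thesis by blast
qed

lemma proj_scaled:
  assumes "L \<in> proj_points n" "x \<in> L" "y \<in> L"
  obtains c where "c \<noteq> 0" "y = (\<lambda>i. c * x i)"
  using proj_pointsE(3)[OF assms(1,2)] assms(3) by blast

lemma proj_nonzero_iff:
  assumes "L \<in> proj_points n" "hom_poly_fun (Suc n) d P" "x \<in> L" "y \<in> L"
  shows "P y \<noteq> 0 \<longleftrightarrow> P x \<noteq> 0"
  by (rule proj_scaled[OF assms(1,3,4)]) (simp add: hom_poly_fun_scale[OF assms(2)])

text \<open>
  The reason why quotients of homogeneous polynomials of the same degree are functions on projective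
  space.
\<close>
lemma proj_ratio:
  assumes "L \<in> proj_points n" "hom_poly_fun (Suc n) d P" "hom_poly_fun (Suc n) d Q" "x \<in> L" "y \<in> L"
  shows "P y / Q y = P x / Q x"
  by (rule proj_scaled[OF assms(1,4,5)])
    (simp add: hom_poly_fun_scale[OF assms(2)] hom_poly_fun_scale[OF assms(3)])

abbreviation proj_basic_open :: "nat \<Rightarrow> ((nat \<Rightarrow> real) \<Rightarrow> real) \<Rightarrow> (nat \<Rightarrow> real) set set" where
  "proj_basic_open n P \<equiv> {L \<in> proj_points n. \<forall>x\<in>L. P x \<noteq> 0}"

lemma zariski_projective:
  "zariski (projective_space n) =
    topology_generated_by {proj_basic_open n P | P d. hom_poly_fun (Suc n) d P}"
  by (simp add: projective_space_def)

lemma openin_proj_basic_open: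
  "hom_poly_fun (Suc n) d P \<Longrightarrow> openin (zariski (projective_space n)) (proj_basic_open n P)"
  unfolding zariski_projective by (rule openin_generator) blast

lemma points_projective: "points (projective_space n) = proj_points n"
proof
  show "points (projective_space n) \<subseteq> proj_points n"
    unfolding zariski_projective topology_generated_by_topspace by blast
  have "proj_basic_open n (\<lambda>_. 1) = proj_points n" by auto
  then show "proj_points n \<subseteq> points (projective_space n)"
    using openin_subset[OF openin_proj_basic_open[OF hom_poly_fun.const[of "Suc n" 1]]] by simp
qed

lemma sections_projective_iff:
  "f \<in> sections (projective_space n) U \<longleftrightarrow>
    (\<forall>L\<in>U. \<exists>d P Q. hom_poly_fun (Suc n) d P \<and> hom_poly_fun (Suc n) d Q \<and> (\<forall>x\<in>L. Q x \<noteq> 0) \<and>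
       (\<forall>M\<in>U. \<forall>x\<in>M. Q x \<noteq> 0 \<longrightarrow> f M = P x / Q x))"
  by (simp add: projective_space_def)

lemma nonvanishing_invertible_projective: "nonvanishing_invertible (projective_space n)"
  unfolding nonvanishing_invertible_def
proof (intro allI impI)
  let ?Z = "projective_space n"
  fix U f assume h: "openin (zariski ?Z) U \<and> f \<in> sections ?Z U"
  let ?N = "{L \<in> U. f L \<noteq> 0}"
  have U: "U \<subseteq> proj_points n" using h openin_subset points_projective by blast
  have *: "\<exists>d P Q. hom_poly_fun (Suc n) d P \<and> hom_poly_fun (Suc n) d Q \<and> (\<forall>x\<in>L. P x \<noteq> 0) \<and> (\<forall>x\<in>L. Q x \<noteq> 0) \<and>
       (\<forall>M\<in>U. \<forall>x\<in>M. Q x \<noteq> 0 \<longrightarrow> f M = P x / Q x)" if L: "L \<in> ?N" for L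
  proof -
    obtain d P Q where PQ: "hom_poly_fun (Suc n) d P" "hom_poly_fun (Suc n) d Q" "\<forall>x\<in>L. Q x \<noteq> 0"
       "\<forall>M\<in>U. \<forall>x\<in>M. Q x \<noteq> 0 \<longrightarrow> f M = P x / Q x"
      using h L unfolding sections_projective_iff by blast
    have "P x \<noteq> 0" if "x \<in> L" for x using PQ(3,4) that L by force
    then show ?thesis using PQ by blast
  qed
  show "openin (zariski ?Z) ?N \<and> (\<lambda>x. inverse (f x)) \<in> sections ?Z ?N"
  proof
    show "openin (zariski ?Z) ?N"
    proof (subst openin_subopen, intro ballI)
      fix L assume L: "L \<in> ?N"
      obtain d P Q where PQ: "hom_poly_fun (Suc n) d P" "hom_poly_fun (Suc n) d Q" "\<forall>x\<in>L. P x \<noteq> 0" "\<forall>x\<in>L. Q x \<noteq> 0"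
         "\<forall>M\<in>U. \<forall>x\<in>M. Q x \<noteq> 0 \<longrightarrow> f M = P x / Q x" using *[OF L] by blast
      let ?T = "U \<inter> (proj_basic_open n P \<inter> proj_basic_open n Q)"
      have o: "openin (zariski ?Z) ?T"
        using h openin_proj_basic_open[OF PQ(1)] openin_proj_basic_open[OF PQ(2)] by (blast intro: openin_Int)
      have s: "f M \<noteq> 0" if M: "M \<in> ?T" for M
      proof -
        obtain x where "x \<in> M" using proj_points_nonempty M by blast
        then show ?thesis using M PQ(5) by auto
      qed
      show "\<exists>T. openin (zariski ?Z) T \<and> L \<in> T \<and> T \<subseteq> ?N"
        using o s L U PQ by (intro exI[of _ ?T]) auto
    qed
    show "(\<lambda>x. inverse (f x)) \<in> sections ?Z ?N"
      unfolding sections_projective_iff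
    proof
      fix L assume L: "L \<in> ?N"
      obtain d P Q where PQ: "hom_poly_fun (Suc n) d P" "hom_poly_fun (Suc n) d Q" "\<forall>x\<in>L. P x \<noteq> 0" "\<forall>x\<in>L. Q x \<noteq> 0"
         "\<forall>M\<in>U. \<forall>x\<in>M. Q x \<noteq> 0 \<longrightarrow> f M = P x / Q x" using *[OF L] by blast
      \<comment> \<open>The quotient is extended by \<open>Q\<close>, because nothing is known about \<open>f\<close> where \<open>Q\<close> vanishes.\<close>
      have "hom_poly_fun (Suc n) (d + d) (\<lambda>x. Q x * Q x)" "hom_poly_fun (Suc n) (d + d) (\<lambda>x. P x * Q x)"
        using PQ by (auto intro: hom_poly_fun.mult)
      then show "\<exists>d P Q. hom_poly_fun (Suc n) d P \<and> hom_poly_fun (Suc n) d Q \<and> (\<forall>x\<in>L. Q x \<noteq> 0) \<and>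
       (\<forall>M\<in>?N. \<forall>x\<in>M. Q x \<noteq> 0 \<longrightarrow> inverse (f M) = P x / Q x)"
        using PQ by (intro exI[of _ "d + d"] exI[of _ "\<lambda>x. Q x * Q x"] exI[of _ "\<lambda>x. P x * Q x"]) auto
    qed
  qed
qed

lemma hom_poly_fun_norm_square: "hom_poly_fun n 2 (\<lambda>x. \<Sum>i<k. x i * x i)" if "k \<le> n"
  using that
proof (induction k)
  case 0 then show ?case by (simp add: hom_poly_fun.zero)
next
  case (Suc k)
  then have "hom_poly_fun n (1 + 1) (\<lambda>x. x k * x k)" by (intro hom_poly_fun.mult hom_poly_fun.coord) auto
  then have "hom_poly_fun n 2 (\<lambda>x. x k * x k)" by (simp add: numeral_2_eq_2)
  then show ?case using Suc by (auto intro!: hom_poly_fun.add)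
qed

lemma hom_poly_fun_power: "hom_poly_fun n d P \<Longrightarrow> hom_poly_fun n (k * d) (\<lambda>x. P x ^ k)"
proof (induction k)
  case 0 then show ?case using hom_poly_fun.const[of n 1] by simp
next
  case (Suc k) then show ?case using hom_poly_fun.mult[of n d P "k * d" "\<lambda>x. P x ^ k"] by simp
qed

lemma proj_basic_open_Inter:
  assumes "finite T" "T \<subseteq> {proj_basic_open n P | P d. hom_poly_fun (Suc n) d P}" "L \<in> \<Inter>T"
  shows "\<exists>d P. hom_poly_fun (Suc n) d P \<and> (\<forall>x\<in>L. P x \<noteq> 0) \<and> proj_basic_open n P \<subseteq> \<Inter>T"
  using assms
proof (induction T)
  case empty
  then show ?case using hom_poly_fun.const[of "Suc n" 1] by (intro exI[of _ 0] exI[of _ "\<lambda>_. 1"]) auto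
next
  case (insert B T)
  then obtain d P where P: "hom_poly_fun (Suc n) d P" "\<forall>x\<in>L. P x \<noteq> 0" "proj_basic_open n P \<subseteq> \<Inter>T" by auto
  obtain e Q where Q: "hom_poly_fun (Suc n) e Q" "B = proj_basic_open n Q" using insert.prems by blast
  have "\<forall>x\<in>L. Q x \<noteq> 0" using insert.prems Q by auto
  then show ?case using hom_poly_fun.mult[OF P(1) Q(1)] P Q
    by (intro exI[of _ "d + e"] exI[of _ "\<lambda>x. P x * Q x"]) auto
qed

text \<open>
  If \<open>P\<close> is homogeneous of degree \<open>d\<close>, then \<open>P(x)\<^sup>2 / \<bar>x\<bar>\<^sup>2\<^sup>d\<close> is regular on the whole
  projective space and has the same zeros as \<open>P\<close>.  Thus global regular functions detect the Zariski
  topology, as they do on an affine variety.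
\<close>
lemma projective_cutoff_section:
  assumes U: "openin (zariski (projective_space n)) U" and L: "L \<in> U"
  shows "\<exists>a\<in>sections (projective_space n) (proj_points n).
    a L \<noteq> 0 \<and> (\<forall>M\<in>proj_points n. a M \<noteq> 0 \<longrightarrow> M \<in> U)"
proof -
  obtain T where T: "finite T" "T \<subseteq> {proj_basic_open n P | P d. hom_poly_fun (Suc n) d P}" "L \<in> \<Inter>T" "\<Inter>T \<subseteq> U"
    using generated_topology_nhd[OF U[unfolded zariski_projective] L] by auto
  obtain d P where P: "hom_poly_fun (Suc n) d P" "\<forall>x\<in>L. P x \<noteq> 0" "proj_basic_open n P \<subseteq> \<Inter>T"
    using proj_basic_open_Inter[OF T(1-3)] by blast
  define N where "N = (\<lambda>x::nat \<Rightarrow> real. \<Sum>i<Suc n. x i * x i)"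
  define P2 where "P2 = (\<lambda>x. P x ^ 2)"
  define Nd where "Nd = (\<lambda>x. N x ^ d)"
  have h2: "hom_poly_fun (Suc n) (2 * d) P2" unfolding P2_def by (rule hom_poly_fun_power[OF P(1)])
  have hN: "hom_poly_fun (Suc n) (2 * d) Nd" unfolding Nd_def N_def
    using hom_poly_fun_power[OF hom_poly_fun_norm_square[of "Suc n" "Suc n"], of d] by (simp add: mult.commute)
  have N0: "Nd x \<noteq> 0" if h: "M \<in> proj_points n" "x \<in> M" for M x
  proof -
    obtain i where i: "x i \<noteq> 0" using proj_pointsE(2)[OF h] by blast
    then have "i < Suc n" using proj_pointsE(1)[OF h] unfolding Rn_def by (metis (mono_tags) mem_Collect_eq not_le)
    then have "0 < x i * x i" "x i * x i \<le> N x" using i unfolding N_def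
      by (auto intro!: member_le_sum simp: zero_less_mult_iff simp del: sum.lessThan_Suc)
    then show ?thesis unfolding Nd_def by simp
  qed
  define a where "a = (\<lambda>M. P2 (SOME x. x \<in> M) / Nd (SOME x. x \<in> M))"
  have a: "a M = P2 x / Nd x" if "M \<in> proj_points n" "x \<in> M" for M x
  proof -
    have "(SOME x. x \<in> M) \<in> M" using someI[of "\<lambda>x. x \<in> M", OF that(2)] .
    then show ?thesis unfolding a_def using proj_ratio[OF that(1) h2 hN that(2)] by simp
  qed
  have Lp: "L \<in> proj_points n" using U L openin_subset points_projective by blast
  obtain x where x: "x \<in> L" using proj_points_nonempty[OF Lp] by blast
  have "a L \<noteq> 0" using a[OF Lp x] N0[OF Lp x] P(2) x by (auto simp: P2_def)
  moreover have "M \<in> U" if M: "M \<in> proj_points n" "a M \<noteq> 0" for M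
  proof -
    obtain y where y: "y \<in> M" using proj_points_nonempty[OF M(1)] by blast
    have "P y \<noteq> 0" using a[OF M(1) y] M(2) by (auto simp: P2_def)
    then have "M \<in> proj_basic_open n P" using proj_nonzero_iff[OF M(1) P(1) y] M(1) by blast
    then show ?thesis using P(3) T(4) by blast
  qed
  moreover have "a \<in> sections (projective_space n) (proj_points n)"
    unfolding sections_projective_iff using h2 hN N0 a by blast
  ultimately show ?thesis by blast
qed

text \<open>
  The linear form \<open>z \<mapsto> z\<^sub>i x'\<^sub>j - z\<^sub>j x'\<^sub>i\<close> vanishes on the line through \<open>x'\<close>, and for suitable
  \<open>i\<close>, \<open>j\<close> it does not vanish on the line through \<open>x\<close>.
\<close>
lemma projective_T1:
  assumes L: "L \<in> proj_points n" "L' \<in> proj_points n" "L \<noteq> L'"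
  shows "\<exists>U. openin (zariski (projective_space n)) U \<and> L \<in> U \<and> L' \<notin> U"
proof -
  obtain x x' where x: "x \<in> L" "x' \<in> L'" using proj_points_nonempty L by blast
  have "\<exists>i j. x i * x' j \<noteq> x j * x' i"
  proof (rule ccontr)
    assume "\<not> ?thesis"
    then have e: "x i * x' j = x j * x' i" for i j by blast
    obtain j where j: "x' j \<noteq> 0" using proj_pointsE(2)[OF L(2) x(2)] by blast
    have xe: "x = (\<lambda>i. (x j / x' j) * x' i)" using e j by (auto simp: field_simps fun_eq_iff)
    have "x j \<noteq> 0"
    proof
      assume "x j = 0"
      then have "x = (\<lambda>_. 0)" using xe by simp
      then show False using proj_pointsE(2)[OF L(1) x(1)] by simp
    qed
    then have "x j / x' j \<noteq> 0" using j by simp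
    then have "x \<in> L'" using xe proj_pointsE(3)[OF L(2) x(2)] by blast
    then show False using proj_pointsE(3)[OF L(2)] proj_pointsE(3)[OF L(1) x(1)] L(3) by blast
  qed
  then obtain i j where ij: "x i * x' j \<noteq> x j * x' i" by blast
  have lt: "i < Suc n \<and> j < Suc n"
  proof (rule ccontr)
    assume "\<not> ?thesis"
    then have "x i = 0 \<and> x' i = 0 \<or> x j = 0 \<and> x' j = 0"
      using proj_pointsE(1)[OF L(1) x(1)] proj_pointsE(1)[OF L(2) x(2)] unfolding Rn_def
      by (metis (mono_tags) mem_Collect_eq not_le)
    then show False using ij by auto
  qed
  define P where "P = (\<lambda>z::nat \<Rightarrow> real. z i * x' j + z j * (- x' i))"
  have P: "hom_poly_fun (Suc n) (1 + 0) P" unfolding P_def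
    using lt by (intro hom_poly_fun.add hom_poly_fun.mult hom_poly_fun.coord hom_poly_fun.const) auto
  have p: "P x \<noteq> 0" "P x' = 0" using ij by (auto simp: P_def)
  have "\<forall>y\<in>L. P y \<noteq> 0" using proj_nonzero_iff[OF L(1) P x(1)] p(1) by blast
  then have "L \<in> proj_basic_open n P" using L(1) by blast
  moreover have "L' \<notin> proj_basic_open n P" using p(2) x(2) by blast
  ultimately show ?thesis using openin_proj_basic_open[OF P] by blast
qed

lemma variety_nonvanishing_invertible:
  assumes "real_algebraic_variety X"
  shows "nonvanishing_invertible X"
  using assms nonvanishing_invertible_pullback nonvanishing_invertible_subspace nonvanishing_invertible_projective
  unfolding real_algebraic_variety_def by blast

lemma variety_sheaf: "real_algebraic_variety X \<Longrightarrow> sheaf_of_real_functions X"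
  by (simp add: real_algebraic_variety_def)

lemma variety_embedding:
  assumes "real_algebraic_variety X"
  obtains n S \<phi> \<psi> where "S \<subseteq> proj_points n" "regular_map X (subspace_of (projective_space n) S) \<phi>"
    "regular_map (subspace_of (projective_space n) S) X \<psi>"
    "\<forall>x\<in>points X. \<phi> x \<in> S \<and> \<psi> (\<phi> x) = x" "points (subspace_of (projective_space n) S) = S"
proof -
  obtain n U C where U: "openin (zariski (projective_space n)) U"
    and iso: "isomorphic X (subspace_of (projective_space n) (U \<inter> C))"
    using assms unfolding real_algebraic_variety_def by blast
  obtain \<phi> \<psi> where p: "regular_map X (subspace_of (projective_space n) (U \<inter> C)) \<phi>"
    "regular_map (subspace_of (projective_space n) (U \<inter> C)) X \<psi>" "\<forall>x\<in>points X. \<psi> (\<phi> x) = x"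
    using iso unfolding isomorphic_def biregular_def by blast
  have S: "U \<inter> C \<subseteq> proj_points n" using openin_subset[OF U] points_projective by blast
  moreover have e: "points (subspace_of (projective_space n) (U \<inter> C)) = U \<inter> C" using S by (auto simp: points_projective)
  moreover have "\<forall>x\<in>points X. \<phi> x \<in> U \<inter> C \<and> \<psi> (\<phi> x) = x"
    using p(3) regular_map_points[OF p(1)] e by blast
  ultimately show thesis using that[of "U \<inter> C" n \<phi> \<psi>] p by blast
qed

lemma variety_cutoff_section:
  assumes X: "real_algebraic_variety X" and U: "openin (zariski X) U" and x: "x \<in> U"
  shows "\<exists>a\<in>sections X (points X). a x \<noteq> 0 \<and> (\<forall>z\<in>points X. a z \<noteq> 0 \<longrightarrow> z \<in> U)"
proof -
  obtain n S \<phi> \<psi> where e: "S \<subseteq> proj_points n" "regular_map X (subspace_of (projective_space n) S) \<phi>"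
    "regular_map (subspace_of (projective_space n) S) X \<psi>"
    "\<forall>x\<in>points X. \<phi> x \<in> S \<and> \<psi> (\<phi> x) = x" "points (subspace_of (projective_space n) S) = S"
    by (rule variety_embedding[OF X])
  have xp: "x \<in> points X" using U x openin_subset by blast
  have "openin (zariski (subspace_of (projective_space n) S)) {z \<in> S. \<psi> z \<in> U}"
    using regular_map_openin[OF e(3) U] unfolding e(5) .
  then obtain W where W: "openin (zariski (projective_space n)) W" "{z \<in> S. \<psi> z \<in> U} = W \<inter> S"
    unfolding zariski_subspace openin_subtopology by blast
  have "\<phi> x \<in> W" using W(2) xp e(4) x by auto
  then obtain a where a: "a \<in> sections (projective_space n) (proj_points n)" "a (\<phi> x) \<noteq> 0"
    "\<forall>M\<in>proj_points n. a M \<noteq> 0 \<longrightarrow> M \<in> W" using projective_cutoff_section[OF W(1)] by blast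
  have "a \<in> sections (subspace_of (projective_space n) S) S"
    by (rule sections_subspaceI[OF _ a(1)]) (use e(1) in \<open>simp_all flip: points_projective\<close>)
  then have "(\<lambda>x. a (\<phi> x)) \<in> sections X (points X)"
    using regular_map_global_sections[OF e(2)] e(5) by simp
  moreover have "z \<in> U" if "z \<in> points X" "a (\<phi> z) \<noteq> 0" for z
  proof -
    have "\<phi> z \<in> W \<inter> S" using that a(3) e(1,4) by blast
    then show ?thesis using W(2) that e(4) by force
  qed
  ultimately show ?thesis using a(2) by (intro bexI[of _ "\<lambda>x. a (\<phi> x)"]) auto
qed

lemma variety_separating_section:
  assumes X: "real_algebraic_variety X" and x: "x \<in> points X" "x' \<in> points X" "x \<noteq> x'"
  shows "\<exists>a\<in>sections X (points X). a x \<noteq> a x'"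
proof -
  obtain n S \<phi> \<psi> where e: "S \<subseteq> proj_points n" "regular_map X (subspace_of (projective_space n) S) \<phi>"
    "regular_map (subspace_of (projective_space n) S) X \<psi>"
    "\<forall>x\<in>points X. \<phi> x \<in> S \<and> \<psi> (\<phi> x) = x" "points (subspace_of (projective_space n) S) = S"
    by (rule variety_embedding[OF X])
  have "\<phi> x \<noteq> \<phi> x'" using x e(4) by metis
  then obtain W where W: "openin (zariski (projective_space n)) W" "\<phi> x \<in> W" "\<phi> x' \<notin> W"
    using projective_T1 e(1,4) x by (meson subsetD)
  have "openin (zariski (subspace_of (projective_space n) S)) (W \<inter> S)"
    using W(1) by (simp add: openin_subtopology_Int)
  from regular_map_openin[OF e(2) this]
  have o: "openin (zariski X) {z \<in> points X. \<phi> z \<in> W \<inter> S}" .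
  have "x \<in> {z \<in> points X. \<phi> z \<in> W \<inter> S}" using x W e(4) by blast
  from variety_cutoff_section[OF X o this] obtain a where "a \<in> sections X (points X)" "a x \<noteq> 0"
    "\<forall>z\<in>points X. a z \<noteq> 0 \<longrightarrow> z \<in> {z \<in> points X. \<phi> z \<in> W \<inter> S}" by blast
  then show ?thesis using x W(3) by (intro bexI[of _ a]) force+
qed

section \<open>Approximation by global regular functions\<close>

text \<open>
  Arbitrary products of Hausdorff spaces are Hausdorff.  This is what the Stone-Weierstrass theorem
  asks of the type in which the compact set lies; that type will be a product of real lines
  indexed by the global regular functions.  Coherence of the class hierarchy requires
  the instances for \<open>T\<^sub>0\<close> and \<open>T\<^sub>1\<close> first.
\<close>
lemma open_coordinate_preimage:
  "open W \<Longrightarrow> open {h :: 'a \<Rightarrow> 'b::topological_space. h i \<in> W}"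
  using open_vimage[OF _ continuous_on_product_coordinates[of i], of W] by (simp add: vimage_def)

instance "fun" :: (type, t0_space) t0_space
proof
  fix f g :: "'a \<Rightarrow> 'b" assume "f \<noteq> g"
  then obtain i where i: "f i \<noteq> g i" by blast
  then obtain U where "open U" "\<not> (f i \<in> U \<longleftrightarrow> g i \<in> U)" using t0_space_class.t0_space[OF i] by auto
  then show "\<exists>U. open U \<and> \<not> (f \<in> U \<longleftrightarrow> g \<in> U)"
    using open_coordinate_preimage[of U i] by (intro exI[of _ "{h. h i \<in> U}"]) auto
qed

instance "fun" :: (type, t1_space) t1_space
proof
  fix f g :: "'a \<Rightarrow> 'b" assume "f \<noteq> g"
  then obtain i where i: "f i \<noteq> g i" by blast
  then obtain U where "open U" "f i \<in> U" "g i \<notin> U" using t1_space_class.t1_space[OF i] by auto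
  then show "\<exists>U. open U \<and> f \<in> U \<and> g \<notin> U"
    using open_coordinate_preimage[of U i] by (intro exI[of _ "{h. h i \<in> U}"]) auto
qed

instance "fun" :: (type, t2_space) t2_space
proof
  fix f g :: "'a \<Rightarrow> 'b" assume "f \<noteq> g"
  then obtain i where i: "f i \<noteq> g i" by blast
  then obtain U V where "open U" "open V" "f i \<in> U" "g i \<in> V" "U \<inter> V = {}" using hausdorff[OF i] by auto
  then show "\<exists>U V. open U \<and> open V \<and> f \<in> U \<and> g \<in> V \<and> U \<inter> V = {}"
    using open_coordinate_preimage[of U i] open_coordinate_preimage[of V i]
    by (intro exI[of _ "{h. h i \<in> U}"] exI[of _ "{h. h i \<in> V}"]) auto
qed

lemma openin_euclidean_generator:
  "openin (zariski X) U \<Longrightarrow> f \<in> sections X U \<Longrightarrow> open W \<Longrightarrow>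
    openin (euclidean_topology X) {x \<in> U. f x \<in> W}"
  unfolding euclidean_topology_def by (rule openin_generator) blast

lemma openin_euclidean_of_zariski:
  assumes "sheaf_of_real_functions X" "openin (zariski X) U"
  shows "openin (euclidean_topology X) U"
  using openin_euclidean_generator[OF assms(2) sections_const[OF assms, of 0] open_UNIV] by simp

lemma topspace_euclidean_topology:
  assumes "sheaf_of_real_functions X"
  shows "topspace (euclidean_topology X) = points X"
proof
  show "topspace (euclidean_topology X) \<subseteq> points X"
    unfolding euclidean_topology_def topology_generated_by_topspace using openin_subset by blast
  show "points X \<subseteq> topspace (euclidean_topology X)"
    using openin_euclidean_of_zariski[OF assms, of "points X"] openin_subset by blast
qed

lemma continuous_map_section:
  assumes X: "sheaf_of_real_functions X" and f: "f \<in> sections X (points X)"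
  shows "continuous_map (euclidean_topology X) euclideanreal f"
  unfolding continuous_map_def
proof (intro conjI allI impI)
  fix U :: "real set" assume "openin euclideanreal U"
  then show "openin (euclidean_topology X) {x \<in> topspace (euclidean_topology X). f x \<in> U}"
    unfolding topspace_euclidean_topology[OF X]
    using openin_euclidean_generator[OF openin_topspace f, of U] by simp
qed simp

lemma regular_map_euclidean_continuous:
  assumes X: "sheaf_of_real_functions X" and Y: "sheaf_of_real_functions Y" and g: "regular_map X Y g"
  shows "continuous_map (euclidean_topology X) (euclidean_topology Y) g"
  unfolding euclidean_topology_def[of Y]
proof (rule continuous_on_generated_topo)
  fix S assume "S \<in> {{x \<in> U. f x \<in> W} | U f W. openin (zariski Y) U \<and> f \<in> sections Y U \<and> open W}"
  then obtain U f W where S: "S = {x \<in> U. f x \<in> W}" "openin (zariski Y) U" "f \<in> sections Y U" "open W" by blast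
  have "openin (euclidean_topology X) {x \<in> {x \<in> points X. g x \<in> U}. f (g x) \<in> W}"
    by (rule openin_euclidean_generator[OF regular_map_openin[OF g S(2)] regular_map_sections[OF g S(2,3)] S(4)])
  moreover have "{x \<in> {x \<in> points X. g x \<in> U}. f (g x) \<in> W} = g -` S \<inter> topspace (euclidean_topology X)"
    by (auto simp: S(1) topspace_euclidean_topology[OF X])
  ultimately show "openin (euclidean_topology X) (g -` S \<inter> topspace (euclidean_topology X))" by simp
next
  have "g ` points X \<subseteq> topspace (euclidean_topology Y)"
    using regular_map_points[OF g] topspace_euclidean_topology[OF Y] by auto
  then show "g ` topspace (euclidean_topology X) \<subseteq> \<Union> {{x \<in> U. f x \<in> W} | U f W. openin (zariski Y) U \<and> f \<in> sections Y U \<and> open W}"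
    unfolding topspace_euclidean_topology[OF X] by (simp add: euclidean_topology_def topology_generated_by_topspace)
qed

text \<open>
  Global regular functions separate points, so evaluating them maps \<open>K\<close> bijectively onto a compact
  subset of a product of real lines.  A bijection from a compact space onto a Hausdorff space is a
  quotient map, hence \<open>v\<close> becomes a continuous function on the image, where the Stone-Weierstrass
  theorem applies.
\<close>
lemma sections_approximation:
  assumes X: "real_algebraic_variety X" and K: "compactin (euclidean_topology X) K"
    and v: "continuous_map (subtopology (euclidean_topology X) K) euclideanreal v" and e: "0 < (e::real)"
  shows "\<exists>f\<in>sections X (points X). \<forall>x\<in>K. \<bar>v x - f x\<bar> < e"
proof -
  note sh = variety_sheaf[OF X]
  define G where "G = sections X (points X)"
  define T where "T = subtopology (euclidean_topology X) K"
  have KX: "K \<subseteq> points X" using compactin_subset_topspace[OF K] topspace_euclidean_topology[OF sh] by simp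
  have topT: "topspace T = K" using compactin_subset_topspace[OF K] by (auto simp: T_def)
  have cT: "compact_space T" unfolding T_def by (rule compact_space_subtopology[OF K])
  have fT: "continuous_map T euclideanreal f" if "f \<in> G" for f
    using continuous_map_section[OF sh] that unfolding T_def G_def by (blast intro: continuous_map_from_subtopology)
  define \<iota> where "\<iota> = (\<lambda>x f. if f \<in> G then f x else (0::real))"
  define S where "S = \<iota> ` K"
  have inj: "x = y" if h: "x \<in> K" "y \<in> K" "\<iota> x = \<iota> y" for x y
  proof (rule ccontr)
    assume "x \<noteq> y"
    then obtain a where "a \<in> G" "a x \<noteq> a y" using variety_separating_section[OF X] KX h(1,2) unfolding G_def by blast
    then show False using fun_cong[OF h(3), of a] by (simp add: \<iota>_def)
  qed
  have ci: "continuous_map T euclidean \<iota>"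
    unfolding euclidean_product_topology[symmetric] continuous_map_componentwise_UNIV
  proof
    fix f show "continuous_map T euclideanreal (\<lambda>x. \<iota> x f)" using fT[of f] by (cases "f \<in> G") (simp_all add: \<iota>_def)
  qed
  have compS: "compact S"
    using image_compactin[OF _ ci, of K] cT topT unfolding S_def compact_space_def by simp
  have ciS: "continuous_map T (top_of_set S) \<iota>"
    using ci topT by (auto simp: continuous_map_in_subtopology S_def)
  have "Hausdorff_space (euclidean :: (('a \<Rightarrow> real) \<Rightarrow> real) topology)"
    unfolding Hausdorff_space_def disjnt_def open_openin[symmetric]
    by (metis hausdorff)
  then have hS: "Hausdorff_space (top_of_set S)" by (rule Hausdorff_space_subtopology)
  have q: "quotient_map T (top_of_set S) \<iota>"
    by (rule continuous_closed_imp_quotient_map[OF ciS continuous_imp_closed_map[OF ciS cT hS]])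
      (simp add: topT flip: S_def)
  define u where "u = (\<lambda>w. v (inv_into K \<iota> w))"
  have u: "u (\<iota> x) = v x" if "x \<in> K" for x
    unfolding u_def using inj that by (subst inv_into_f_f) (auto intro: inj_onI)
  have "continuous_map T euclideanreal (u \<circ> \<iota>)"
    by (rule continuous_map_eq[OF v[folded T_def]]) (simp add: topT u)
  then have "continuous_map (top_of_set S) euclideanreal u"
    using continuous_compose_quotient_map_eq[OF q] by blast
  then have cu: "continuous_on S u" by simp
  define R where "R = {p. continuous_on S p \<and> (\<exists>f\<in>G. \<forall>x\<in>K. p (\<iota> x) = f x)}"
  have pt: "openin (zariski X) (points X)" by simp
  interpret R: function_ring_on R S
  proof
    show "compact S" by (rule compS)
    show "continuous_on S p" if "p \<in> R" for p using that by (simp add: R_def)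
    show "(\<lambda>w. p w + q w) \<in> R" if h: "p \<in> R" "q \<in> R" for p q
    proof -
      obtain f g where fg: "f \<in> G" "\<forall>x\<in>K. p (\<iota> x) = f x" "g \<in> G" "\<forall>x\<in>K. q (\<iota> x) = g x" using h unfolding R_def by blast
      have "(\<lambda>x. f x + g x) \<in> G" using sections_add[OF sh pt] fg unfolding G_def by blast
      then show ?thesis using h fg unfolding R_def by (auto intro!: continuous_on_add bexI[of _ "\<lambda>x. f x + g x"])
    qed
    show "(\<lambda>w. p w * q w) \<in> R" if h: "p \<in> R" "q \<in> R" for p q
    proof -
      obtain f g where fg: "f \<in> G" "\<forall>x\<in>K. p (\<iota> x) = f x" "g \<in> G" "\<forall>x\<in>K. q (\<iota> x) = g x" using h unfolding R_def by blast
      have "(\<lambda>x. f x * g x) \<in> G" using sections_mult[OF sh pt] fg unfolding G_def by blast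
      then show ?thesis using h fg unfolding R_def by (auto intro!: continuous_on_mult bexI[of _ "\<lambda>x. f x * g x"])
    qed
    show "(\<lambda>_. c) \<in> R" for c
      unfolding R_def using sections_const[OF sh pt, of c] by (auto simp: G_def intro!: bexI[of _ "\<lambda>_. c"])
    show "\<exists>p\<in>R. p w \<noteq> p z" if h: "w \<in> S" "z \<in> S" "w \<noteq> z" for w z
    proof -
      obtain f where f: "w f \<noteq> z f" using h(3) by blast
      obtain x y where xy: "x \<in> K" "y \<in> K" "w = \<iota> x" "z = \<iota> y" using h unfolding S_def by blast
      have "f \<in> G" using f xy by (auto simp: \<iota>_def split: if_splits)
      moreover have "continuous_on S (\<lambda>w. w f)"
        by (rule continuous_on_subset[OF continuous_on_product_coordinates]) simp
      ultimately have "(\<lambda>w. w f) \<in> R" unfolding R_def by (auto simp: \<iota>_def intro!: bexI[of _ f])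
      then show ?thesis using f by (intro bexI[of _ "\<lambda>w. w f"]) auto
    qed
  qed
  obtain p where p: "p \<in> R" "\<forall>w\<in>S. \<bar>u w - p w\<bar> < e" using R.Stone_Weierstrass_basic[OF cu e] by blast
  then obtain f where f: "f \<in> G" "\<forall>x\<in>K. p (\<iota> x) = f x" unfolding R_def by blast
  have "\<forall>x\<in>K. \<bar>v x - f x\<bar> < e" using p(2) f(2) u unfolding S_def by force
  then show ?thesis using f(1) unfolding G_def by blast
qed

text \<open>
  The set where \<open>\<bar>v\<bar> \<ge> e/2\<close> is compact and disjoint from \<open>A\<close>, so a finite sum \<open>b\<close> of squares of
  regular functions vanishing on \<open>A\<close> is at least some \<open>c > 0\<close> there.  If \<open>f\<close> approximates
  \<open>v / max b c\<close>, then \<open>b f\<close> vanishes on \<open>A\<close> and approximates \<open>v\<close>: at points with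
  \<open>b < c\<close> both \<open>v\<close> and \<open>b v / c\<close> are small.
\<close>
lemma sections_approximation_relative:
  assumes X: "real_algebraic_variety X" and K: "compactin (euclidean_topology X) K"
    and A: "closedin (zariski X) A"
    and v: "continuous_map (subtopology (euclidean_topology X) K) euclideanreal v"
    and vA: "\<And>x. x \<in> K \<Longrightarrow> x \<in> A \<Longrightarrow> v x = 0" and e: "0 < (e::real)"
  shows "\<exists>f\<in>sections X (points X). (\<forall>x\<in>A. f x = 0) \<and> (\<forall>x\<in>K. \<bar>f x - v x\<bar> < e)"
proof -
  note sh = variety_sheaf[OF X]
  define T where "T = subtopology (euclidean_topology X) K"
  have KX: "K \<subseteq> points X" using compactin_subset_topspace[OF K] topspace_euclidean_topology[OF sh] by simp
  have topT: "topspace T = K" using compactin_subset_topspace[OF K] by (auto simp: T_def)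
  have cT: "compact_space T" unfolding T_def by (rule compact_space_subtopology[OF K])
  have vT: "continuous_map T euclideanreal v" using v unfolding T_def .
  have fT: "continuous_map T euclideanreal f" if "f \<in> sections X (points X)" for f
    using continuous_map_section[OF sh] that unfolding T_def by (blast intro: continuous_map_from_subtopology)
  have AX: "A \<subseteq> points X" using A closedin_subset by blast
  define L where "L = {x \<in> K. v x \<notin> {-e/2<..<e/2}}"
  have "closedin T {x \<in> topspace T. v x \<in> - {-e/2<..<e/2}}"
    by (rule closedin_continuous_map_preimage[OF vT]) (auto simp: closed_Compl)
  then have cL: "compactin T L" using closedin_compact_space[OF cT] topT by (simp add: L_def)
  have cover: "\<exists>a\<in>sections X (points X). a x \<noteq> 0 \<and> (\<forall>z\<in>A. a z = 0)" if x: "x \<in> L" for x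
  proof -
    have xA: "x \<in> points X - A" using x vA KX e unfolding L_def by force
    have "openin (zariski X) (points X - A)" using A by (simp add: openin_diff)
    from variety_cutoff_section[OF X this xA] show ?thesis using AX by blast
  qed
  then obtain a where a: "\<And>x. x \<in> L \<Longrightarrow> a x \<in> sections X (points X) \<and> a x x \<noteq> 0 \<and> (\<forall>z\<in>A. a x z = 0)" by metis
  define N where "N = (\<lambda>x. {z \<in> topspace T. a x z \<in> - {0}})"
  have oN: "openin T (N x)" if "x \<in> L" for x
    unfolding N_def using a[OF that] by (intro openin_continuous_map_preimage[OF fT]) auto
  have LK: "L \<subseteq> K" by (auto simp: L_def)
  have "L \<subseteq> \<Union> (N ` L)" using a LK topT by (auto simp: N_def)
  then obtain I where I: "finite I" "I \<subseteq> L" "L \<subseteq> \<Union> (N ` I)"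
    using cL oN unfolding compactin_def by (metis (no_types, lifting) finite_subset_image imageE)
  define b where "b = (\<lambda>z. \<Sum>i\<in>I. a i z * a i z)"
  have b: "b \<in> sections X (points X)" unfolding b_def
    using I a by (intro sections_sum[OF sh] sections_mult[OF sh]) auto
  have bA: "b z = 0" if "z \<in> A" for z unfolding b_def using a I that by (auto intro!: sum.neutral)
  have b0: "0 \<le> b z" for z unfolding b_def by (auto intro: sum_nonneg)
  have bL: "0 < b z" if z: "z \<in> L" for z
  proof -
    obtain i where i: "i \<in> I" "z \<in> N i" using I(3) z by blast
    then have "a i z * a i z \<le> b z" unfolding b_def by (intro member_le_sum) (auto simp: I)
    moreover have "0 < a i z * a i z" using i by (auto simp: N_def zero_less_mult_iff)
    ultimately show ?thesis by simp
  qed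
  have "compact (b ` L)" using image_compactin[OF cL fT[OF b]] by simp
  then obtain c where c: "0 < c" "\<And>z. z \<in> L \<Longrightarrow> c \<le> b z"
    using compact_attains_inf[of "b ` L"] bL
    by (cases "L = {}") (auto intro: zero_less_one that)
  have "compact (b ` K)" using image_compactin[OF K continuous_map_section[OF sh b]] by simp
  then obtain M where M: "0 < M" "\<And>z. z \<in> K \<Longrightarrow> b z \<le> M"
    using compact_imp_bounded[of "b ` K"] unfolding bounded_pos by (metis abs_le_D1 image_eqI real_norm_def)
  \<comment> \<open>Equal to \<open>v / b\<close> on \<open>L\<close>, and continuous on the whole of \<open>K\<close>.\<close>
  define w where "w = (\<lambda>z. v z / max (b z) c)"
  have "continuous_map T euclideanreal w"
    unfolding w_def using c(1) by (intro continuous_map_real_divide continuous_map_real_max vT fT[OF b]) auto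
  then obtain f where f: "f \<in> sections X (points X)" "\<And>x. x \<in> K \<Longrightarrow> \<bar>w x - f x\<bar> < e / (2 * M)"
    using sections_approximation[OF X K, of w "e / (2 * M)"] e M(1) unfolding T_def by auto
  have "\<bar>b x * f x - v x\<bar> < e" if x: "x \<in> K" for x
  proof -
    have 1: "\<bar>b x * w x - v x\<bar> < e / 2 \<or> b x * w x = v x"
    proof (cases "c \<le> b x")
      case True
      then have "b x * w x = v x" using c(1) by (simp add: w_def max_def)
      then show ?thesis ..
    next
      case False
      then have "x \<notin> L" using c(2) by force
      then have ve: "\<bar>v x\<bar> < e / 2" using x by (auto simp: L_def abs_if)
      have r: "0 \<le> b x / c" "b x / c \<le> 1" using False c(1) b0 by (auto simp: field_simps)
      have "b x * w x - v x = (b x / c - 1) * v x" using False by (simp add: w_def max_def field_simps)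
      then have "\<bar>b x * w x - v x\<bar> = \<bar>b x / c - 1\<bar> * \<bar>v x\<bar>" by (simp add: abs_mult)
      also have "\<dots> \<le> 1 * \<bar>v x\<bar>" using r by (intro mult_right_mono) auto
      finally show ?thesis using ve by simp
    qed
    have "\<bar>b x * f x - b x * w x\<bar> = b x * \<bar>w x - f x\<bar>" using b0[of x] by (metis abs_minus_commute abs_mult abs_of_nonneg right_diff_distrib)
    also have "\<dots> \<le> M * \<bar>w x - f x\<bar>" using M(2)[OF x] by (intro mult_right_mono) auto
    also have "\<dots> < M * (e / (2 * M))" using M(1) f(2)[OF x] by (intro mult_strict_left_mono) auto
    also have "\<dots> = e / 2" using M(1) by simp
    finally have "\<bar>b x * f x - b x * w x\<bar> < e / 2" .
    then show ?thesis using 1 by linarith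
  qed
  moreover have "(\<lambda>x. b x * f x) \<in> sections X (points X)" using b f by (intro sections_mult[OF sh]) auto
  ultimately show ?thesis using bA by (intro bexI[of _ "\<lambda>x. b x * f x"]) auto
qed

section \<open>Projections onto linear subspaces\<close>

definition linear_subspace :: "(nat \<Rightarrow> real) set \<Rightarrow> bool" where
  "linear_subspace S \<longleftrightarrow> (\<lambda>_. 0) \<in> S \<and>
     (\<forall>u\<in>S. \<forall>v\<in>S. (\<lambda>j. u j + v j) \<in> S) \<and> (\<forall>c. \<forall>u\<in>S. (\<lambda>j. c * u j) \<in> S)"

lemma linear_subspace_zero: "linear_subspace S \<Longrightarrow> (\<lambda>_. 0) \<in> S"
  by (simp add: linear_subspace_def)

lemma linear_subspace_add: "linear_subspace S \<Longrightarrow> u \<in> S \<Longrightarrow> v \<in> S \<Longrightarrow> (\<lambda>j. u j + v j) \<in> S"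
  by (simp add: linear_subspace_def)

lemma linear_subspace_scale: "linear_subspace S \<Longrightarrow> u \<in> S \<Longrightarrow> (\<lambda>j. c * u j) \<in> S"
  by (simp add: linear_subspace_def)

lemma linear_subspace_sum:
  assumes S: "linear_subspace S" and u: "\<And>i. i \<in> I \<Longrightarrow> u i \<in> S"
  shows "(\<lambda>j. \<Sum>i\<in>I. c i * u i j) \<in> S"
  using u
proof (induction I rule: infinite_finite_induct)
  case (insert i I)
  have "(\<lambda>j. c i * u i j) \<in> S" by (rule linear_subspace_scale[OF S]) (simp add: insert)
  moreover have "(\<lambda>j. \<Sum>i\<in>I. c i * u i j) \<in> S" by (rule insert.IH) (simp add: insert)
  ultimately have "(\<lambda>j. c i * u i j + (\<Sum>i\<in>I. c i * u i j)) \<in> S" by (rule linear_subspace_add[OF S])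
  then show ?case using insert by simp
qed (use S in \<open>simp_all add: linear_subspace_def\<close>)

text \<open>
  A projection of \<open>\<real>\<^sup>m\<close> onto \<open>S\<close>, written as a matrix with rows in \<open>S\<close>.  Induction on \<open>m\<close>: the
  vectors of \<open>S\<close> with last coordinate \<open>0\<close> form a subspace of \<open>\<real>\<^sup>m\<^sup>-\<^sup>1\<close>, and if some \<open>a \<in> S\<close> has last
  coordinate \<open>1\<close>, then subtracting a multiple of \<open>a\<close> moves every vector of \<open>S\<close> into it.
\<close>
lemma projection_matrix:
  assumes "linear_subspace S" and "S \<subseteq> Rn m"
  shows "\<exists>\<mu>. (\<forall>j<m. \<mu> j \<in> S) \<and> (\<forall>v\<in>S. \<forall>l. v l = (\<Sum>j<m. v j * \<mu> j l))"
  using assms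
proof (induction m arbitrary: S)
  case 0
  then show ?case by (auto simp: Rn_def)
next
  case (Suc m)
  define S0 where "S0 = {v \<in> S. v m = 0}"
  have "linear_subspace S0" using Suc.prems(1) unfolding linear_subspace_def S0_def by simp
  moreover have "S0 \<subseteq> Rn m"
  proof
    fix v assume v: "v \<in> S0"
    have "v i = 0" if "i \<ge> m" for i
      using that v Suc.prems(2) unfolding S0_def Rn_def by (cases "i = m") auto
    then show "v \<in> Rn m" by (simp add: Rn_def)
  qed
  ultimately obtain \<mu> where "(\<forall>j<m. \<mu> j \<in> S0) \<and> (\<forall>v\<in>S0. \<forall>l. v l = (\<Sum>j<m. v j * \<mu> j l))"
    using Suc.IH[of S0] by auto
  then have \<mu>: "\<forall>j<m. \<mu> j \<in> S0" "\<And>v l. v \<in> S0 \<Longrightarrow> v l = (\<Sum>j<m. v j * \<mu> j l)" by auto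
  show ?case
  proof (cases "S0 = S")
    case True
    have "(\<lambda>_. 0) \<in> S" using Suc.prems(1) by (simp add: linear_subspace_def)
    then show ?thesis
      using \<mu> True by (intro exI[of _ "\<mu>(m := (\<lambda>_. 0))"]) (auto simp: less_Suc_eq)
  next
    case False
    then obtain a0 where a0: "a0 \<in> S" "a0 m \<noteq> 0" by (auto simp: S0_def)
    define a where "a = (\<lambda>l. inverse (a0 m) * a0 l)"
    have a: "a \<in> S" "a m = 1"
      using a0 linear_subspace_scale[OF Suc.prems(1) a0(1), of "inverse (a0 m)"] by (auto simp: a_def)
    define b where "b = (\<lambda>l. a l + -1 * (\<Sum>j<m. a j * \<mu> j l))"
    have "(\<lambda>l. \<Sum>j<m. a j * \<mu> j l) \<in> S"
      using \<mu>(1) by (intro linear_subspace_sum[OF Suc.prems(1)]) (auto simp: S0_def)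
    then have "(\<lambda>l. -1 * (\<Sum>j<m. a j * \<mu> j l)) \<in> S"
      by (rule linear_subspace_scale[OF Suc.prems(1)])
    then have b: "b \<in> S" unfolding b_def by (rule linear_subspace_add[OF Suc.prems(1) a(1)])
    have "v l = (\<Sum>j<m. v j * \<mu> j l) + v m * b l" if v: "v \<in> S" for v l
    proof -
      have "(\<lambda>l. - v m * a l) \<in> S" by (rule linear_subspace_scale[OF Suc.prems(1) a(1)])
      then have "(\<lambda>l. v l + - v m * a l) \<in> S" by (rule linear_subspace_add[OF Suc.prems(1) v])
      then have "(\<lambda>l. v l + - v m * a l) \<in> S0" using a(2) by (simp add: S0_def)
      from \<mu>(2)[OF this, of l] have "v l - v m * a l = (\<Sum>j<m. (v j - v m * a j) * \<mu> j l)" by simp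
      also have "\<dots> = (\<Sum>j<m. v j * \<mu> j l) - v m * (\<Sum>j<m. a j * \<mu> j l)"
        by (simp add: algebra_simps sum_subtractf sum_distrib_left)
      finally show ?thesis by (simp add: b_def algebra_simps)
    qed
    then show ?thesis using b \<mu>(1)
      by (intro exI[of _ "\<mu>(m := b)"]) (auto simp: less_Suc_eq S0_def)
  qed
qed

section \<open>Strict differentiability\<close>

text \<open>
  The neighbourhood filter of \<open>p\<close> in \<open>S\<close> for the pseudometric given by the coordinates \<open>e\<close>.
\<close>
definition near :: "'p set \<Rightarrow> nat \<Rightarrow> ('p \<Rightarrow> nat \<Rightarrow> real) \<Rightarrow> 'p \<Rightarrow> 'p filter" where
  "near S N e p = inf (filtercomap (\<lambda>q. \<Sum>j<N. \<bar>e q j - e p j\<bar>) (nhds 0)) (principal S)"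

lemma eventually_near:
  "eventually P (near S N e p) \<longleftrightarrow> (\<exists>\<eta>>0. \<forall>q\<in>S. (\<Sum>j<N. \<bar>e q j - e p j\<bar>) < \<eta> \<longrightarrow> P q)"
proof
  assume "eventually P (near S N e p)"
  then obtain Q where Q: "eventually Q (nhds (0::real))" "\<And>q. Q (\<Sum>j<N. \<bar>e q j - e p j\<bar>) \<Longrightarrow> q \<in> S \<Longrightarrow> P q"
    unfolding near_def eventually_inf_principal eventually_filtercomap by auto
  then obtain \<eta> where "\<eta> > 0" "\<And>r. dist r 0 < \<eta> \<Longrightarrow> Q r" unfolding eventually_nhds_metric by blast
  then show "\<exists>\<eta>>0. \<forall>q\<in>S. (\<Sum>j<N. \<bar>e q j - e p j\<bar>) < \<eta> \<longrightarrow> P q"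
    using Q(2) by (intro exI[of _ \<eta>]) (auto simp: sum_nonneg)
next
  assume "\<exists>\<eta>>0. \<forall>q\<in>S. (\<Sum>j<N. \<bar>e q j - e p j\<bar>) < \<eta> \<longrightarrow> P q"
  then obtain \<eta> where \<eta>: "\<eta> > 0" "\<forall>q\<in>S. (\<Sum>j<N. \<bar>e q j - e p j\<bar>) < \<eta> \<longrightarrow> P q" by blast
  have "eventually (\<lambda>r. r < \<eta>) (nhds 0)" using \<eta>(1) by (intro eventually_nhds_in_open[of "{..<\<eta>}", simplified])
  then show "eventually P (near S N e p)"
    unfolding near_def eventually_inf_principal eventually_filtercomap using \<eta>(2) by blast
qed

lemma eventually_near_mem: "eventually (\<lambda>q. q \<in> S) (near S N e p)"
  unfolding eventually_near by (intro exI[of _ 1]) simp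

lemma tendsto_near_coordinate:
  assumes "j < N"
  shows "((\<lambda>q. e q j) \<longlongrightarrow> e p j) (near S N e p)"
proof (rule tendstoI)
  fix \<epsilon> :: real assume "\<epsilon> > 0"
  moreover have "\<bar>e q j - e p j\<bar> \<le> (\<Sum>j<N. \<bar>e q j - e p j\<bar>)" for q
    using assms by (intro member_le_sum) auto
  ultimately show "eventually (\<lambda>q. dist (e q j) (e p j) < \<epsilon>) (near S N e p)"
    unfolding eventually_near dist_real_def by (intro exI[of _ \<epsilon>]) (meson le_less_trans)
qed

lemma filterlim_near:
  assumes "\<And>j. j < N \<Longrightarrow> ((\<lambda>x. e (g x) j) \<longlongrightarrow> e p j) F" and "eventually (\<lambda>x. g x \<in> S) F"
  shows "filterlim g (near S N e p) F"
proof -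
  have "((\<lambda>x. \<Sum>j<N. \<bar>e (g x) j - e p j\<bar>) \<longlongrightarrow> (\<Sum>j<N. \<bar>e p j - e p j\<bar>)) F"
    by (intro tendsto_intros assms(1)) simp
  then have l: "((\<lambda>x. \<Sum>j<N. \<bar>e (g x) j - e p j\<bar>) \<longlongrightarrow> 0) F" by simp
  show ?thesis
    unfolding filterlim_iff
  proof (intro allI impI)
    fix P assume "eventually P (near S N e p)"
    then obtain \<eta> where \<eta>: "\<eta> > 0" "\<forall>q\<in>S. (\<Sum>j<N. \<bar>e q j - e p j\<bar>) < \<eta> \<longrightarrow> P q" unfolding eventually_near by blast
    have "eventually (\<lambda>x. (\<Sum>j<N. \<bar>e (g x) j - e p j\<bar>) < \<eta>) F" by (rule order_tendstoD(2)[OF l \<eta>(1)])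
    then show "eventually (\<lambda>x. P (g x)) F" using assms(2) by eventually_elim (use \<eta>(2) in auto)
  qed
qed

text \<open>
  Strict differentiability at \<open>p\<close> with respect to the coordinates \<open>e\<close>, with increments taken over
  the pairs of points described by the filter \<open>F\<close>.  Pairs of points of \<open>Y\<close> close to \<open>p\<close> give
  the differential of a function on \<open>Y\<close>; pairs of points in the same fibre of a
  bundle give the differential along the fibres, uniformly in the base point.  The notion is stable
  under the field operations, so it passes from the coordinates to all regular functions.
\<close>
definition strictly_diff ::
  "nat \<Rightarrow> ('p \<Rightarrow> nat \<Rightarrow> real) \<Rightarrow> ('p \<times> 'p) filter \<Rightarrow> 'p \<Rightarrow> ('p \<Rightarrow> real) \<Rightarrow> (nat \<Rightarrow> real) \<Rightarrow> bool" where
  "strictly_diff N e F p h l \<longleftrightarrow>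
     ((\<lambda>w. h (fst w)) \<longlongrightarrow> h p) F \<and> ((\<lambda>w. h (snd w)) \<longlongrightarrow> h p) F \<and>
     (\<lambda>w. h (fst w) - h (snd w) - (\<Sum>j<N. l j * (e (fst w) j - e (snd w) j)))
        \<in> o[F](\<lambda>w. \<Sum>j<N. \<bar>e (fst w) j - e (snd w) j\<bar>)"

lemma tendsto_imp_bigo_1: "(f \<longlongrightarrow> c) F \<Longrightarrow> f \<in> O[F](\<lambda>_. 1 :: real)" for f :: "'a \<Rightarrow> real"
  by (rule bigoI_tendsto[of f "\<lambda>_. 1" c]) simp_all

lemma tendsto_0_imp_smallo_1: "(f \<longlongrightarrow> 0) F \<Longrightarrow> f \<in> o[F](\<lambda>_. 1 :: real)" for f :: "'a \<Rightarrow> real"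
  by (rule smalloI_tendsto[of f "\<lambda>_. 1"]) simp_all

lemma linear_bigo_increment:
  fixes N :: nat
  shows "(\<lambda>w. \<Sum>j<N. l j * (e (fst w) j - e (snd w) j)) \<in> O[F](\<lambda>w. \<Sum>j<N. \<bar>e (fst w) j - e (snd w) j :: real\<bar>)"
proof (rule bigoI[of _ "\<Sum>j<N. \<bar>l j\<bar>"], intro always_eventually allI)
  fix w
  have "\<bar>\<Sum>j<N. l j * (e (fst w) j - e (snd w) j)\<bar> \<le> (\<Sum>j<N. \<bar>l j\<bar> * \<bar>e (fst w) j - e (snd w) j\<bar>)"
    by (rule order_trans[OF sum_abs]) (simp add: abs_mult)
  also have "\<dots> \<le> (\<Sum>j<N. (\<Sum>j<N. \<bar>l j\<bar>) * \<bar>e (fst w) j - e (snd w) j\<bar>)"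
    by (intro sum_mono mult_right_mono member_le_sum[of _ "{..<N}" "\<lambda>j. \<bar>l j\<bar>"]) simp_all
  also have "\<dots> = (\<Sum>j<N. \<bar>l j\<bar>) * (\<Sum>j<N. \<bar>e (fst w) j - e (snd w) j\<bar>)"
    by (simp add: sum_distrib_left)
  finally show "norm (\<Sum>j<N. l j * (e (fst w) j - e (snd w) j)) \<le> (\<Sum>j<N. \<bar>l j\<bar>) * norm (\<Sum>j<N. \<bar>e (fst w) j - e (snd w) j\<bar>)"
    by (simp add: sum_nonneg)
qed

lemma strictly_diff_const: "strictly_diff N e F p (\<lambda>_. c) (\<lambda>_. 0)"
  by (simp add: strictly_diff_def)

lemma strictly_diff_coordinate:
  assumes "i < N" "((\<lambda>w. e (fst w) i) \<longlongrightarrow> e p i) F" "((\<lambda>w. e (snd w) i) \<longlongrightarrow> e p i) F"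
  shows "strictly_diff N e F p (\<lambda>q. e q i) (\<lambda>j. if j = i then 1 else 0)"
proof -
  have "(\<Sum>j<N. (if j = i then 1 else 0) * (e (fst w) j - e (snd w) j)) = e (fst w) i - e (snd w) i" for w :: "'a \<times> 'a"
    using assms(1) by (simp add: if_distrib[of "\<lambda>x. x * _"] cong: if_cong)
  then show ?thesis using assms(2,3) by (simp add: strictly_diff_def)
qed

lemma strictly_diff_add:
  assumes "strictly_diff N e F p f l" "strictly_diff N e F p g k"
  shows "strictly_diff N e F p (\<lambda>q. f q + g q) (\<lambda>j. l j + k j)"
proof -
  let ?\<Delta> = "\<lambda>l w. \<Sum>j<N. l j * (e (fst w) j - e (snd w) j)"
  have "(\<lambda>w. (f (fst w) - f (snd w) - ?\<Delta> l w) + (g (fst w) - g (snd w) - ?\<Delta> k w))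
      \<in> o[F](\<lambda>w. \<Sum>j<N. \<bar>e (fst w) j - e (snd w) j\<bar>)"
    by (intro sum_in_smallo(1) assms[unfolded strictly_diff_def, THEN conjunct2, THEN conjunct2])
  moreover have "(\<lambda>w. (f (fst w) - f (snd w) - ?\<Delta> l w) + (g (fst w) - g (snd w) - ?\<Delta> k w)) =
    (\<lambda>w. (f (fst w) + g (fst w)) - (f (snd w) + g (snd w)) - ?\<Delta> (\<lambda>j. l j + k j) w)"
    by (simp add: fun_eq_iff distrib_right sum.distrib)
  ultimately show ?thesis using assms by (auto simp: strictly_diff_def intro!: tendsto_add)
qed

text \<open>
  The four error terms are of the form \<open>o(\<Delta>) O(1)\<close> or \<open>O(\<Delta>) o(1)\<close>.
\<close>
lemma strictly_diff_mult:
  assumes f: "strictly_diff N e F p f l" and g: "strictly_diff N e F p g k"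
  shows "strictly_diff N e F p (\<lambda>q. f q * g q) (\<lambda>j. g p * l j + f p * k j)"
proof -
  let ?\<Delta> = "\<lambda>l w. \<Sum>j<N. l j * (e (fst w) j - e (snd w) j)"
  let ?d = "\<lambda>w. \<Sum>j<N. \<bar>e (fst w) j - e (snd w) j\<bar>"
  note lim = f[unfolded strictly_diff_def, THEN conjunct1] f[unfolded strictly_diff_def, THEN conjunct2, THEN conjunct1]
    g[unfolded strictly_diff_def, THEN conjunct1] g[unfolded strictly_diff_def, THEN conjunct2, THEN conjunct1]
  have "(\<lambda>w. (f (fst w) - f (snd w) - ?\<Delta> l w) * g (fst w)) \<in> o[F](\<lambda>w. ?d w * 1)"
    using f by (intro landau_o.small_big_mult tendsto_imp_bigo_1[OF lim(3)]) (simp add: strictly_diff_def)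
  moreover have "(\<lambda>w. (g (fst w) - g (snd w) - ?\<Delta> k w) * f (snd w)) \<in> o[F](\<lambda>w. ?d w * 1)"
    using g by (intro landau_o.small_big_mult tendsto_imp_bigo_1[OF lim(2)]) (simp add: strictly_diff_def)
  moreover have "(\<lambda>w. ?\<Delta> l w * (g (fst w) - g p)) \<in> o[F](\<lambda>w. ?d w * 1)"
    by (intro landau_o.big_small_mult linear_bigo_increment tendsto_0_imp_smallo_1)
      (use tendsto_diff[OF lim(3) tendsto_const[of "g p"]] in simp)
  moreover have "(\<lambda>w. ?\<Delta> k w * (f (snd w) - f p)) \<in> o[F](\<lambda>w. ?d w * 1)"
    by (intro landau_o.big_small_mult linear_bigo_increment tendsto_0_imp_smallo_1)
      (use tendsto_diff[OF lim(2) tendsto_const[of "f p"]] in simp)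
  ultimately have "(\<lambda>w. (f (fst w) - f (snd w) - ?\<Delta> l w) * g (fst w) + (g (fst w) - g (snd w) - ?\<Delta> k w) * f (snd w)
     + ?\<Delta> l w * (g (fst w) - g p) + ?\<Delta> k w * (f (snd w) - f p)) \<in> o[F](\<lambda>w. ?d w * 1)"
    by (intro sum_in_smallo(1))
  moreover have "(f (fst w) - f (snd w) - ?\<Delta> l w) * g (fst w) + (g (fst w) - g (snd w) - ?\<Delta> k w) * f (snd w)
     + ?\<Delta> l w * (g (fst w) - g p) + ?\<Delta> k w * (f (snd w) - f p)
     = f (fst w) * g (fst w) - f (snd w) * g (snd w) - ?\<Delta> (\<lambda>j. g p * l j + f p * k j) w" for w
  proof -
    have "?\<Delta> (\<lambda>j. g p * l j + f p * k j) w = g p * ?\<Delta> l w + f p * ?\<Delta> k w"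
      by (simp add: algebra_simps sum.distrib sum_distrib_left sum_subtractf)
    then show ?thesis by (simp add: algebra_simps)
  qed
  ultimately show ?thesis using lim by (auto simp: strictly_diff_def intro!: tendsto_mult)
qed

lemma strictly_diff_inverse:
  assumes f: "strictly_diff N e F p f l" and nz: "f p \<noteq> 0"
  shows "strictly_diff N e F p (\<lambda>q. inverse (f q)) (\<lambda>j. - (inverse (f p) * inverse (f p)) * l j)"
proof -
  let ?\<Delta> = "\<lambda>l w. \<Sum>j<N. l j * (e (fst w) j - e (snd w) j)"
  let ?d = "\<lambda>w. \<Sum>j<N. \<bar>e (fst w) j - e (snd w) j\<bar>"
  note lim = f[unfolded strictly_diff_def, THEN conjunct1] f[unfolded strictly_diff_def, THEN conjunct2, THEN conjunct1]
  let ?r = "\<lambda>w. inverse (f (fst w)) * inverse (f (snd w))"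
  have r: "(?r \<longlongrightarrow> inverse (f p) * inverse (f p)) F" by (intro tendsto_intros lim nz)
  have "(\<lambda>w. (f (fst w) - f (snd w) - ?\<Delta> l w) * ?r w) \<in> o[F](\<lambda>w. ?d w * 1)"
    using f by (intro landau_o.small_big_mult tendsto_imp_bigo_1[OF r]) (simp add: strictly_diff_def)
  moreover have "(\<lambda>w. ?\<Delta> l w * (?r w - inverse (f p) * inverse (f p))) \<in> o[F](\<lambda>w. ?d w * 1)"
    by (intro landau_o.big_small_mult linear_bigo_increment tendsto_0_imp_smallo_1)
      (use tendsto_diff[OF r tendsto_const[of "inverse (f p) * inverse (f p)"]] in simp)
  ultimately have "(\<lambda>w. - ((f (fst w) - f (snd w) - ?\<Delta> l w) * ?r w + ?\<Delta> l w * (?r w - inverse (f p) * inverse (f p)))) \<in> o[F](\<lambda>w. ?d w * 1)"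
    by (simp only: landau_o.small.uminus_in_iff) (intro sum_in_smallo(1))
  moreover have "eventually (\<lambda>w. - ((f (fst w) - f (snd w) - ?\<Delta> l w) * ?r w + ?\<Delta> l w * (?r w - inverse (f p) * inverse (f p)))
     = inverse (f (fst w)) - inverse (f (snd w)) - ?\<Delta> (\<lambda>j. - (inverse (f p) * inverse (f p)) * l j) w) F"
    using tendsto_imp_eventually_ne[OF lim(1) nz] tendsto_imp_eventually_ne[OF lim(2) nz]
  proof eventually_elim
    case (elim w)
    have "?\<Delta> (\<lambda>j. - (inverse (f p) * inverse (f p)) * l j) w = - (inverse (f p) * inverse (f p)) * ?\<Delta> l w"
      by (simp add: sum_distrib_left mult.assoc sum_negf)
    moreover have "inverse (f (fst w)) - inverse (f (snd w)) = - (f (fst w) - f (snd w)) * ?r w"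
      using elim by (simp add: field_simps)
    ultimately show ?case by (simp only:) (simp add: algebra_simps)
  qed
  ultimately have "(\<lambda>w. inverse (f (fst w)) - inverse (f (snd w)) - ?\<Delta> (\<lambda>j. - (inverse (f p) * inverse (f p)) * l j) w) \<in> o[F](\<lambda>w. ?d w * 1)"
    by (simp only: landau_o.small.in_cong)
  then show ?thesis using lim nz by (auto simp: strictly_diff_def intro!: tendsto_inverse)
qed

lemma strictly_diff_cong:
  assumes "strictly_diff N e F p f l" "f p = g p"
    "eventually (\<lambda>w. f (fst w) = g (fst w) \<and> f (snd w) = g (snd w)) F"
  shows "strictly_diff N e F p g l"
proof -
  let ?\<Delta> = "\<lambda>l w. \<Sum>j<N. l j * (e (fst w) j - e (snd w) j)"
  have "((\<lambda>w. g (fst w)) \<longlongrightarrow> g p) F" "((\<lambda>w. g (snd w)) \<longlongrightarrow> g p) F"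
    using assms(1)[unfolded strictly_diff_def assms(2)]
    by (blast intro: Lim_transform_eventually eventually_mono[OF assms(3)])+
  moreover
  have "eventually (\<lambda>w. f (fst w) - f (snd w) - ?\<Delta> l w = g (fst w) - g (snd w) - ?\<Delta> l w) F"
    using assms(3) by eventually_elim simp
  then have "(\<lambda>w. g (fst w) - g (snd w) - ?\<Delta> l w) \<in> o[F](\<lambda>w. \<Sum>j<N. \<bar>e (fst w) j - e (snd w) j\<bar>)"
    by (rule landau_o.small.in_cong[THEN iffD1]) (use assms(1) in \<open>simp add: strictly_diff_def\<close>)
  ultimately show ?thesis unfolding strictly_diff_def by blast
qed

lemma strictly_diff_poly:
  assumes P: "poly_fun N P"
    and c: "\<And>i. i < N \<Longrightarrow> ((\<lambda>w. e (fst w) i) \<longlongrightarrow> e p i) F" "\<And>i. i < N \<Longrightarrow> ((\<lambda>w. e (snd w) i) \<longlongrightarrow> e p i) F"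
  shows "\<exists>l. strictly_diff N e F p (\<lambda>q. P (e q)) l"
  using P
proof induction
  case (const c) then show ?case by (intro exI) (rule strictly_diff_const)
next
  case (coord i) then show ?case by (intro exI) (rule strictly_diff_coordinate[OF _ c])
next
  case (add P Q) then show ?case by (elim exE) (intro exI, rule strictly_diff_add)
next
  case (mult P Q) then show ?case by (elim exE) (intro exI, rule strictly_diff_mult)
qed

section \<open>Affine charts\<close>

lemma zariski_affine:
  "zariski (affine_space n) = topology_generated_by {{x \<in> Rn n. P x \<noteq> 0} | P. poly_fun n P}"
  by (simp add: affine_space_def)

lemma openin_affine_basic: "poly_fun n P \<Longrightarrow> openin (zariski (affine_space n)) {x \<in> Rn n. P x \<noteq> 0}"
  unfolding zariski_affine by (rule openin_generator) blast

lemma points_affine: "points (affine_space n) = Rn n"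
proof
  show "points (affine_space n) \<subseteq> Rn n"
    unfolding zariski_affine topology_generated_by_topspace by blast
  show "Rn n \<subseteq> points (affine_space n)"
    using openin_subset[OF openin_affine_basic[OF poly_fun.const[of n 1]]] by simp
qed

lemma affine_basic_nhd:
  assumes "openin (zariski (affine_space n)) U" "z \<in> U"
  shows "\<exists>R. poly_fun n R \<and> R z \<noteq> 0 \<and> (\<forall>x\<in>Rn n. R x \<noteq> 0 \<longrightarrow> x \<in> U)"
proof -
  obtain T where T: "finite T" "T \<subseteq> {{x \<in> Rn n. P x \<noteq> 0} | P. poly_fun n P}" "z \<in> \<Inter>T" "\<Inter>T \<subseteq> U"
    using generated_topology_nhd[OF assms(1)[unfolded zariski_affine] assms(2)] by blast
  have "\<exists>R. poly_fun n R \<and> R z \<noteq> 0 \<and> (\<forall>x\<in>Rn n. R x \<noteq> 0 \<longrightarrow> x \<in> \<Inter>T)"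
    using T(1-3)
  proof (induction T)
    case empty
    then show ?case using poly_fun.const[of n 1] by (intro exI[of _ "\<lambda>_. 1"]) auto
  next
    case (insert B T)
    then obtain R where R: "poly_fun n R" "R z \<noteq> 0" "\<forall>x\<in>Rn n. R x \<noteq> 0 \<longrightarrow> x \<in> \<Inter>T" by auto
    obtain P where P: "poly_fun n P" "B = {x \<in> Rn n. P x \<noteq> 0}" using insert.prems by blast
    show ?case using poly_fun.mult[OF P(1) R(1)] R P insert.prems
      by (intro exI[of _ "\<lambda>x. P x * R x"]) auto
  qed
  then show ?thesis using T(4) by (meson subsetD)
qed

lemma sections_affine_iff:
  "f \<in> sections (affine_space n) U \<longleftrightarrow>
    (\<forall>x\<in>U. \<exists>P Q. poly_fun n P \<and> poly_fun n Q \<and> Q x \<noteq> 0 \<and> (\<forall>z\<in>U. Q z \<noteq> 0 \<longrightarrow> f z = P z / Q z))"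
  by (simp add: affine_space_def)

lemma poly_fun_section: "poly_fun n P \<Longrightarrow> P \<in> sections (affine_space n) U"
  unfolding sections_affine_iff
  by (intro ballI exI[of _ P] exI[of _ "\<lambda>_. 1"]) (simp add: poly_fun.const)

text \<open>
  Numerator and denominator are multiplied by a polynomial whose nonvanishing locus lies in \<open>U\<close>, so
  that the denominator also detects membership in \<open>U\<close>.
\<close>
lemma section_affine_local_quotient:
  assumes "openin (zariski (affine_space n)) U" "f \<in> sections (affine_space n) U" "z \<in> U"
  shows "\<exists>P Q. poly_fun n P \<and> poly_fun n Q \<and> Q z \<noteq> 0 \<and>
    (\<forall>x\<in>Rn n. Q x \<noteq> 0 \<longrightarrow> x \<in> U \<and> f x = P x / Q x)"
proof -
  obtain P Q where PQ: "poly_fun n P" "poly_fun n Q" "Q z \<noteq> 0" "\<forall>x\<in>U. Q x \<noteq> 0 \<longrightarrow> f x = P x / Q x"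
    using assms(2,3) unfolding sections_affine_iff by blast
  obtain R where R: "poly_fun n R" "R z \<noteq> 0" "\<forall>x\<in>Rn n. R x \<noteq> 0 \<longrightarrow> x \<in> U"
    using affine_basic_nhd[OF assms(1,3)] by blast
  show ?thesis
    using poly_fun.mult[OF PQ(1) R(1)] poly_fun.mult[OF PQ(2) R(1)] PQ R
    by (intro exI[of _ "\<lambda>x. P x * R x"] exI[of _ "\<lambda>x. Q x * R x"]) auto
qed

text \<open>
  A closed embedding of \<open>Y\<close> into \<open>\<real>\<^sup>m\<close>, reduced to two properties: its coordinates are regular, and
  regular functions are locally quotients of polynomials in them.
\<close>
locale affine_chart =
  fixes Y :: "'y fspace" and m :: nat and \<psi> :: "'y \<Rightarrow> nat \<Rightarrow> real"
  assumes sheaf: "sheaf_of_real_functions Y"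
    and coordinate_section: "j < m \<Longrightarrow> (\<lambda>y. \<psi> y j) \<in> sections Y (points Y)"
    and section_local_quotient: "openin (zariski Y) U \<Longrightarrow> f \<in> sections Y U \<Longrightarrow> y \<in> U \<Longrightarrow>
      \<exists>P Q. poly_fun m P \<and> poly_fun m Q \<and> Q (\<psi> y) \<noteq> 0 \<and>
        (\<forall>z\<in>points Y. Q (\<psi> z) \<noteq> 0 \<longrightarrow> z \<in> U \<and> f z = P (\<psi> z) / Q (\<psi> z))"

lemma affine_chart_exists:
  assumes Y: "sheaf_of_real_functions Y" and ns: "nonsingular Y"
  shows "\<exists>m \<psi>. affine_chart Y m \<psi>"
proof -
  obtain m V where V: "closedin (zariski (affine_space m)) V"
    and iso: "isomorphic Y (subspace_of (affine_space m) V)"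
    using ns unfolding nonsingular_def by blast
  let ?V = "subspace_of (affine_space m) V"
  obtain \<psi> \<theta> where p: "regular_map Y ?V \<psi>" "regular_map ?V Y \<theta>" "\<And>y. y \<in> points Y \<Longrightarrow> \<theta> (\<psi> y) = y"
    using iso unfolding isomorphic_def biregular_def by blast
  have VR: "V \<subseteq> Rn m" using closedin_subset[OF V] points_affine by blast
  have pV: "points ?V = V" using VR by (auto simp: points_affine)
  have \<psi>V: "\<psi> y \<in> V" if "y \<in> points Y" for y using regular_map_points[OF p(1) that] pV by simp
  have "affine_chart Y m \<psi>"
  proof
    show "sheaf_of_real_functions Y" by (rule Y)
    show "(\<lambda>y. \<psi> y j) \<in> sections Y (points Y)" if "j < m" for j
    proof -
      have "(\<lambda>x. x j) \<in> sections ?V V"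
        by (rule sections_subspaceI[of _ "Rn m" "\<lambda>x. x j"])
          (use VR openin_topspace[of "zariski (affine_space m)"] in
            \<open>auto simp: points_affine intro!: poly_fun_section poly_fun.coord that\<close>)
      then show ?thesis using regular_map_global_sections[OF p(1), unfolded pV] by blast
    qed
    show "\<exists>P Q. poly_fun m P \<and> poly_fun m Q \<and> Q (\<psi> y) \<noteq> 0 \<and>
        (\<forall>z\<in>points Y. Q (\<psi> z) \<noteq> 0 \<longrightarrow> z \<in> U \<and> f z = P (\<psi> z) / Q (\<psi> z))"
      if U: "openin (zariski Y) U" and f: "f \<in> sections Y U" and y: "y \<in> U" for U f y
    proof -
      have yY: "y \<in> points Y" using openin_subset[OF U] y by blast
      have o: "openin (zariski ?V) {z \<in> V. \<theta> z \<in> U}" using regular_map_openin[OF p(2) U] unfolding pV .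
      have s: "(\<lambda>z. f (\<theta> z)) \<in> sections ?V {z \<in> V. \<theta> z \<in> U}" using regular_map_sections[OF p(2) U f] unfolding pV .
      have z0: "\<psi> y \<in> {z \<in> V. \<theta> z \<in> U}" using \<psi>V[OF yY] p(3)[OF yY] y by simp
      obtain W g where W: "openin (zariski (affine_space m)) W" "\<psi> y \<in> W" "g \<in> sections (affine_space m) W"
        "\<forall>z\<in>{z \<in> V. \<theta> z \<in> U} \<inter> W. f (\<theta> z) = g z" using sections_subspaceE[OF s z0] by blast
      obtain W' where W': "openin (zariski (affine_space m)) W'" "{z \<in> V. \<theta> z \<in> U} = W' \<inter> V"
        using o unfolding zariski_subspace openin_subtopology by blast
      obtain P Q where PQ: "poly_fun m P" "poly_fun m Q" "Q (\<psi> y) \<noteq> 0" "\<forall>x\<in>Rn m. Q x \<noteq> 0 \<longrightarrow> x \<in> W \<and> g x = P x / Q x"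
        using section_affine_local_quotient[OF W(1,3,2)] by blast
      have "\<psi> y \<in> W'" using W'(2) z0 by blast
      then obtain R where R: "poly_fun m R" "R (\<psi> y) \<noteq> 0" "\<forall>x\<in>Rn m. R x \<noteq> 0 \<longrightarrow> x \<in> W'"
        using affine_basic_nhd[OF W'(1)] by blast
      have "z \<in> U \<and> f z = (P (\<psi> z) * R (\<psi> z)) / (Q (\<psi> z) * R (\<psi> z))"
        if z: "z \<in> points Y" and nz: "Q (\<psi> z) * R (\<psi> z) \<noteq> 0" for z
      proof -
        have zV: "\<psi> z \<in> V" "\<psi> z \<in> Rn m" using \<psi>V[OF z] VR by auto
        have "\<psi> z \<in> W'" "\<psi> z \<in> W" "g (\<psi> z) = P (\<psi> z) / Q (\<psi> z)" using R(3) PQ(4) zV(2) nz by auto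
        then have "\<psi> z \<in> {z \<in> V. \<theta> z \<in> U} \<inter> W" using W'(2) zV(1) by blast
        then have "\<theta> (\<psi> z) \<in> U" "f (\<theta> (\<psi> z)) = g (\<psi> z)" using W(4) by auto
        then show ?thesis using p(3)[OF z] \<open>g (\<psi> z) = _\<close> nz by simp
      qed
      then show ?thesis
        using poly_fun.mult[OF PQ(1) R(1)] poly_fun.mult[OF PQ(2) R(1)] PQ(3) R(2)
        by (intro exI[of _ "\<lambda>x. P x * R x"] exI[of _ "\<lambda>x. Q x * R x"]) auto
    qed
  qed
  then show ?thesis by blast
qed

context affine_chart
begin

abbreviation nearY :: "'y \<Rightarrow> 'y filter" where
  "nearY \<equiv> near (points Y) m \<psi>"

definition chart_dist :: "'y \<Rightarrow> 'y \<Rightarrow> real" where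
  "chart_dist y z = (\<Sum>j<m. \<bar>\<psi> y j - \<psi> z j\<bar>)"

lemma chart_dist_nonneg [simp]: "0 \<le> chart_dist y z"
  by (simp add: chart_dist_def sum_nonneg)

lemma chart_dist_self [simp]: "chart_dist y y = 0"
  by (simp add: chart_dist_def)

lemma chart_dist_commute: "chart_dist y z = chart_dist z y"
  by (simp add: chart_dist_def abs_minus_commute)

lemma chart_dist_triangle: "chart_dist x z \<le> chart_dist x y + chart_dist y z"
  unfolding chart_dist_def sum.distrib[symmetric] by (intro sum_mono) linarith

lemma eventually_nearY:
  "eventually P (nearY y) \<longleftrightarrow> (\<exists>\<eta>>0. \<forall>z\<in>points Y. chart_dist z y < \<eta> \<longrightarrow> P z)"
  by (simp add: eventually_near chart_dist_def)

lemma poly_section: "poly_fun m P \<Longrightarrow> (\<lambda>y. P (\<psi> y)) \<in> sections Y (points Y)"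
proof (induction rule: poly_fun.induct)
  case (const c) show ?case by (rule sections_const[OF sheaf openin_topspace])
next
  case (coord i) then show ?case by (rule coordinate_section)
next
  case (add P Q) then show ?case by (intro sections_add[OF sheaf openin_topspace])
next
  case (mult P Q) then show ?case by (intro sections_mult[OF sheaf openin_topspace])
qed

lemma section_strictly_diff:
  assumes U: "openin (zariski Y) U" and f: "f \<in> sections Y U" and y: "y \<in> U"
    and F: "filterlim fst (nearY y) F" "filterlim snd (nearY y) F"
  shows "\<exists>l. strictly_diff m \<psi> F y f l"
proof -
  obtain P Q where PQ: "poly_fun m P" "poly_fun m Q" "Q (\<psi> y) \<noteq> 0"
    "\<forall>z\<in>points Y. Q (\<psi> z) \<noteq> 0 \<longrightarrow> z \<in> U \<and> f z = P (\<psi> z) / Q (\<psi> z)"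
    using section_local_quotient[OF U f y] by blast
  have c: "((\<lambda>w. \<psi> (fst w) i) \<longlongrightarrow> \<psi> y i) F" "((\<lambda>w. \<psi> (snd w) i) \<longlongrightarrow> \<psi> y i) F" if "i < m" for i
    using filterlim_compose[OF tendsto_near_coordinate[OF that] F(1)]
      filterlim_compose[OF tendsto_near_coordinate[OF that] F(2)] by auto
  obtain p where p: "strictly_diff m \<psi> F y (\<lambda>q. P (\<psi> q)) p" using strictly_diff_poly[OF PQ(1), of \<psi> y F] c by blast
  obtain q where q: "strictly_diff m \<psi> F y (\<lambda>z. Q (\<psi> z)) q" using strictly_diff_poly[OF PQ(2), of \<psi> y F] c by blast
  from strictly_diff_mult[OF p strictly_diff_inverse[OF q PQ(3)]]
  obtain l where l: "strictly_diff m \<psi> F y (\<lambda>z. P (\<psi> z) * inverse (Q (\<psi> z))) l" by blast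
  have yY: "y \<in> points Y" using openin_subset[OF U] y by blast
  have mem: "eventually (\<lambda>w. fst w \<in> points Y \<and> snd w \<in> points Y) F"
    using eventually_compose_filterlim[OF eventually_near_mem F(1)]
      eventually_compose_filterlim[OF eventually_near_mem F(2)] by (rule eventually_conj)
  have "((\<lambda>w. Q (\<psi> (fst w))) \<longlongrightarrow> Q (\<psi> y)) F" "((\<lambda>w. Q (\<psi> (snd w))) \<longlongrightarrow> Q (\<psi> y)) F"
    using q unfolding strictly_diff_def by auto
  then have nz: "eventually (\<lambda>w. Q (\<psi> (fst w)) \<noteq> 0) F" "eventually (\<lambda>w. Q (\<psi> (snd w)) \<noteq> 0) F"
    using PQ(3) tendsto_imp_eventually_ne by blast+
  have "strictly_diff m \<psi> F y f l"
  proof (rule strictly_diff_cong[OF l])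
    show "P (\<psi> y) * inverse (Q (\<psi> y)) = f y" using PQ(3,4) yY by (simp add: divide_inverse)
    show "eventually (\<lambda>w. P (\<psi> (fst w)) * inverse (Q (\<psi> (fst w))) = f (fst w) \<and>
      P (\<psi> (snd w)) * inverse (Q (\<psi> (snd w))) = f (snd w)) F"
      using mem nz by eventually_elim (use PQ(4) in \<open>simp add: divide_inverse\<close>)
  qed
  then show ?thesis by blast
qed

lemma filterlim_diag: "filterlim (\<lambda>z. (z, z)) (nearY y \<times>\<^sub>F nearY y) (nearY y)"
  by (intro filterlim_Pair filterlim_ident)

lemma tendsto_section:
  assumes "openin (zariski Y) U" "f \<in> sections Y U" "y \<in> U"
  shows "(f \<longlongrightarrow> f y) (nearY y)"
proof -
  obtain l where "strictly_diff m \<psi> (nearY y \<times>\<^sub>F nearY y) y f l"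
    using section_strictly_diff[OF assms filterlim_fst filterlim_snd] by blast
  then have "((\<lambda>w. f (fst w)) \<longlongrightarrow> f y) (nearY y \<times>\<^sub>F nearY y)" by (simp add: strictly_diff_def)
  from filterlim_compose[OF this filterlim_diag] show ?thesis by simp
qed

lemma eventually_nearY_zariski_open:
  assumes "openin (zariski Y) U" "y \<in> U"
  shows "eventually (\<lambda>z. z \<in> U) (nearY y)"
proof -
  obtain P Q where PQ: "poly_fun m P" "poly_fun m Q" "Q (\<psi> y) \<noteq> 0"
    "\<forall>z\<in>points Y. Q (\<psi> z) \<noteq> 0 \<longrightarrow> z \<in> U \<and> 0 = P (\<psi> z) / Q (\<psi> z)"
    using section_local_quotient[OF assms(1) sections_const[OF sheaf assms(1)] assms(2)] by blast
  have yY: "y \<in> points Y" using openin_subset[OF assms(1)] assms(2) by blast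
  have "((\<lambda>z. Q (\<psi> z)) \<longlongrightarrow> Q (\<psi> y)) (nearY y)"
    by (rule tendsto_section[OF openin_topspace poly_section[OF PQ(2)] yY])
  then have "eventually (\<lambda>z. Q (\<psi> z) \<noteq> 0) (nearY y)" using PQ(3) by (rule tendsto_imp_eventually_ne)
  with eventually_near_mem show ?thesis by eventually_elim (use PQ(4) in blast)
qed

text \<open>
  The Euclidean topology is defined by regular functions on Zariski open sets; these are rational in
  the chart, so the topology is not finer than the one of \<open>chart_dist\<close>.
\<close>
lemma eventually_nearY_euclidean_open:
  assumes W: "openin (euclidean_topology Y) W" and y: "y \<in> W"
  shows "eventually (\<lambda>z. z \<in> W) (nearY y)"
proof -
  obtain T where T: "finite T" "T \<subseteq> {{x \<in> U. f x \<in> W} | U f W. openin (zariski Y) U \<and> f \<in> sections Y U \<and> open W}"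
    "y \<in> \<Inter>T" "\<Inter>T \<subseteq> W"
    using generated_topology_nhd[OF W[unfolded euclidean_topology_def] y] by blast
  have "eventually (\<lambda>z. z \<in> B) (nearY y)" if B: "B \<in> T" for B
  proof -
    obtain U f V where O: "B = {x \<in> U. f x \<in> V}" "openin (zariski Y) U" "f \<in> sections Y U" "open V"
      using T(2) B by blast
    have "y \<in> U" "f y \<in> V" using T(3) B O(1) by auto
    have "eventually (\<lambda>z. f z \<in> V) (nearY y)"
      using tendsto_section[OF O(2,3) \<open>y \<in> U\<close>] O(4) \<open>f y \<in> V\<close> by (rule topological_tendstoD)
    with eventually_nearY_zariski_open[OF O(2) \<open>y \<in> U\<close>] show ?thesis
      unfolding O(1) by eventually_elim simp
  qed
  then have "eventually (\<lambda>z. \<forall>B\<in>T. z \<in> B) (nearY y)" using T(1) by (simp add: eventually_ball_finite)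
  then show ?thesis by (rule eventually_mono) (use T(4) in blast)
qed

lemma euclidean_open_chart_ball:
  assumes "openin (euclidean_topology Y) W" "y \<in> W"
  shows "\<exists>\<eta>>0. \<forall>z\<in>points Y. chart_dist z y < \<eta> \<longrightarrow> z \<in> W"
  using eventually_nearY_euclidean_open[OF assms] unfolding eventually_nearY .

lemma continuous_map_chart_coordinate:
  "j < m \<Longrightarrow> continuous_map (euclidean_topology Y) euclideanreal (\<lambda>y. \<psi> y j)"
  by (rule continuous_map_section[OF sheaf coordinate_section])

lemma continuous_map_chart_dist:
  assumes "continuous_map T (euclidean_topology Y) f" "continuous_map T (euclidean_topology Y) g"
  shows "continuous_map T euclideanreal (\<lambda>x. chart_dist (f x) (g x))"
  unfolding chart_dist_def
proof (intro continuous_map_sum continuous_map_real_abs continuous_map_diff)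
  fix j assume "j \<in> {..<m}"
  then have "j < m" by simp
  from continuous_map_chart_coordinate[OF this]
  show "continuous_map T euclideanreal (\<lambda>x. \<psi> (f x) j)" "continuous_map T euclideanreal (\<lambda>x. \<psi> (g x) j)"
    using continuous_map_compose[OF assms(1)] continuous_map_compose[OF assms(2)] by (auto simp: o_def)
qed simp

text \<open>
  If \<open>f = P/Q\<close> near \<open>y\<close>, then \<open>Q\<^sup>2 f = Q P\<close> where \<open>Q\<close> does not vanish, and the right-hand side
  is regular everywhere and vanishes with \<open>Q\<close>.  So the function \<open>q = Q\<^sup>2\<close> clears the denominator and
  cuts \<open>f\<close> off at the same time; for several \<open>f\<close> the product of these functions is used.
\<close>
lemma globalize_sections:
  fixes n :: nat
  assumes U: "openin (zariski Y) U" and y: "y \<in> U" and f: "\<And>j. j < n \<Longrightarrow> f j \<in> sections Y U"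
  shows "\<exists>q g. q \<in> sections Y (points Y) \<and> q y \<noteq> 0 \<and> (\<forall>z\<in>points Y. q z \<noteq> 0 \<longrightarrow> z \<in> U) \<and>
    (\<forall>j<n. g j \<in> sections Y (points Y) \<and>
      (\<forall>z\<in>points Y. if q z = 0 then g j z = 0 else g j z = q z * f j z))"
proof -
  have one: "\<exists>q g. q \<in> sections Y (points Y) \<and> q y \<noteq> 0 \<and> (\<forall>z\<in>points Y. q z \<noteq> 0 \<longrightarrow> z \<in> U) \<and>
      g \<in> sections Y (points Y) \<and> (\<forall>z\<in>points Y. if q z = 0 then g z = 0 else g z = q z * f z)"
    if f: "f \<in> sections Y U" for f
  proof -
    obtain P Q where PQ: "poly_fun m P" "poly_fun m Q" "Q (\<psi> y) \<noteq> 0"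
      "\<forall>z\<in>points Y. Q (\<psi> z) \<noteq> 0 \<longrightarrow> z \<in> U \<and> f z = P (\<psi> z) / Q (\<psi> z)"
      using section_local_quotient[OF U f y] by blast
    show ?thesis
      using PQ(3,4) poly_section[OF poly_fun.mult[OF PQ(2) PQ(2)]] poly_section[OF poly_fun.mult[OF PQ(2) PQ(1)]]
      by (intro exI[of _ "\<lambda>z. Q (\<psi> z) * Q (\<psi> z)"] exI[of _ "\<lambda>z. Q (\<psi> z) * P (\<psi> z)"]) auto
  qed
  show ?thesis using f
  proof (induction n)
    case 0
    show ?case using one[OF sections_const[OF sheaf U, of 0]] by auto
  next
    case (Suc n)
    obtain q g where q: "q \<in> sections Y (points Y)" "q y \<noteq> 0" "\<forall>z\<in>points Y. q z \<noteq> 0 \<longrightarrow> z \<in> U"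
      "\<forall>j<n. g j \<in> sections Y (points Y) \<and> (\<forall>z\<in>points Y. if q z = 0 then g j z = 0 else g j z = q z * f j z)"
      using Suc.IH[OF Suc.prems] by auto
    obtain q' g' where q': "q' \<in> sections Y (points Y)" "q' y \<noteq> 0" "\<forall>z\<in>points Y. q' z \<noteq> 0 \<longrightarrow> z \<in> U"
      "g' \<in> sections Y (points Y)" "\<forall>z\<in>points Y. if q' z = 0 then g' z = 0 else g' z = q' z * f n z"
      using one[OF Suc.prems[OF lessI]] by auto
    define G where "G = (\<lambda>j z. if j = n then g' z * q z else g j z * q' z)"
    have "G j \<in> sections Y (points Y)" if "j < Suc n" for j
      using that q q' unfolding G_def
      by (cases "j = n") (auto intro!: sections_mult[OF sheaf openin_topspace])
    moreover have "if q z * q' z = 0 then G j z = 0 else G j z = q z * q' z * f j z"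
      if "j < Suc n" "z \<in> points Y" for j z
    proof (cases "j = n")
      case True
      then show ?thesis using q'(5) that unfolding G_def by (auto split: if_splits)
    next
      case False
      then have "j < n" using that by simp
      then show ?thesis using q(4) that False unfolding G_def by (auto split: if_splits)
    qed
    ultimately show ?case
      using q q' sections_mult[OF sheaf openin_topspace q(1) q'(1)]
      by (intro exI[of _ "\<lambda>z. q z * q' z"] exI[of _ G]) auto
  qed
qed

end

section \<open>Tangent vectors in an affine chart\<close>

lemma regular_atI: "openin (zariski Z) U \<Longrightarrow> p \<in> U \<Longrightarrow> f \<in> sections Z U \<Longrightarrow> f \<in> regular_at Z p"
  unfolding regular_at_def by blast

lemma regular_atE:
  assumes "f \<in> regular_at Z p"
  obtains U where "openin (zariski Z) U" "p \<in> U" "f \<in> sections Z U"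
  using assms unfolding regular_at_def by blast

lemma regular_at_const:
  assumes "sheaf_of_real_functions Z" "p \<in> points Z"
  shows "(\<lambda>_. c) \<in> regular_at Z p"
  by (rule regular_atI[OF openin_topspace assms(2) sections_const[OF assms(1) openin_topspace]])

lemma regular_at_cong:
  assumes Z: "sheaf_of_real_functions Z" and f: "f \<in> regular_at Z p"
    and N: "openin (zariski Z) N" "p \<in> N" "\<And>z. z \<in> N \<Longrightarrow> g z = f z"
  shows "g \<in> regular_at Z p"
proof -
  obtain U where U: "openin (zariski Z) U" "p \<in> U" "f \<in> sections Z U" by (rule regular_atE[OF f])
  have o: "openin (zariski Z) (U \<inter> N)" using U(1) N(1) by (rule openin_Int)
  have "f \<in> sections Z (U \<inter> N)" by (rule sections_restrict[OF Z U(1) o _ U(3)]) simp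
  then have "g \<in> sections Z (U \<inter> N)" by (rule sections_cong[OF Z o]) (use N(3) in simp)
  then show ?thesis using o U(2) N(2) by (intro regular_atI[of Z "U \<inter> N"]) auto
qed

lemma regular_at_common:
  assumes Z: "sheaf_of_real_functions Z" and f: "f \<in> regular_at Z p" and g: "g \<in> regular_at Z p"
  shows "\<exists>U. openin (zariski Z) U \<and> p \<in> U \<and> f \<in> sections Z U \<and> g \<in> sections Z U"
proof -
  obtain U where U: "openin (zariski Z) U" "p \<in> U" "f \<in> sections Z U" by (rule regular_atE[OF f])
  obtain V where V: "openin (zariski Z) V" "p \<in> V" "g \<in> sections Z V" by (rule regular_atE[OF g])
  have o: "openin (zariski Z) (U \<inter> V)" using U(1) V(1) by (rule openin_Int)
  have "f \<in> sections Z (U \<inter> V)" by (rule sections_restrict[OF Z U(1) o _ U(3)]) simp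
  moreover have "g \<in> sections Z (U \<inter> V)" by (rule sections_restrict[OF Z V(1) o _ V(3)]) simp
  ultimately show ?thesis using o U V by (intro exI[of _ "U \<inter> V"]) auto
qed

lemma regular_at_add:
  assumes Z: "sheaf_of_real_functions Z" and f: "f \<in> regular_at Z p" and g: "g \<in> regular_at Z p"
  shows "(\<lambda>z. f z + g z) \<in> regular_at Z p"
proof -
  obtain U where U: "openin (zariski Z) U" "p \<in> U" "f \<in> sections Z U" "g \<in> sections Z U"
    using regular_at_common[OF assms] by blast
  show ?thesis by (rule regular_atI[OF U(1,2) sections_add[OF Z U(1,3,4)]])
qed

lemma regular_at_mult:
  assumes Z: "sheaf_of_real_functions Z" and f: "f \<in> regular_at Z p" and g: "g \<in> regular_at Z p"
  shows "(\<lambda>z. f z * g z) \<in> regular_at Z p"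
proof -
  obtain U where U: "openin (zariski Z) U" "p \<in> U" "f \<in> sections Z U" "g \<in> sections Z U"
    using regular_at_common[OF assms] by blast
  show ?thesis by (rule regular_atI[OF U(1,2) sections_mult[OF Z U(1,3,4)]])
qed

lemma regular_at_nonzero_nhd:
  assumes Z: "nonvanishing_invertible Z" and f: "f \<in> regular_at Z p" and nz: "f p \<noteq> 0"
  obtains N where "openin (zariski Z) N" "p \<in> N" "\<forall>z\<in>N. f z \<noteq> 0" "(\<lambda>z. inverse (f z)) \<in> sections Z N"
proof -
  obtain U where U: "openin (zariski Z) U" "p \<in> U" "f \<in> sections Z U" by (rule regular_atE[OF f])
  have "openin (zariski Z) {x \<in> U. f x \<noteq> 0}" "(\<lambda>x. inverse (f x)) \<in> sections Z {x \<in> U. f x \<noteq> 0}"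
    using Z U(1,3) unfolding nonvanishing_invertible_def by auto
  then show thesis using U nz by (intro that[of "{x \<in> U. f x \<noteq> 0}"]) auto
qed

lemma regular_at_inverse:
  assumes Z: "nonvanishing_invertible Z" and f: "f \<in> regular_at Z p" and nz: "f p \<noteq> 0"
  shows "(\<lambda>z. inverse (f z)) \<in> regular_at Z p"
  by (rule regular_at_nonzero_nhd[OF assms]) (rule regular_atI)

lemma tangent_vectors_add:
  "D \<in> tangent_vectors Z p \<Longrightarrow> f \<in> regular_at Z p \<Longrightarrow> g \<in> regular_at Z p \<Longrightarrow> D (\<lambda>z. f z + g z) = D f + D g"
  unfolding tangent_vectors_def by blast

lemma tangent_vectors_mult:
  "D \<in> tangent_vectors Z p \<Longrightarrow> f \<in> regular_at Z p \<Longrightarrow> g \<in> regular_at Z p \<Longrightarrow>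
    D (\<lambda>z. f z * g z) = f p * D g + g p * D f"
  unfolding tangent_vectors_def by blast

lemma tangent_vectors_scale:
  "D \<in> tangent_vectors Z p \<Longrightarrow> f \<in> regular_at Z p \<Longrightarrow> D (\<lambda>z. c * f z) = c * D f"
  unfolding tangent_vectors_def by blast

lemma tangent_vectors_cong:
  assumes D: "D \<in> tangent_vectors Z p" and f: "f \<in> regular_at Z p" and g: "g \<in> regular_at Z p"
    and N: "openin (zariski Z) N" "p \<in> N" "\<And>z. z \<in> N \<Longrightarrow> f z = g z"
  shows "D f = D g"
proof -
  have "\<forall>f\<in>regular_at Z p. \<forall>g\<in>regular_at Z p.
            (\<exists>U. openin (zariski Z) U \<and> p \<in> U \<and> (\<forall>z\<in>U. f z = g z)) \<longrightarrow> D f = D g"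
    using D unfolding tangent_vectors_def by simp
  then show ?thesis using f g N by metis
qed

lemma tangent_vectors_const:
  assumes Z: "sheaf_of_real_functions Z" and p: "p \<in> points Z" and D: "D \<in> tangent_vectors Z p"
  shows "D (\<lambda>_. c) = 0"
proof -
  have "D (\<lambda>z. 1 * 1) = 1 * D (\<lambda>_. 1) + 1 * D (\<lambda>_. 1)"
    by (rule tangent_vectors_mult[OF D regular_at_const[OF Z p] regular_at_const[OF Z p]])
  then have "D (\<lambda>_. 1) = 0" by simp
  moreover have "D (\<lambda>_. c * 1) = c * D (\<lambda>_. 1)"
    by (rule tangent_vectors_scale[OF D regular_at_const[OF Z p]])
  ultimately show ?thesis by simp
qed

lemma regular_at_sum:
  assumes Z: "sheaf_of_real_functions Z" and p: "p \<in> points Z"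
    and f: "\<And>i. i \<in> I \<Longrightarrow> f i \<in> regular_at Z p"
  shows "(\<lambda>z. \<Sum>i\<in>I. f i z * c i) \<in> regular_at Z p"
  using f
proof (induction I rule: infinite_finite_induct)
  case (insert i I)
  have "(\<lambda>z. f i z * c i) \<in> regular_at Z p"
    by (intro regular_at_mult[OF Z] regular_at_const[OF Z p] insert.prems) simp
  moreover have "(\<lambda>z. \<Sum>i\<in>I. f i z * c i) \<in> regular_at Z p" by (intro insert.IH insert.prems) simp
  ultimately have "(\<lambda>z. f i z * c i + (\<Sum>i\<in>I. f i z * c i)) \<in> regular_at Z p" by (rule regular_at_add[OF Z])
  then show ?case using insert by simp
qed (simp_all add: regular_at_const[OF Z p])

lemma tangent_vectors_sum:
  assumes Z: "sheaf_of_real_functions Z" and p: "p \<in> points Z" and D: "D \<in> tangent_vectors Z p"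
    and f: "\<And>i. i \<in> I \<Longrightarrow> f i \<in> regular_at Z p"
  shows "D (\<lambda>z. \<Sum>i\<in>I. f i z * c i) = (\<Sum>i\<in>I. D (f i) * c i)"
  using f
proof (induction I rule: infinite_finite_induct)
  case (insert i I)
  have fi: "f i \<in> regular_at Z p" by (rule insert.prems) simp
  have 1: "(\<lambda>z. c i * f i z) \<in> regular_at Z p"
    by (intro regular_at_mult[OF Z] regular_at_const[OF Z p] fi)
  have 2: "(\<lambda>z. \<Sum>i\<in>I. f i z * c i) \<in> regular_at Z p" by (intro regular_at_sum[OF Z p] insert.prems) simp
  have "D (\<lambda>z. c i * f i z + (\<Sum>i\<in>I. f i z * c i)) = D (\<lambda>z. c i * f i z) + D (\<lambda>z. \<Sum>i\<in>I. f i z * c i)"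
    by (rule tangent_vectors_add[OF D 1 2])
  also have "D (\<lambda>z. c i * f i z) = c i * D (f i)" by (rule tangent_vectors_scale[OF D fi])
  also have "D (\<lambda>z. \<Sum>i\<in>I. f i z * c i) = (\<Sum>i\<in>I. D (f i) * c i)" by (intro insert.IH insert.prems) simp
  finally show ?case using insert by (simp add: mult.commute)
qed (simp_all add: tangent_vectors_const[OF Z p D])

lemma tangent_vectors_inverse:
  assumes Z: "sheaf_of_real_functions Z" "nonvanishing_invertible Z" and p: "p \<in> points Z"
    and D: "D \<in> tangent_vectors Z p" and f: "f \<in> regular_at Z p" and nz: "f p \<noteq> 0"
  shows "D (\<lambda>z. inverse (f z)) = - (inverse (f p) * inverse (f p)) * D f"
proof -
  obtain N where N: "openin (zariski Z) N" "p \<in> N" "\<forall>z\<in>N. f z \<noteq> 0"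
    by (rule regular_at_nonzero_nhd[OF Z(2) f nz])
  note i = regular_at_inverse[OF Z(2) f nz]
  have "D (\<lambda>z. f z * inverse (f z)) = D (\<lambda>_. 1)"
    by (rule tangent_vectors_cong[OF D regular_at_mult[OF Z(1) f i] regular_at_const[OF Z(1) p] N(1,2)]) (use N(3) in simp)
  then have "f p * D (\<lambda>z. inverse (f z)) + inverse (f p) * D f = 0"
    using tangent_vectors_mult[OF D f i] tangent_vectors_const[OF Z(1) p D] by simp
  then show ?thesis using nz by (simp add: field_simps) 
qed

context affine_chart
begin

abbreviation pairsY :: "'y \<Rightarrow> ('y \<times> 'y) filter" where
  "pairsY y \<equiv> nearY y \<times>\<^sub>F nearY y"

text \<open>
  Covectors that vanish to first order on differences of nearby points.  Where \<open>Y\<close> is a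
  manifold this is the conormal space.
\<close>
definition null_covectors :: "'y \<Rightarrow> (nat \<Rightarrow> real) set" where
  "null_covectors y = {l \<in> Rn m. (\<lambda>w. \<Sum>j<m. l j * (\<psi> (fst w) j - \<psi> (snd w) j))
     \<in> o[pairsY y](\<lambda>w. \<Sum>j<m. \<bar>\<psi> (fst w) j - \<psi> (snd w) j\<bar>)}"

lemma linear_subspace_null_covectors: "linear_subspace (null_covectors y)"
  unfolding linear_subspace_def
proof (intro conjI ballI allI)
  show "(\<lambda>_. 0) \<in> null_covectors y" by (simp add: null_covectors_def Rn_def)
  fix u assume u: "u \<in> null_covectors y"
  show "(\<lambda>j. u j + v j) \<in> null_covectors y" if v: "v \<in> null_covectors y" for v
  proof -
    have "(\<lambda>w. (\<Sum>j<m. u j * (\<psi> (fst w) j - \<psi> (snd w) j)) + (\<Sum>j<m. v j * (\<psi> (fst w) j - \<psi> (snd w) j)))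
        \<in> o[pairsY y](\<lambda>w. \<Sum>j<m. \<bar>\<psi> (fst w) j - \<psi> (snd w) j\<bar>)"
      using u v unfolding null_covectors_def by (intro sum_in_smallo(1)) auto
    then show ?thesis using u v by (simp add: null_covectors_def Rn_def distrib_right sum.distrib)
  qed
  show "(\<lambda>j. c * u j) \<in> null_covectors y" for c
  proof (cases "c = 0")
    case True
    then show ?thesis by (simp add: null_covectors_def Rn_def)
  next
    case False
    then have "(\<lambda>w. c * (\<Sum>j<m. u j * (\<psi> (fst w) j - \<psi> (snd w) j)))
        \<in> o[pairsY y](\<lambda>w. \<Sum>j<m. \<bar>\<psi> (fst w) j - \<psi> (snd w) j\<bar>)"
      using u by (simp add: null_covectors_def)
    then show ?thesis using u by (simp add: null_covectors_def Rn_def sum_distrib_left mult.assoc)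
  qed
qed

lemma strictly_diff_unique:
  assumes "strictly_diff m \<psi> (pairsY y) y f l" "strictly_diff m \<psi> (pairsY y) y f k"
  shows "(\<lambda>j. if j < m then l j - k j else 0) \<in> null_covectors y"
proof -
  let ?\<Delta> = "\<lambda>l w. \<Sum>j<m. l j * (\<psi> (fst w) j - \<psi> (snd w) j)"
  have "(\<lambda>w. (f (fst w) - f (snd w) - ?\<Delta> k w) - (f (fst w) - f (snd w) - ?\<Delta> l w))
      \<in> o[pairsY y](\<lambda>w. \<Sum>j<m. \<bar>\<psi> (fst w) j - \<psi> (snd w) j\<bar>)"
    by (intro sum_in_smallo(2) assms[unfolded strictly_diff_def, THEN conjunct2, THEN conjunct2])
  moreover have "(\<lambda>w. (f (fst w) - f (snd w) - ?\<Delta> k w) - (f (fst w) - f (snd w) - ?\<Delta> l w)) =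
    ?\<Delta> (\<lambda>j. if j < m then l j - k j else 0)"
    by (simp add: fun_eq_iff left_diff_distrib sum_subtractf)
  ultimately show ?thesis by (simp add: null_covectors_def Rn_def)
qed

text \<open>
  The derivative at \<open>y\<close> in the direction \<open>t\<close>.  Strict differentials are unique up to null covectors,
  so the choice among them is immaterial when \<open>t\<close> is annihilated by the null covectors.
\<close>
definition chart_derivation :: "'y \<Rightarrow> (nat \<Rightarrow> real) \<Rightarrow> ('y \<Rightarrow> real) \<Rightarrow> real" where
  "chart_derivation y t f = (\<Sum>j<m. (SOME l. strictly_diff m \<psi> (pairsY y) y f l) j * t j)"

lemma chart_derivation_eq:
  assumes t: "\<And>l. l \<in> null_covectors y \<Longrightarrow> (\<Sum>j<m. l j * t j) = 0"
    and f: "strictly_diff m \<psi> (pairsY y) y f l"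
  shows "chart_derivation y t f = (\<Sum>j<m. l j * t j)"
proof -
  define k where "k = (SOME l. strictly_diff m \<psi> (pairsY y) y f l)"
  have "strictly_diff m \<psi> (pairsY y) y f k"
    unfolding k_def using f by (rule someI[of "strictly_diff m \<psi> (pairsY y) y f"])
  from t[OF strictly_diff_unique[OF f this]]
  have "(\<Sum>j<m. (l j - k j) * t j) = 0" by simp
  then show ?thesis by (simp add: chart_derivation_def k_def left_diff_distrib sum_subtractf)
qed

lemma regular_at_strictly_diff:
  assumes "f \<in> regular_at Y y"
  shows "\<exists>l. strictly_diff m \<psi> (pairsY y) y f l"
proof -
  obtain U where "openin (zariski Y) U" "y \<in> U" "f \<in> sections Y U" by (rule regular_atE[OF assms])
  from section_strictly_diff[OF this(1,3,2) filterlim_fst filterlim_snd] show ?thesis .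
qed

lemma eventually_pairsY_zariski_open:
  assumes "openin (zariski Y) U" "y \<in> U"
  shows "eventually (\<lambda>w. fst w \<in> U \<and> snd w \<in> U) (pairsY y)"
  using eventually_compose_filterlim[OF eventually_nearY_zariski_open[OF assms] filterlim_fst]
    eventually_compose_filterlim[OF eventually_nearY_zariski_open[OF assms] filterlim_snd]
  by (rule eventually_conj)

lemma chart_derivation_tangent:
  assumes y: "y \<in> points Y" and t: "\<And>l. l \<in> null_covectors y \<Longrightarrow> (\<Sum>j<m. l j * t j) = 0"
  shows "chart_derivation y t \<in> tangent_vectors Y y"
  unfolding tangent_vectors_def
proof (intro CollectI conjI ballI allI impI)
  have eq: "chart_derivation y t f = (\<Sum>j<m. l j * t j)" if "strictly_diff m \<psi> (pairsY y) y f l" for f l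
    by (rule chart_derivation_eq[OF _ that]) (rule t)
  fix f assume f: "f \<in> regular_at Y y"
  obtain l where l: "strictly_diff m \<psi> (pairsY y) y f l" using regular_at_strictly_diff[OF f] by blast
  show "chart_derivation y t (\<lambda>z. c * f z) = c * chart_derivation y t f" for c
    using eq[OF strictly_diff_mult[OF strictly_diff_const l], of c] eq[OF l]
    by (simp add: sum_distrib_left mult.assoc)
  fix g assume g: "g \<in> regular_at Y y"
  obtain k where k: "strictly_diff m \<psi> (pairsY y) y g k" using regular_at_strictly_diff[OF g] by blast
  show "chart_derivation y t (\<lambda>z. f z + g z) = chart_derivation y t f + chart_derivation y t g"
    using eq[OF strictly_diff_add[OF l k]] eq[OF l] eq[OF k] by (simp add: distrib_right sum.distrib)
  show "chart_derivation y t (\<lambda>z. f z * g z) = f y * chart_derivation y t g + g y * chart_derivation y t f"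
    using eq[OF strictly_diff_mult[OF l k]] eq[OF l] eq[OF k]
    by (simp add: distrib_right sum.distrib sum_distrib_left mult.assoc)
  assume "\<exists>U. openin (zariski Y) U \<and> y \<in> U \<and> (\<forall>z\<in>U. f z = g z)"
  then obtain U where U: "openin (zariski Y) U" "y \<in> U" "\<forall>z\<in>U. f z = g z" by blast
  have "strictly_diff m \<psi> (pairsY y) y g l"
    by (rule strictly_diff_cong[OF l]) (use U in \<open>auto intro: eventually_mono[OF eventually_pairsY_zariski_open[OF U(1,2)]]\<close>)
  then show "chart_derivation y t f = chart_derivation y t g" using eq[OF l] eq by simp
qed

text \<open>
  The columns of \<open>1 - \<mu>\<close>, for a projection \<open>\<mu>\<close> onto the null covectors, are annihilated by the null
  covectors and therefore directions of derivations.  Combining them with coefficients \<open>a\<close> gives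
  \<open>a - \<mu> a\<close>, and \<open>\<mu> a\<close> is negligible if \<open>a\<close> is the difference of two nearby points.
\<close>
lemma tangent_frame:
  assumes y: "y \<in> points Y"
  shows "\<exists>\<mu>. (\<forall>k<m. \<mu> k \<in> null_covectors y) \<and>
    (\<forall>l<m. \<exists>D\<in>tangent_vectors Y y. \<forall>k<m. D (\<lambda>z. \<psi> z k) = (if k = l then 1 else 0) - \<mu> k l)"
proof -
  obtain \<mu> where \<mu>: "\<forall>k<m. \<mu> k \<in> null_covectors y"
    "\<forall>v\<in>null_covectors y. \<forall>l. v l = (\<Sum>j<m. v j * \<mu> j l)"
    using projection_matrix[OF linear_subspace_null_covectors, of y m] by (auto simp: null_covectors_def)
  have "\<exists>D\<in>tangent_vectors Y y. \<forall>k<m. D (\<lambda>z. \<psi> z k) = (if k = l then 1 else 0) - \<mu> k l" if l: "l < m" for l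
  proof -
    define t where "t = (\<lambda>k. (if k = l then 1 else 0) - \<mu> k l)"
    have t: "(\<Sum>j<m. v j * t j) = 0" if v: "v \<in> null_covectors y" for v
    proof -
      have "(\<Sum>j<m. v j * t j) = (\<Sum>j<m. v j * (if j = l then 1 else 0)) - (\<Sum>j<m. v j * \<mu> j l)"
        by (simp add: t_def right_diff_distrib sum_subtractf)
      also have "(\<Sum>j<m. v j * (if j = l then 1 else 0)) = v l"
        using l by (simp add: if_distrib[of "\<lambda>x. _ * x"] cong: if_cong)
      also have "(\<Sum>j<m. v j * \<mu> j l) = v l" using \<mu>(2) v by simp
      finally show ?thesis by simp
    qed
    have "chart_derivation y t (\<lambda>z. \<psi> z k) = t k" if k: "k < m" for k
    proof -
      have *: "strictly_diff m \<psi> (pairsY y) y (\<lambda>z. \<psi> z k) (\<lambda>j. if j = k then 1 else 0)"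
        by (rule strictly_diff_coordinate[OF k filterlim_compose[OF tendsto_near_coordinate[OF k] filterlim_fst]
          filterlim_compose[OF tendsto_near_coordinate[OF k] filterlim_snd]])
      have "chart_derivation y t (\<lambda>z. \<psi> z k) = (\<Sum>j<m. (if j = k then 1 else 0) * t j)"
        by (rule chart_derivation_eq[OF _ *]) (rule t)
      then show ?thesis using k by (simp add: if_distrib[of "\<lambda>x. x * _"] cong: if_cong)
    qed
    moreover have "chart_derivation y t \<in> tangent_vectors Y y" by (rule chart_derivation_tangent[OF y]) (rule t)
    ultimately show ?thesis by (intro bexI[of _ "chart_derivation y t"]) (auto simp: t_def)
  qed
  then show ?thesis using \<mu>(1) by blast
qed

end

section \<open>Products with affine space\<close>

lemma quotient_section:
  assumes X: "sheaf_of_real_functions X" "nonvanishing_invertible X" and N: "openin (zariski X) N"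
    and loc: "\<And>x. x \<in> N \<Longrightarrow> \<exists>M p q. openin (zariski X) M \<and> x \<in> M \<and> p \<in> sections X M \<and> q \<in> sections X M \<and>
      q x \<noteq> 0 \<and> (\<forall>z\<in>M \<inter> N. q z \<noteq> 0 \<longrightarrow> f z = p z / q z)"
  shows "f \<in> sections X N"
proof (rule sections_glue[OF X(1) N])
  fix x assume x: "x \<in> N"
  obtain M p q where M: "openin (zariski X) M" "x \<in> M" "p \<in> sections X M" "q \<in> sections X M"
      "q x \<noteq> 0" "\<forall>z\<in>M \<inter> N. q z \<noteq> 0 \<longrightarrow> f z = p z / q z"
    using loc[OF x] by blast
  let ?M = "{z \<in> M. q z \<noteq> 0}"
  have q: "openin (zariski X) ?M" "(\<lambda>z. inverse (q z)) \<in> sections X ?M"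
    using X(2) M(1,4) unfolding nonvanishing_invertible_def by auto
  have o: "openin (zariski X) (?M \<inter> N)" using q(1) N by (rule openin_Int)
  have "p \<in> sections X (?M \<inter> N)" by (rule sections_restrict[OF X(1) M(1) o _ M(3)]) auto
  moreover have "(\<lambda>z. inverse (q z)) \<in> sections X (?M \<inter> N)" by (rule sections_restrict[OF X(1) q(1) o _ q(2)]) auto
  ultimately have "(\<lambda>z. p z * inverse (q z)) \<in> sections X (?M \<inter> N)" by (rule sections_mult[OF X(1) o])
  then have "f \<in> sections X (?M \<inter> N)"
    by (rule sections_cong[OF X(1) o]) (use M(6) in \<open>auto simp: divide_inverse\<close>)
  then show "\<exists>V. openin (zariski X) V \<and> x \<in> V \<and> V \<subseteq> N \<and> f \<in> sections X V"
    using o x M(2,5) by (intro exI[of _ "?M \<inter> N"]) auto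
qed

lemma poly_fun_compose_section:
  assumes X: "sheaf_of_real_functions X" and w: "\<And>j. j < n \<Longrightarrow> (\<lambda>x. w x j) \<in> sections X (points X)"
    and P: "poly_fun n P"
  shows "(\<lambda>x. P (w x)) \<in> sections X (points X)"
  using P
proof induction
  case (const c) show ?case by (rule sections_const[OF X openin_topspace])
next
  case (coord i) then show ?case by (rule w)
next
  case (add P Q) then show ?case by (intro sections_add[OF X openin_topspace])
next
  case (mult P Q) then show ?case by (intro sections_mult[OF X openin_topspace])
qed

lemma regular_map_into_affine:
  assumes X: "sheaf_of_real_functions X" "nonvanishing_invertible X"
    and w: "\<And>j. j < n \<Longrightarrow> (\<lambda>x. w x j) \<in> sections X (points X)" and R: "\<And>x. x \<in> points X \<Longrightarrow> w x \<in> Rn n"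
  shows "regular_map X (affine_space n) w"
proof -
  have pw: "(\<lambda>x. P (w x)) \<in> sections X (points X)" if "poly_fun n P" for P
    by (rule poly_fun_compose_section[OF X(1) _ that]) (rule w)
  have c: "continuous_map (zariski X) (zariski (affine_space n)) w"
    unfolding zariski_affine
  proof (rule continuous_on_generated_topo)
    fix S assume "S \<in> {{x \<in> Rn n. P x \<noteq> 0} | P. poly_fun n P}"
    then obtain P where P: "S = {x \<in> Rn n. P x \<noteq> 0}" "poly_fun n P" by blast
    have "openin (zariski X) {x \<in> points X. P (w x) \<noteq> 0}"
      using X(2) pw[OF P(2)] unfolding nonvanishing_invertible_def by auto
    moreover have "{x \<in> points X. P (w x) \<noteq> 0} = w -` S \<inter> points X" using R P(1) by auto
    ultimately show "openin (zariski X) (w -` S \<inter> points X)" by simp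
  next
    have "w ` points X \<subseteq> points (affine_space n)" using R points_affine by blast
    then show "w ` points X \<subseteq> \<Union>{{x \<in> Rn n. P x \<noteq> 0} | P. poly_fun n P}"
      unfolding zariski_affine topology_generated_by_topspace .
  qed
  have "(\<lambda>x. f (w x)) \<in> sections X {x \<in> points X. w x \<in> U}"
    if U: "openin (zariski (affine_space n)) U" and f: "f \<in> sections (affine_space n) U" for U f
  proof (rule quotient_section[OF X])
    show "openin (zariski X) {x \<in> points X. w x \<in> U}" using c U by (simp add: continuous_map_def)
    fix x assume x: "x \<in> {x \<in> points X. w x \<in> U}"
    then obtain P Q where PQ: "poly_fun n P" "poly_fun n Q" "Q (w x) \<noteq> 0" "\<forall>z\<in>U. Q z \<noteq> 0 \<longrightarrow> f z = P z / Q z"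
      using f unfolding sections_affine_iff by blast
    show "\<exists>M p q. openin (zariski X) M \<and> x \<in> M \<and> p \<in> sections X M \<and> q \<in> sections X M \<and> q x \<noteq> 0 \<and>
      (\<forall>z\<in>M \<inter> {x \<in> points X. w x \<in> U}. q z \<noteq> 0 \<longrightarrow> f (w z) = p z / q z)"
      using pw[OF PQ(1)] pw[OF PQ(2)] PQ(3,4) x
      by (intro exI[of _ "points X"] exI[of _ "\<lambda>x. P (w x)"] exI[of _ "\<lambda>x. Q (w x)"]) auto
  qed
  then show ?thesis using c unfolding regular_map_def by (simp add: o_def)
qed

lemma tensor_sectionsE:
  assumes "h \<in> tensor_sections X U Y V"
  obtains k f g where "\<And>i. i < k \<Longrightarrow> f i \<in> sections X U" "\<And>i. i < k \<Longrightarrow> g i \<in> sections Y V"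
    "h = (\<lambda>p. \<Sum>i<(k::nat). f i (fst p) * g i (snd p))"
proof -
  obtain k f g where "\<forall>i<(k::nat). f i \<in> sections X U \<and> g i \<in> sections Y V"
      "h = (\<lambda>(x, y). \<Sum>i<k. f i x * g i y)"
    using assms unfolding tensor_sections_def by blast
  then show thesis by (intro that[of k f g]) (auto simp: fun_eq_iff)
qed

lemma tensor_sections_simple:
  assumes "f \<in> sections X U" "g \<in> sections Y V"
  shows "(\<lambda>p. f (fst p) * g (snd p)) \<in> tensor_sections X U Y V"
  unfolding tensor_sections_def using assms
  by (intro CollectI exI[of _ 1] exI[of _ "\<lambda>_. f"] exI[of _ "\<lambda>_. g"]) (auto simp: fun_eq_iff)

abbreviation prod_basic :: "('a set) \<Rightarrow> ('b set) \<Rightarrow> ('a \<times> 'b \<Rightarrow> real) \<Rightarrow> ('a \<times> 'b) set" where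
  "prod_basic U V h \<equiv> {w \<in> U \<times> V. h w \<noteq> 0}"

lemma zariski_prod:
  "zariski (prod_fspace X Y) = topology_generated_by {prod_basic U V h | U V h.
      openin (zariski X) U \<and> openin (zariski Y) V \<and> h \<in> tensor_sections X U Y V}"
  by (simp add: prod_fspace_def)

lemma sections_prod_iff:
  "f \<in> sections (prod_fspace X Y) W \<longleftrightarrow> (\<forall>w\<in>W. \<exists>U V P Q.
              openin (zariski X) U \<and> openin (zariski Y) V \<and> w \<in> U \<times> V \<and>
              P \<in> tensor_sections X U Y V \<and> Q \<in> tensor_sections X U Y V \<and> Q w \<noteq> 0 \<and>
              (\<forall>z\<in>W \<inter> U \<times> V. Q z \<noteq> 0 \<longrightarrow> f z = P z / Q z))"
  by (simp add: prod_fspace_def)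

lemma sections_prodE:
  assumes "f \<in> sections (prod_fspace X Y) W" "w \<in> W"
  obtains U V P Q where "openin (zariski X) U" "openin (zariski Y) V" "w \<in> U \<times> V"
    "P \<in> tensor_sections X U Y V" "Q \<in> tensor_sections X U Y V" "Q w \<noteq> 0"
    "\<And>z. z \<in> W \<Longrightarrow> z \<in> U \<times> V \<Longrightarrow> Q z \<noteq> 0 \<Longrightarrow> f z = P z / Q z"
proof -
  from assms(1)[unfolded sections_prod_iff, rule_format, OF assms(2)] show thesis
    by (elim exE conjE) (rule that, assumption+, simp)
qed

lemma openin_prod_basic:
  "openin (zariski X) U \<Longrightarrow> openin (zariski Y) V \<Longrightarrow> h \<in> tensor_sections X U Y V \<Longrightarrow>
    openin (zariski (prod_fspace X Y)) (prod_basic U V h)"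
  unfolding zariski_prod by (rule openin_generator) blast

lemma one_tensor:
  assumes "sheaf_of_real_functions Y" "openin (zariski Y) U"
  shows "(\<lambda>_. 1) \<in> tensor_sections Y U (affine_space n) V"
  using tensor_sections_simple[OF sections_const[OF assms, of 1] poly_fun_section[OF poly_fun.const[of n 1]], of V] by simp

lemma points_prod:
  assumes Y: "sheaf_of_real_functions Y"
  shows "points (prod_fspace Y (affine_space n)) = points Y \<times> Rn n"
proof
  show "points (prod_fspace Y (affine_space n)) \<subseteq> points Y \<times> Rn n"
  proof
    fix p assume "p \<in> points (prod_fspace Y (affine_space n))"
    then obtain U V where "openin (zariski Y) U" "openin (zariski (affine_space n)) V" "p \<in> U \<times> V"
      unfolding zariski_prod topology_generated_by_topspace by blast
    then show "p \<in> points Y \<times> Rn n" using openin_subset[of "zariski Y" U] openin_subset[of "zariski (affine_space n)" V]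
      unfolding points_affine by blast
  qed
  have "openin (zariski (prod_fspace Y (affine_space n))) (prod_basic (points Y) (points (affine_space n)) (\<lambda>_. 1))"
    by (rule openin_prod_basic[OF openin_topspace openin_topspace one_tensor[OF Y openin_topspace]])
  from openin_subset[OF this] show "points Y \<times> Rn n \<subseteq> points (prod_fspace Y (affine_space n))"
    by (simp add: points_affine)
qed

text \<open>
  A tensor pulls back to a finite sum of products of regular functions; hence basic open sets and
  local quotients pull back to sets and functions of the same kind.
\<close>
lemma regular_map_into_prod:
  assumes X: "sheaf_of_real_functions X" "nonvanishing_invertible X" and Y: "sheaf_of_real_functions Y"
    and g: "regular_map X Y g" and w: "regular_map X (affine_space n) w"
  shows "regular_map X (prod_fspace Y (affine_space n)) (\<lambda>x. (g x, w x))"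
proof -
  let ?Z = "prod_fspace Y (affine_space n)"
  define N where "N = (\<lambda>U V. {x \<in> points X. g x \<in> U} \<inter> {x \<in> points X. w x \<in> V})"
  have oN: "openin (zariski X) (N U V)" if "openin (zariski Y) U" "openin (zariski (affine_space n)) V" for U V
    unfolding N_def by (intro openin_Int regular_map_openin[OF g that(1)] regular_map_openin[OF w that(2)])
  have tN: "(\<lambda>x. h (g x, w x)) \<in> sections X (N U V)"
    if U: "openin (zariski Y) U" and V: "openin (zariski (affine_space n)) V" and h: "h \<in> tensor_sections Y U (affine_space n) V" for U V h
  proof (rule tensor_sectionsE[OF h])
    fix k f e assume fe: "\<And>i. i < k \<Longrightarrow> f i \<in> sections Y U" "\<And>i. i < k \<Longrightarrow> e i \<in> sections (affine_space n) V"
      and eq: "h = (\<lambda>p. \<Sum>i<(k::nat). f i (fst p) * e i (snd p))"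
    have "(\<lambda>x. \<Sum>i<k. f i (g x) * e i (w x)) \<in> sections X (N U V)"
    proof (intro sections_sum[OF X(1) oN[OF U V]] sections_mult[OF X(1) oN[OF U V]])
      fix i assume "i \<in> {..<k}"
      then have i: "i < k" by simp
      show "(\<lambda>x. f i (g x)) \<in> sections X (N U V)"
        by (rule sections_restrict[OF X(1) regular_map_openin[OF g U] oN[OF U V] _ regular_map_sections[OF g U fe(1)[OF i]]])
          (simp add: N_def)
      show "(\<lambda>x. e i (w x)) \<in> sections X (N U V)"
        by (rule sections_restrict[OF X(1) regular_map_openin[OF w V] oN[OF U V] _ regular_map_sections[OF w V fe(2)[OF i]]])
          (simp add: N_def)
    qed
    then show ?thesis by (simp add: eq)
  qed
  have c: "continuous_map (zariski X) (zariski ?Z) (\<lambda>x. (g x, w x))"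
    unfolding zariski_prod
  proof (rule continuous_on_generated_topo)
    fix S assume "S \<in> {prod_basic U V h | U V h.
      openin (zariski Y) U \<and> openin (zariski (affine_space n)) V \<and> h \<in> tensor_sections Y U (affine_space n) V}"
    then obtain U V h where S: "S = prod_basic U V h" "openin (zariski Y) U" "openin (zariski (affine_space n)) V"
       "h \<in> tensor_sections Y U (affine_space n) V" by blast
    have "openin (zariski X) {x \<in> N U V. h (g x, w x) \<noteq> 0}"
      using X(2) oN[OF S(2,3)] tN[OF S(2-4)] unfolding nonvanishing_invertible_def by blast
    moreover have "{x \<in> N U V. h (g x, w x) \<noteq> 0} = (\<lambda>x. (g x, w x)) -` S \<inter> points X" by (auto simp: N_def S(1))
    ultimately show "openin (zariski X) ((\<lambda>x. (g x, w x)) -` S \<inter> points X)" by simp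
  next
    have "(\<lambda>x. (g x, w x)) ` points X \<subseteq> points ?Z"
      using regular_map_points[OF g] regular_map_points[OF w] by (auto simp: points_prod[OF Y] points_affine)
    then show "(\<lambda>x. (g x, w x)) ` points X \<subseteq> \<Union>{prod_basic U V h | U V h.
      openin (zariski Y) U \<and> openin (zariski (affine_space n)) V \<and> h \<in> tensor_sections Y U (affine_space n) V}"
      unfolding zariski_prod topology_generated_by_topspace .
  qed
  have "(\<lambda>x. f (g x, w x)) \<in> sections X {x \<in> points X. (g x, w x) \<in> W}"
    if W: "openin (zariski ?Z) W" and f: "f \<in> sections ?Z W" for W f
  proof (rule quotient_section[OF X])
    show "openin (zariski X) {x \<in> points X. (g x, w x) \<in> W}" using c W by (simp add: continuous_map_def)
    fix x assume x: "x \<in> {x \<in> points X. (g x, w x) \<in> W}"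
    then have xW: "(g x, w x) \<in> W" by simp
    show "\<exists>M p q. openin (zariski X) M \<and> x \<in> M \<and> p \<in> sections X M \<and> q \<in> sections X M \<and> q x \<noteq> 0 \<and>
      (\<forall>z\<in>M \<inter> {x \<in> points X. (g x, w x) \<in> W}. q z \<noteq> 0 \<longrightarrow> f (g z, w z) = p z / q z)"
    proof (rule sections_prodE[OF f xW])
      fix U V P Q
      assume PQ: "openin (zariski Y) U" "openin (zariski (affine_space n)) V" "(g x, w x) \<in> U \<times> V"
        "P \<in> tensor_sections Y U (affine_space n) V" "Q \<in> tensor_sections Y U (affine_space n) V" "Q (g x, w x) \<noteq> 0"
        "\<And>z. z \<in> W \<Longrightarrow> z \<in> U \<times> V \<Longrightarrow> Q z \<noteq> 0 \<Longrightarrow> f z = P z / Q z"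
      have "openin (zariski X) (N U V)" "x \<in> N U V" using oN[OF PQ(1,2)] x PQ(3) by (auto simp: N_def)
      moreover have "f (g z, w z) = P (g z, w z) / Q (g z, w z)"
        if "z \<in> N U V" "(g z, w z) \<in> W" "Q (g z, w z) \<noteq> 0" for z
        by (rule PQ(7)) (use that in \<open>auto simp: N_def\<close>)
      ultimately show ?thesis
        using tN[OF PQ(1,2,4)] tN[OF PQ(1,2,5)] PQ(6)
        by (intro exI[of _ "N U V"] exI[of _ "\<lambda>x. P (g x, w x)"] exI[of _ "\<lambda>x. Q (g x, w x)"]) auto
    qed
  qed
  then show ?thesis using c unfolding regular_map_def by (simp add: o_def)
qed

lemma prod_coordinate_section:
  assumes Y: "sheaf_of_real_functions Y" and i: "i < n"
  shows "(\<lambda>p. snd p i) \<in> sections (prod_fspace Y (affine_space n)) (points (prod_fspace Y (affine_space n)))"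
  unfolding sections_prod_iff points_prod[OF Y]
proof
  fix w assume w: "w \<in> points Y \<times> Rn n"
  have "(\<lambda>p. snd p i) \<in> tensor_sections Y (points Y) (affine_space n) (Rn n)"
    using tensor_sections_simple[OF sections_const[OF Y openin_topspace, of 1] poly_fun_section[OF poly_fun.coord[OF i]]] by simp
  moreover have "openin (zariski (affine_space n)) (Rn n)" using openin_topspace[of "zariski (affine_space n)"] by (simp add: points_affine)
  ultimately show "\<exists>U V P Q. openin (zariski Y) U \<and> openin (zariski (affine_space n)) V \<and> w \<in> U \<times> V \<and>
       P \<in> tensor_sections Y U (affine_space n) V \<and> Q \<in> tensor_sections Y U (affine_space n) V \<and> Q w \<noteq> 0 \<and>
       (\<forall>z\<in>(points Y \<times> Rn n) \<inter> U \<times> V. Q z \<noteq> 0 \<longrightarrow> snd z i = P z / Q z)"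
    using w one_tensor[OF Y openin_topspace]
    by (intro exI[of _ "points Y"] exI[of _ "Rn n"] exI[of _ "\<lambda>p. snd p i"] exI[of _ "\<lambda>_. 1"]) auto
qed

section \<open>Differentials along the fibres of a vector bundle\<close>

text \<open>
  A vector bundle \<open>pr : E \<rightarrow> Y\<close>, embedded by \<open>\<phi>\<close> as the subbundle \<open>F\<close> of \<open>Y \<times> \<real>\<^sup>n\<close>, with inverse \<open>\<theta>\<close>.
\<close>
locale bundle_chart = affine_chart Y m \<psi>
  for Y :: "'y fspace" and m :: nat and \<psi> :: "'y \<Rightarrow> nat \<Rightarrow> real" +
  fixes E :: "'e fspace" and pr :: "'e \<Rightarrow> 'y" and n :: nat and F :: "('y \<times> (nat \<Rightarrow> real)) set"
    and \<phi> :: "'e \<Rightarrow> 'y \<times> (nat \<Rightarrow> real)" and \<theta> :: "'y \<times> (nat \<Rightarrow> real) \<Rightarrow> 'e"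
  assumes E_sheaf: "sheaf_of_real_functions E" and E_inv: "nonvanishing_invertible E"
    and F_subbundle: "algebraic_subbundle Y n F"
    and phi: "regular_map E (subspace_of (prod_fspace Y (affine_space n)) F) \<phi>"
    and theta: "regular_map (subspace_of (prod_fspace Y (affine_space n)) F) E \<theta>"
    and theta_phi: "u \<in> points E \<Longrightarrow> \<theta> (\<phi> u) = u"
    and phi_theta: "p \<in> F \<Longrightarrow> \<phi> (\<theta> p) = p"
    and fst_phi: "u \<in> points E \<Longrightarrow> fst (\<phi> u) = pr u"
begin

abbreviation YR :: "('y \<times> (nat \<Rightarrow> real)) fspace" where
  "YR \<equiv> prod_fspace Y (affine_space n)"

lemma F_subset: "F \<subseteq> points Y \<times> Rn n"
  using F_subbundle by (simp add: algebraic_subbundle_def)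

lemma points_F: "points (subspace_of YR F) = F"
  using F_subset by (auto simp: points_prod[OF sheaf])

lemma phi_in_F: "u \<in> points E \<Longrightarrow> \<phi> u \<in> F"
  using regular_map_points[OF phi] unfolding points_F .

lemma theta_points: "p \<in> F \<Longrightarrow> \<theta> p \<in> points E"
  using regular_map_points[OF theta] unfolding points_F .

definition fibre_space :: "'y \<Rightarrow> 'e fspace" where
  "fibre_space y = subspace_of E {u \<in> points E. pr u = y}"

end

text \<open>
  Germs are studied at a point \<open>o'\<close> of \<open>E\<close> with fibre coordinates \<open>v1\<close>, inside the fibre \<open>Z\<close> through
  it.
\<close>
locale bundle_chart_point = bundle_chart Y m \<psi> E pr n F \<phi> \<theta>
  for Y :: "'y fspace" and m :: nat and \<psi> :: "'y \<Rightarrow> nat \<Rightarrow> real"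
    and E :: "'e fspace" and pr n F \<phi> \<theta> +
  fixes o' :: 'e
  assumes base_point: "o' \<in> points E"
begin

abbreviation "Z \<equiv> fibre_space (pr o')"
abbreviation "v1 \<equiv> snd (\<phi> o')"

abbreviation nearF :: "('y \<times> (nat \<Rightarrow> real)) filter" where
  "nearF \<equiv> nearY (pr o') \<times>\<^sub>F near (Rn n) n (\<lambda>v. v) v1"

text \<open>
  Pairs of points of \<open>Y \<times> \<real>\<^sup>n\<close> over the same base point, the second one with fibre coordinates \<open>v1\<close>.
  The base point is allowed to vary near \<open>pr o'\<close>, which makes estimates for such pairs locally
  uniform over \<open>Y\<close>.
\<close>
definition pairsF :: "(('y \<times> (nat \<Rightarrow> real)) \<times> ('y \<times> (nat \<Rightarrow> real))) filter" where
  "pairsF = filtermap (\<lambda>p. (p, (fst p, v1))) nearF"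

lemma fst_base: "fst (\<phi> o') = pr o'"
  by (rule fst_phi[OF base_point])

lemma base_in: "pr o' \<in> points Y" "v1 \<in> Rn n"
  using subsetD[OF F_subset phi_in_F[OF base_point]] by (auto simp: mem_Times_iff fst_base)

lemma Z_sheaf: "sheaf_of_real_functions Z" and Z_inv: "nonvanishing_invertible Z"
  unfolding fibre_space_def by (rule sheaf_subspace[OF E_sheaf] nonvanishing_invertible_subspace[OF E_inv])+

lemma points_Z: "points Z = {u \<in> points E. pr u = pr o'}"
  by (auto simp: fibre_space_def)

lemma base_Z: "o' \<in> points Z"
  using base_point by (simp add: points_Z)

lemma regular_at_Z:
  assumes "f \<in> sections E (points E)"
  shows "f \<in> regular_at Z o'"
proof (rule regular_atI[OF openin_topspace base_Z])
  show "f \<in> sections Z (points Z)"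
    unfolding points_Z unfolding fibre_space_def
    by (rule sections_subspaceI[OF openin_topspace assms]) auto
qed

lemma coordinate_section_E:
  assumes "i < n"
  shows "(\<lambda>u. snd (\<phi> u) i) \<in> sections E (points E)"
proof -
  have "(\<lambda>p. snd p i) \<in> sections (subspace_of YR F) (points (subspace_of YR F))"
    unfolding points_F
    by (rule sections_subspaceI[OF openin_topspace prod_coordinate_section[OF sheaf assms]])
      (use F_subset in \<open>auto simp: points_prod[OF sheaf]\<close>)
  from regular_map_global_sections[OF phi this] show ?thesis .
qed

lemma eventually_pairsF: "eventually P pairsF \<longleftrightarrow> eventually (\<lambda>p. P (p, (fst p, v1))) nearF"
  by (simp add: pairsF_def eventually_filtermap)

text \<open>
  Validity near \<open>\<phi> o'\<close> in two senses: for the pairs entering the estimates, and on a Zariski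
  neighbourhood in the fibre, which is what germs depend on.
\<close>
definition locally_F :: "('y \<times> (nat \<Rightarrow> real) \<Rightarrow> bool) \<Rightarrow> bool" where
  "locally_F Q \<longleftrightarrow> eventually (\<lambda>w. Q (fst w) \<and> Q (snd w)) pairsF \<and>
     (\<exists>N. openin (zariski Z) N \<and> o' \<in> N \<and> (\<forall>u\<in>N. Q (\<phi> u)))"

lemma locally_F_base: "locally_F Q \<Longrightarrow> Q (\<phi> o')"
  unfolding locally_F_def by blast

lemma locally_F_mono:
  assumes "locally_F P" "\<And>p. P p \<Longrightarrow> Q p"
  shows "locally_F Q"
proof -
  have "eventually (\<lambda>w. Q (fst w) \<and> Q (snd w)) pairsF"
    using assms(1) unfolding locally_F_def by (auto elim!: eventually_mono intro: assms(2))
  moreover have "\<exists>N. openin (zariski Z) N \<and> o' \<in> N \<and> (\<forall>u\<in>N. Q (\<phi> u))"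
    using assms(1) unfolding locally_F_def by (auto intro: assms(2))
  ultimately show ?thesis unfolding locally_F_def by blast
qed

lemma locally_F_conj:
  assumes "locally_F P" "locally_F Q"
  shows "locally_F (\<lambda>p. P p \<and> Q p)"
proof -
  obtain N M where N: "openin (zariski Z) N" "o' \<in> N" "\<forall>u\<in>N. P (\<phi> u)"
    "openin (zariski Z) M" "o' \<in> M" "\<forall>u\<in>M. Q (\<phi> u)" using assms unfolding locally_F_def by blast
  have "openin (zariski Z) (N \<inter> M)" using N(1,4) by (rule openin_Int)
  then have "\<exists>N. openin (zariski Z) N \<and> o' \<in> N \<and> (\<forall>u\<in>N. P (\<phi> u) \<and> Q (\<phi> u))"
    using N by (intro exI[of _ "N \<inter> M"]) auto
  moreover have "eventually (\<lambda>w. (P (fst w) \<and> Q (fst w)) \<and> (P (snd w) \<and> Q (snd w))) pairsF"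
    using eventually_conj[OF assms[unfolded locally_F_def, THEN conjunct1]] by (rule eventually_mono) blast
  ultimately show ?thesis unfolding locally_F_def by blast
qed

lemma locally_F_total: "locally_F (\<lambda>p. p \<in> points Y \<times> Rn n)"
  unfolding locally_F_def
proof
  have "eventually (\<lambda>p. fst p \<in> points Y \<and> snd p \<in> Rn n) nearF"
    by (intro eventually_conj eventually_compose_filterlim[OF eventually_near_mem filterlim_fst]
        eventually_compose_filterlim[OF eventually_near_mem filterlim_snd])
  then show "eventually (\<lambda>w. fst w \<in> points Y \<times> Rn n \<and> snd w \<in> points Y \<times> Rn n) pairsF"
    unfolding eventually_pairsF by (rule eventually_mono) (use base_in in \<open>auto simp: mem_Times_iff\<close>)
  show "\<exists>N. openin (zariski Z) N \<and> o' \<in> N \<and> (\<forall>u\<in>N. \<phi> u \<in> points Y \<times> Rn n)"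
  proof (intro exI[of _ "points Z"] conjI openin_topspace base_Z ballI)
    fix u assume "u \<in> points Z"
    then show "\<phi> u \<in> points Y \<times> Rn n" using phi_in_F F_subset points_Z by blast
  qed
qed

lemma locally_F_base_open:
  assumes "openin (zariski Y) U" "pr o' \<in> U"
  shows "locally_F (\<lambda>p. fst p \<in> U)"
  unfolding locally_F_def
proof
  show "eventually (\<lambda>w. fst (fst w) \<in> U \<and> fst (snd w) \<in> U) pairsF"
    unfolding eventually_pairsF
    using eventually_compose_filterlim[OF eventually_nearY_zariski_open[OF assms] filterlim_fst] by simp
  show "\<exists>N. openin (zariski Z) N \<and> o' \<in> N \<and> (\<forall>u\<in>N. fst (\<phi> u) \<in> U)"
  proof (intro exI[of _ "points Z"] conjI openin_topspace base_Z ballI)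
    fix u assume "u \<in> points Z"
    then show "fst (\<phi> u) \<in> U" using fst_phi assms(2) points_Z by simp
  qed
qed

text \<open>
  The link between abstract tangent vectors and calculus: one covector \<open>l\<close> serves both as the strict
  differential of \<open>G\<close> along the fibres and as the expression of \<open>D G\<close> by the values of the
  derivation \<open>D\<close> on the coordinates.  Both rules propagate in the same way through sums, products and
  inverses.
\<close>
definition has_differential :: "('y \<times> (nat \<Rightarrow> real) \<Rightarrow> real) \<Rightarrow> (nat \<Rightarrow> real) \<Rightarrow> bool" where
  "has_differential G l \<longleftrightarrow> strictly_diff n snd pairsF (\<phi> o') G l \<and> (\<lambda>u. G (\<phi> u)) \<in> regular_at Z o' \<and>
     (\<forall>D\<in>tangent_vectors Z o'. D (\<lambda>u. G (\<phi> u)) = (\<Sum>j<n. l j * D (\<lambda>u. snd (\<phi> u) j)))"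

lemma has_differentialD:
  assumes "has_differential G l"
  shows "strictly_diff n snd pairsF (\<phi> o') G l" "(\<lambda>u. G (\<phi> u)) \<in> regular_at Z o'"
    "D \<in> tangent_vectors Z o' \<Longrightarrow> D (\<lambda>u. G (\<phi> u)) = (\<Sum>j<n. l j * D (\<lambda>u. snd (\<phi> u) j))"
  using assms unfolding has_differential_def by blast+

lemma has_differentialI:
  assumes "strictly_diff n snd pairsF (\<phi> o') G l" "(\<lambda>u. G (\<phi> u)) \<in> regular_at Z o'"
    "\<And>D. D \<in> tangent_vectors Z o' \<Longrightarrow> D (\<lambda>u. G (\<phi> u)) = (\<Sum>j<n. l j * D (\<lambda>u. snd (\<phi> u) j))"
  shows "has_differential G l"
  using assms unfolding has_differential_def by blast

lemma has_differential_add: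
  assumes f: "has_differential f l" and g: "has_differential g k"
  shows "has_differential (\<lambda>p. f p + g p) (\<lambda>j. l j + k j)"
proof (rule has_differentialI)
  note l = has_differentialD[OF f] and k = has_differentialD[OF g]
  show "strictly_diff n snd pairsF (\<phi> o') (\<lambda>p. f p + g p) (\<lambda>j. l j + k j)"
    by (rule strictly_diff_add[OF l(1) k(1)])
  show "(\<lambda>u. f (\<phi> u) + g (\<phi> u)) \<in> regular_at Z o'" by (rule regular_at_add[OF Z_sheaf l(2) k(2)])
  fix D assume D: "D \<in> tangent_vectors Z o'"
  show "D (\<lambda>u. f (\<phi> u) + g (\<phi> u)) = (\<Sum>j<n. (l j + k j) * D (\<lambda>u. snd (\<phi> u) j))"
    unfolding tangent_vectors_add[OF D l(2) k(2)] l(3)[OF D] k(3)[OF D] by (simp add: distrib_right sum.distrib)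
qed

lemma has_differential_mult:
  assumes f: "has_differential f l" and g: "has_differential g k"
  shows "has_differential (\<lambda>p. f p * g p) (\<lambda>j. g (\<phi> o') * l j + f (\<phi> o') * k j)"
proof (rule has_differentialI)
  note l = has_differentialD[OF f] and k = has_differentialD[OF g]
  show "strictly_diff n snd pairsF (\<phi> o') (\<lambda>p. f p * g p) (\<lambda>j. g (\<phi> o') * l j + f (\<phi> o') * k j)"
    by (rule strictly_diff_mult[OF l(1) k(1)])
  show "(\<lambda>u. f (\<phi> u) * g (\<phi> u)) \<in> regular_at Z o'" by (rule regular_at_mult[OF Z_sheaf l(2) k(2)])
  fix D assume D: "D \<in> tangent_vectors Z o'"
  show "D (\<lambda>u. f (\<phi> u) * g (\<phi> u)) = (\<Sum>j<n. (g (\<phi> o') * l j + f (\<phi> o') * k j) * D (\<lambda>u. snd (\<phi> u) j))"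
    unfolding tangent_vectors_mult[OF D l(2) k(2)] l(3)[OF D] k(3)[OF D]
    by (simp add: distrib_right sum.distrib sum_distrib_left mult.assoc)
qed

lemma has_differential_inverse:
  assumes f: "has_differential f l" and nz: "f (\<phi> o') \<noteq> 0"
  shows "has_differential (\<lambda>p. inverse (f p)) (\<lambda>j. - (inverse (f (\<phi> o')) * inverse (f (\<phi> o'))) * l j)"
proof (rule has_differentialI)
  note l = has_differentialD[OF f]
  show "strictly_diff n snd pairsF (\<phi> o') (\<lambda>p. inverse (f p)) (\<lambda>j. - (inverse (f (\<phi> o')) * inverse (f (\<phi> o'))) * l j)"
    by (rule strictly_diff_inverse[OF l(1) nz])
  show "(\<lambda>u. inverse (f (\<phi> u))) \<in> regular_at Z o'" by (rule regular_at_inverse[OF Z_inv l(2) nz])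
  fix D assume D: "D \<in> tangent_vectors Z o'"
  show "D (\<lambda>u. inverse (f (\<phi> u))) =
      (\<Sum>j<n. - (inverse (f (\<phi> o')) * inverse (f (\<phi> o'))) * l j * D (\<lambda>u. snd (\<phi> u) j))"
    unfolding tangent_vectors_inverse[OF Z_sheaf Z_inv base_Z D l(2) nz] l(3)[OF D]
    by (simp add: sum_distrib_left mult.assoc sum_negf)
qed

lemma has_differential_cong:
  assumes f: "has_differential f l" and eq: "locally_F (\<lambda>p. f p = g p)"
  shows "has_differential g l"
proof (rule has_differentialI)
  note l = has_differentialD[OF f]
  obtain N where N: "openin (zariski Z) N" "o' \<in> N" "\<forall>u\<in>N. f (\<phi> u) = g (\<phi> u)"
    using eq unfolding locally_F_def by blast
  show r: "(\<lambda>u. g (\<phi> u)) \<in> regular_at Z o'" by (rule regular_at_cong[OF Z_sheaf l(2) N(1,2)]) (use N(3) in simp)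
  have "f (\<phi> o') = g (\<phi> o')" by (rule locally_F_base[OF eq])
  then show "strictly_diff n snd pairsF (\<phi> o') g l"
    by (rule strictly_diff_cong[where g = g, OF l(1)]) (use eq in \<open>simp add: locally_F_def\<close>)
  fix D assume D: "D \<in> tangent_vectors Z o'"
  have "D (\<lambda>u. f (\<phi> u)) = D (\<lambda>u. g (\<phi> u))" by (rule tangent_vectors_cong[OF D l(2) r N(1,2)]) (use N(3) in simp)
  then show "D (\<lambda>u. g (\<phi> u)) = (\<Sum>j<n. l j * D (\<lambda>u. snd (\<phi> u) j))" using l(3)[OF D] by simp
qed

text \<open>
  Functions coming from the base are constant along the fibres.
\<close>
lemma has_differential_base:
  assumes U: "openin (zariski Y) U" and f: "f \<in> sections Y U" and y: "pr o' \<in> U"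
  shows "has_differential (\<lambda>p. f (fst p)) (\<lambda>_. 0)"
proof (rule has_differentialI)
  have lim: "((\<lambda>p. f (fst p)) \<longlongrightarrow> f (fst (\<phi> o'))) nearF"
    unfolding fst_base by (rule filterlim_compose[OF tendsto_section[OF U f y] filterlim_fst])
  show "strictly_diff n snd pairsF (\<phi> o') (\<lambda>p. f (fst p)) (\<lambda>_. 0)"
    unfolding strictly_diff_def
  proof (intro conjI)
    show "((\<lambda>w. f (fst (fst w))) \<longlongrightarrow> f (fst (\<phi> o'))) pairsF" "((\<lambda>w. f (fst (snd w))) \<longlongrightarrow> f (fst (\<phi> o'))) pairsF"
      unfolding pairsF_def filterlim_filtermap using lim by simp_all
    have ev: "eventually (\<lambda>w. 0 = f (fst (fst w)) - f (fst (snd w)) - (\<Sum>j<n. 0 * (snd (fst w) j - snd (snd w) j))) pairsF"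
      unfolding eventually_pairsF by simp
    show "(\<lambda>w. f (fst (fst w)) - f (fst (snd w)) - (\<Sum>j<n. 0 * (snd (fst w) j - snd (snd w) j)))
      \<in> o[pairsF](\<lambda>w. \<Sum>j<n. \<bar>snd (fst w) j - snd (snd w) j\<bar>)"
      by (rule landau_o.small.in_cong[THEN iffD1, OF ev]) simp
  qed
  have eq: "f (fst (\<phi> u)) = f (pr o')" if "u \<in> points Z" for u using that fst_phi by (simp add: points_Z)
  show r: "(\<lambda>u. f (fst (\<phi> u))) \<in> regular_at Z o'"
    by (rule regular_at_cong[OF Z_sheaf regular_at_const[OF Z_sheaf base_Z, of "f (pr o')"] openin_topspace base_Z eq])
  fix D assume D: "D \<in> tangent_vectors Z o'"
  have "D (\<lambda>u. f (fst (\<phi> u))) = D (\<lambda>_. f (pr o'))"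
    by (rule tangent_vectors_cong[OF D r regular_at_const[OF Z_sheaf base_Z] openin_topspace base_Z eq])
  then show "D (\<lambda>u. f (fst (\<phi> u))) = (\<Sum>j<n. 0 * D (\<lambda>u. snd (\<phi> u) j))"
    using tangent_vectors_const[OF Z_sheaf base_Z D] by simp
qed

definition fibre_differentiable :: "('y \<times> (nat \<Rightarrow> real) \<Rightarrow> real) \<Rightarrow> bool" where
  "fibre_differentiable G \<longleftrightarrow> (\<exists>l. has_differential G l)"

lemma fibre_differentiable_add:
  assumes "fibre_differentiable f" "fibre_differentiable g"
  shows "fibre_differentiable (\<lambda>p. f p + g p)"
  using assms unfolding fibre_differentiable_def by (elim exE) (rule exI, rule has_differential_add)

lemma fibre_differentiable_mult:
  assumes "fibre_differentiable f" "fibre_differentiable g"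
  shows "fibre_differentiable (\<lambda>p. f p * g p)"
  using assms unfolding fibre_differentiable_def by (elim exE) (rule exI, rule has_differential_mult)

lemma fibre_differentiable_inverse:
  assumes "fibre_differentiable f" "f (\<phi> o') \<noteq> 0"
  shows "fibre_differentiable (\<lambda>p. inverse (f p))"
  using assms unfolding fibre_differentiable_def by (elim exE) (rule exI, rule has_differential_inverse)

lemma fibre_differentiable_cong:
  assumes "fibre_differentiable f" "locally_F (\<lambda>p. f p = g p)"
  shows "fibre_differentiable g"
  using assms unfolding fibre_differentiable_def by (elim exE) (rule exI, rule has_differential_cong)

lemma fibre_differentiable_base:
  assumes "openin (zariski Y) U" "f \<in> sections Y U" "pr o' \<in> U"
  shows "fibre_differentiable (\<lambda>p. f (fst p))"
  unfolding fibre_differentiable_def by (rule exI, rule has_differential_base[OF assms])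

lemma locally_F_nonzero:
  assumes f: "fibre_differentiable f" and nz: "f (\<phi> o') \<noteq> 0"
  shows "locally_F (\<lambda>p. f p \<noteq> 0)"
proof -
  obtain l where l: "has_differential f l" using f unfolding fibre_differentiable_def by blast
  have "((\<lambda>w. f (fst w)) \<longlongrightarrow> f (\<phi> o')) pairsF" "((\<lambda>w. f (snd w)) \<longlongrightarrow> f (\<phi> o')) pairsF"
    using has_differentialD(1)[OF l] unfolding strictly_diff_def by auto
  then have "eventually (\<lambda>w. f (fst w) \<noteq> 0) pairsF" "eventually (\<lambda>w. f (snd w) \<noteq> 0) pairsF"
    using nz tendsto_imp_eventually_ne by blast+
  moreover obtain N where "openin (zariski Z) N" "o' \<in> N" "\<forall>u\<in>N. f (\<phi> u) \<noteq> 0"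
    by (rule regular_at_nonzero_nhd[OF Z_inv has_differentialD(2)[OF l] nz])
  ultimately show ?thesis unfolding locally_F_def eventually_conj_iff by blast
qed

lemma fibre_differentiable_const: "fibre_differentiable (\<lambda>_. c)"
  by (rule fibre_differentiable_base[OF openin_topspace sections_const[OF sheaf openin_topspace] base_in(1)])

lemma fibre_differentiable_coordinate:
  assumes i: "i < n"
  shows "fibre_differentiable (\<lambda>p. snd p i)"
  unfolding fibre_differentiable_def
proof (intro exI, rule has_differentialI)
  have "((\<lambda>p. snd p i) \<longlongrightarrow> v1 i) nearF"
    by (rule filterlim_compose[OF tendsto_near_coordinate[OF i] filterlim_snd])
  then have "((\<lambda>w. snd (fst w) i) \<longlongrightarrow> snd (\<phi> o') i) pairsF" unfolding pairsF_def filterlim_filtermap by simp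
  moreover have "((\<lambda>w. snd (snd w) i) \<longlongrightarrow> snd (\<phi> o') i) pairsF" unfolding pairsF_def filterlim_filtermap by simp
  ultimately show "strictly_diff n snd pairsF (\<phi> o') (\<lambda>p. snd p i) (\<lambda>j. if j = i then 1 else 0)"
    by (rule strictly_diff_coordinate[OF i])
  show "(\<lambda>u. snd (\<phi> u) i) \<in> regular_at Z o'" by (rule regular_at_Z[OF coordinate_section_E[OF i]])
  show "D (\<lambda>u. snd (\<phi> u) i) = (\<Sum>j<n. (if j = i then 1 else 0) * D (\<lambda>u. snd (\<phi> u) j))"
    for D :: "('e \<Rightarrow> real) \<Rightarrow> real"
    using i by (simp add: if_distrib[of "\<lambda>x. x * _"] cong: if_cong)
qed

lemma fibre_differentiable_poly: "poly_fun n P \<Longrightarrow> fibre_differentiable (\<lambda>p. P (snd p))"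
proof (induction rule: poly_fun.induct)
  case (const c) show ?case by (rule fibre_differentiable_const)
next
  case (coord i) then show ?case by (rule fibre_differentiable_coordinate)
next
  case (add P Q) then show ?case by (intro fibre_differentiable_add)
next
  case (mult P Q) then show ?case by (intro fibre_differentiable_mult)
qed

lemma fibre_differentiable_affine_section:
  assumes V: "openin (zariski (affine_space n)) V" and g: "g \<in> sections (affine_space n) V" and v: "v1 \<in> V"
  shows "fibre_differentiable (\<lambda>p. g (snd p))" "locally_F (\<lambda>p. snd p \<in> V)"
proof -
  obtain P Q where PQ: "poly_fun n P" "poly_fun n Q" "Q v1 \<noteq> 0" "\<forall>x\<in>Rn n. Q x \<noteq> 0 \<longrightarrow> x \<in> V \<and> g x = P x / Q x"
    using section_affine_local_quotient[OF V g v] by blast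
  have l: "locally_F (\<lambda>p. Q (snd p) \<noteq> 0 \<and> p \<in> points Y \<times> Rn n)"
    by (intro locally_F_conj locally_F_nonzero fibre_differentiable_poly PQ locally_F_total)
  have "fibre_differentiable (\<lambda>p. P (snd p) * inverse (Q (snd p)))" by (intro fibre_differentiable_mult fibre_differentiable_inverse fibre_differentiable_poly PQ)
  then show "fibre_differentiable (\<lambda>p. g (snd p))"
    by (rule fibre_differentiable_cong) (rule locally_F_mono[OF l], use PQ(4) in \<open>auto simp: divide_inverse\<close>)
  show "locally_F (\<lambda>p. snd p \<in> V)" by (rule locally_F_mono[OF l]) (use PQ(4) in auto)
qed

lemma fibre_differentiable_sum: "(\<And>i. i \<in> I \<Longrightarrow> fibre_differentiable (f i)) \<Longrightarrow> fibre_differentiable (\<lambda>p. \<Sum>i\<in>I. f i p)"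
proof (induction I rule: infinite_finite_induct)
  case (insert i I)
  then have "fibre_differentiable (\<lambda>p. f i p + (\<Sum>i\<in>I. f i p))" by (intro fibre_differentiable_add) auto
  then show ?case using insert by simp
qed (simp_all add: fibre_differentiable_const)

lemma fibre_differentiable_tensor:
  assumes U: "openin (zariski Y) U" and V: "openin (zariski (affine_space n)) V"
    and h: "h \<in> tensor_sections Y U (affine_space n) V" and p: "\<phi> o' \<in> U \<times> V"
  shows "fibre_differentiable h"
proof (rule tensor_sectionsE[OF h])
  fix k f g assume fg: "\<And>i. i < k \<Longrightarrow> f i \<in> sections Y U" "\<And>i. i < k \<Longrightarrow> g i \<in> sections (affine_space n) V"
    and eq: "h = (\<lambda>p. \<Sum>i<(k::nat). f i (fst p) * g i (snd p))"
  have "pr o' \<in> U" "v1 \<in> V" using p by (auto simp: mem_Times_iff fst_base)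
  then show ?thesis unfolding eq
    by (intro fibre_differentiable_sum fibre_differentiable_mult fibre_differentiable_base[OF U] fibre_differentiable_affine_section(1)[OF V] fg) auto
qed

lemma locally_F_rectangle:
  assumes U: "openin (zariski Y) U" and V: "openin (zariski (affine_space n)) V" and p: "\<phi> o' \<in> U \<times> V"
  shows "locally_F (\<lambda>p. p \<in> U \<times> V)"
proof -
  have "pr o' \<in> U" "v1 \<in> V" using p by (auto simp: mem_Times_iff fst_base)
  then have "locally_F (\<lambda>p. fst p \<in> U \<and> snd p \<in> V)"
    by (intro locally_F_conj locally_F_base_open[OF U] fibre_differentiable_affine_section(2)[OF V poly_fun_section[OF poly_fun.const[of n 0]]])
  then show ?thesis by (simp add: mem_Times_iff)
qed

text \<open>
  The Zariski topology of the product is generated by nonvanishing loci of tensors, and tensors are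
  continuous at \<open>\<phi> o'\<close>.
\<close>
lemma locally_F_open:
  assumes W: "openin (zariski YR) W" and p: "\<phi> o' \<in> W"
  shows "locally_F (\<lambda>p. p \<in> W)"
proof -
  obtain T where T: "finite T" "T \<subseteq> {prod_basic U V h | U V h.
      openin (zariski Y) U \<and> openin (zariski (affine_space n)) V \<and> h \<in> tensor_sections Y U (affine_space n) V}"
    "\<phi> o' \<in> \<Inter>T" "\<Inter>T \<subseteq> W"
    using generated_topology_nhd[OF W[unfolded zariski_prod] p] by auto
  have "locally_F (\<lambda>p. p \<in> \<Inter>T)" using T(1-3)
  proof (induction T)
    case empty
    show ?case by (rule locally_F_mono[OF locally_F_total]) simp
  next
    case (insert B T)
    then obtain U V h where B: "B = prod_basic U V h" "openin (zariski Y) U" "openin (zariski (affine_space n)) V"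
      "h \<in> tensor_sections Y U (affine_space n) V" by auto
    have pB: "\<phi> o' \<in> U \<times> V" "h (\<phi> o') \<noteq> 0" using insert.prems B(1) by auto
    have "locally_F (\<lambda>p. (p \<in> U \<times> V \<and> h p \<noteq> 0) \<and> p \<in> \<Inter>T)"
      using insert by (intro locally_F_conj locally_F_rectangle[OF B(2,3) pB(1)]
          locally_F_nonzero[OF fibre_differentiable_tensor[OF B(2-4) pB(1)] pB(2)] insert.IH) auto
    then show ?case by (rule locally_F_mono) (use B(1) in auto)
  qed
  then show ?thesis by (rule locally_F_mono) (use T(4) in blast)
qed

lemma fibre_differentiable_prod_section:
  assumes W: "openin (zariski YR) W" and g: "g \<in> sections YR W" and p: "\<phi> o' \<in> W"
  shows "fibre_differentiable g"
proof (rule sections_prodE[OF g p])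
  fix U V P Q
  assume PQ: "openin (zariski Y) U" "openin (zariski (affine_space n)) V" "\<phi> o' \<in> U \<times> V"
    "P \<in> tensor_sections Y U (affine_space n) V" "Q \<in> tensor_sections Y U (affine_space n) V" "Q (\<phi> o') \<noteq> 0"
    "\<And>z. z \<in> W \<Longrightarrow> z \<in> U \<times> V \<Longrightarrow> Q z \<noteq> 0 \<Longrightarrow> g z = P z / Q z"
  note gP = fibre_differentiable_tensor[OF PQ(1,2,4,3)] and gQ = fibre_differentiable_tensor[OF PQ(1,2,5,3)]
  have l: "locally_F (\<lambda>p. p \<in> W \<and> p \<in> U \<times> V \<and> Q p \<noteq> 0)"
    by (intro locally_F_conj locally_F_open[OF W p] locally_F_rectangle[OF PQ(1-3)] locally_F_nonzero[OF gQ PQ(6)])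
  have "fibre_differentiable (\<lambda>p. P p * inverse (Q p))" by (intro fibre_differentiable_mult gP fibre_differentiable_inverse gQ PQ(6))
  then show ?thesis
    by (rule fibre_differentiable_cong) (rule locally_F_mono[OF l], use PQ(7) in \<open>auto simp: divide_inverse\<close>)
qed

text \<open>
  A regular function on \<open>F\<close> extends to \<open>Y \<times> \<real>\<^sup>n\<close> near \<open>\<phi> o'\<close>; what is known about the extension is
  restricted to pairs of points of \<open>F\<close>.
\<close>
lemma section_on_F:
  assumes H: "H \<in> sections (subspace_of YR F) F"
  shows "\<exists>l. ((H \<longlongrightarrow> H (\<phi> o')) (inf nearF (principal F))) \<and>
    strictly_diff n snd (inf pairsF (principal (F \<times> F))) (\<phi> o') H l \<and>
    (\<forall>D\<in>tangent_vectors Z o'. D (\<lambda>u. H (\<phi> u)) = (\<Sum>j<n. l j * D (\<lambda>u. snd (\<phi> u) j)))"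
proof -
  note pF = phi_in_F[OF base_point]
  obtain W g where W: "openin (zariski YR) W" "\<phi> o' \<in> W" "g \<in> sections YR W" "\<forall>p\<in>F \<inter> W. H p = g p"
    using sections_subspaceE[OF H pF] by blast
  have lW: "locally_F (\<lambda>p. p \<in> W)" by (rule locally_F_open[OF W(1,2)])
  show ?thesis
  proof -
    obtain l where hl: "has_differential g l"
      using fibre_differentiable_prod_section[OF W(1,3,2)] unfolding fibre_differentiable_def by blast
    note l = has_differentialD[OF hl]
    have Hb: "g (\<phi> o') = H (\<phi> o')" using W(2,4) pF by simp
    have evW: "eventually (\<lambda>p. p \<in> W) nearF"
      using lW unfolding locally_F_def eventually_pairsF by (auto elim!: eventually_mono)
    have "((\<lambda>w. g (fst w)) \<longlongrightarrow> g (\<phi> o')) pairsF" using l(1) unfolding strictly_diff_def by blast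
    then have "(g \<longlongrightarrow> g (\<phi> o')) nearF" unfolding pairsF_def filterlim_filtermap by simp
    then have "(g \<longlongrightarrow> H (\<phi> o')) (inf nearF (principal F))" unfolding Hb by (rule tendsto_mono[OF inf_le1])
    moreover have "eventually (\<lambda>p. g p = H p) (inf nearF (principal F))"
      unfolding eventually_inf_principal using evW by (rule eventually_mono) (use W(4) in auto)
    ultimately have 1: "(H \<longlongrightarrow> H (\<phi> o')) (inf nearF (principal F))" by (rule Lim_transform_eventually)
    have le: "inf pairsF (principal (F \<times> F)) \<le> pairsF" by simp
    have "strictly_diff n snd (inf pairsF (principal (F \<times> F))) (\<phi> o') g l"
      using l(1) unfolding strictly_diff_def
      by (auto intro: tendsto_mono[OF le] landau_o.small.filter_mono[OF le])
    then have 2: "strictly_diff n snd (inf pairsF (principal (F \<times> F))) (\<phi> o') H l"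
    proof (rule strictly_diff_cong[where g = H])
      show "g (\<phi> o') = H (\<phi> o')" by (rule Hb)
      have "eventually (\<lambda>w. fst w \<in> W \<and> snd w \<in> W) pairsF" using lW unfolding locally_F_def by blast
      then show "eventually (\<lambda>w. g (fst w) = H (fst w) \<and> g (snd w) = H (snd w)) (inf pairsF (principal (F \<times> F)))"
        unfolding eventually_inf_principal by (rule eventually_mono) (use W(4) in auto)
    qed
    obtain N where N: "openin (zariski Z) N" "o' \<in> N" "\<forall>u\<in>N. \<phi> u \<in> W" using lW unfolding locally_F_def by blast
    have NF: "\<phi> u \<in> F" if "u \<in> N" for u
      using openin_subset[OF N(1)] that phi_in_F by (auto simp: points_Z)
    have eq: "H (\<phi> u) = g (\<phi> u)" if "u \<in> N" for u using N(3) NF[OF that] W(4) that by auto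
    have r: "(\<lambda>u. H (\<phi> u)) \<in> regular_at Z o'" by (rule regular_at_cong[OF Z_sheaf l(2) N(1,2) eq])
    have "\<forall>D\<in>tangent_vectors Z o'. D (\<lambda>u. H (\<phi> u)) = (\<Sum>j<n. l j * D (\<lambda>u. snd (\<phi> u) j))"
      using tangent_vectors_cong[OF _ r l(2) N(1,2) eq] l(3) by simp
    then show ?thesis using 1 2 by blast
  qed
qed

end

section \<open>Corrections along a dominating spray\<close>

lemma eventually_near_prodD:
  assumes "eventually P (near S N e p \<times>\<^sub>F near S' N' e' p')"
  shows "\<exists>\<eta>>0. \<forall>q\<in>S. \<forall>q'\<in>S'. (\<Sum>j<N. \<bar>e q j - e p j\<bar>) < \<eta> \<longrightarrow> (\<Sum>j<N'. \<bar>e' q' j - e' p' j\<bar>) < \<eta> \<longrightarrow> P (q, q')"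
proof -
  obtain Q R where Q: "eventually Q (near S N e p)" and R: "eventually R (near S' N' e' p')"
    and QR: "\<And>q q'. Q q \<Longrightarrow> R q' \<Longrightarrow> P (q, q')"
    using assms unfolding eventually_prod_filter by blast
  obtain \<eta> where \<eta>: "\<eta> > 0" "\<forall>q\<in>S. (\<Sum>j<N. \<bar>e q j - e p j\<bar>) < \<eta> \<longrightarrow> Q q" using Q unfolding eventually_near by blast
  obtain \<kappa> where \<kappa>: "\<kappa> > 0" "\<forall>q\<in>S'. (\<Sum>j<N'. \<bar>e' q j - e' p' j\<bar>) < \<kappa> \<longrightarrow> R q" using R unfolding eventually_near by blast
  show ?thesis using \<eta> \<kappa> QR by (intro exI[of _ "min \<eta> \<kappa>"]) auto
qed

context bundle_chart
begin

lemma linear_subspace_fibre: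
  assumes y: "y \<in> points Y"
  shows "linear_subspace {v. (y, v) \<in> F}"
proof -
  obtain U r e where U: "y \<in> U" "\<forall>z\<in>U. bij_betw (\<lambda>c j. \<Sum>i<(r::nat). c i * e i z j) (Rn r) {v. (z, v) \<in> F}"
    using F_subbundle y unfolding algebraic_subbundle_def by blast
  define L where "L = (\<lambda>c j. \<Sum>i<r. c i * e i y j)"
  have im: "{v. (y, v) \<in> F} = L ` Rn r"
    using bij_betw_imp_surj_on[OF U(2)[rule_format, OF U(1)]] by (simp add: L_def)
  show ?thesis
    unfolding linear_subspace_def im
  proof (intro conjI ballI allI)
    have "(\<lambda>_. 0) = L (\<lambda>_. 0)" by (simp add: L_def)
    then show "(\<lambda>_. 0) \<in> L ` Rn r" by (rule image_eqI[where f = L]) (simp add: Rn_def)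
    fix u assume "u \<in> L ` Rn r"
    then obtain a where a: "u = L a" "a \<in> Rn r" by blast
    have "(\<lambda>j. c * u j) = L (\<lambda>i. c * a i)" for c by (simp add: a L_def sum_distrib_left mult.assoc)
    then show "(\<lambda>j. c * u j) \<in> L ` Rn r" for c by (rule image_eqI[where f = L]) (use a in \<open>simp add: Rn_def\<close>)
    fix v assume "v \<in> L ` Rn r"
    then obtain b where b: "v = L b" "b \<in> Rn r" by blast
    have "(\<lambda>j. u j + v j) = L (\<lambda>i. a i + b i)" by (simp add: a b L_def distrib_right sum.distrib)
    then show "(\<lambda>j. u j + v j) \<in> L ` Rn r" by (rule image_eqI[where f = L]) (use a b in \<open>simp add: Rn_def\<close>)
  qed
qed

text \<open>
  Constant coefficients in a local frame give a section near \<open>y\<close>.  Multiplying it by a function \<open>q\<close>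
  that clears denominators and vanishes where the frame is not defined makes it global, and
  dividing by the number \<open>q y\<close> restores the value at \<open>y\<close>.
\<close>
lemma vector_field_extension:
  assumes y: "y \<in> points Y" and \<omega>: "(y, \<omega>) \<in> F"
  shows "\<exists>\<xi>. (\<forall>j<n. (\<lambda>z. \<xi> z j) \<in> sections Y (points Y)) \<and> (\<forall>z\<in>points Y. (z, \<xi> z) \<in> F) \<and> \<xi> y = \<omega>"
proof -
  obtain U r e where U: "openin (zariski Y) U" "y \<in> U" "\<forall>i<(r::nat). \<forall>j<n. (\<lambda>z. e i z j) \<in> sections Y U"
    "\<forall>z\<in>U. bij_betw (\<lambda>c j. \<Sum>i<r. c i * e i z j) (Rn r) {v. (z, v) \<in> F}"
    using F_subbundle y unfolding algebraic_subbundle_def by blast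
  have im: "{v. (z, v) \<in> F} = (\<lambda>c j. \<Sum>i<r. c i * e i z j) ` Rn r" if "z \<in> U" for z
    using bij_betw_imp_surj_on[OF U(4)[rule_format, OF that]] by simp
  obtain c where c: "c \<in> Rn r" "\<omega> = (\<lambda>j. \<Sum>i<r. c i * e i y j)" using im[OF U(2)] \<omega> by blast
  define f where "f = (\<lambda>j z. \<Sum>i<r. c i * e i z j)"
  have fF: "(z, \<lambda>j. f j z) \<in> F" if "z \<in> U" for z using im[OF that] c(1) unfolding f_def by blast
  have f0: "f j z = 0" if "z \<in> U" "j \<ge> n" for z j using fF[OF that(1)] F_subset that(2) by (auto simp: Rn_def)
  have fs: "f j \<in> sections Y U" if "j < n" for j
    unfolding f_def using U(3) that
    by (intro sections_sum[OF sheaf U(1)] sections_mult[OF sheaf U(1)] sections_const[OF sheaf U(1)]) auto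
  obtain q g where q: "q \<in> sections Y (points Y)" "q y \<noteq> 0" "\<forall>z\<in>points Y. q z \<noteq> 0 \<longrightarrow> z \<in> U"
    "\<forall>j<n. g j \<in> sections Y (points Y) \<and> (\<forall>z\<in>points Y. if q z = 0 then g j z = 0 else g j z = q z * f j z)"
    using globalize_sections[OF U(1,2), of n f] fs by auto
  define \<xi> where "\<xi> = (\<lambda>z j. if j < n then inverse (q y) * g j z else 0)"
  have "(\<lambda>z. \<xi> z j) \<in> sections Y (points Y)" if "j < n" for j
    using that q(4) unfolding \<xi>_def
    by (auto intro!: sections_mult[OF sheaf openin_topspace] sections_const[OF sheaf openin_topspace])
  moreover have \<xi>: "\<xi> z = (\<lambda>j. (inverse (q y) * q z) * f j z)" if z: "z \<in> points Y" "q z \<noteq> 0" for z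
  proof
    fix j
    show "\<xi> z j = (inverse (q y) * q z) * f j z"
      using q(3,4) z f0[of z j] by (cases "j < n") (auto simp: \<xi>_def)
  qed
  moreover have "(z, \<xi> z) \<in> F" if z: "z \<in> points Y" for z
  proof (cases "q z = 0")
    case True
    then have "\<xi> z = (\<lambda>_. 0)" using q(4) z by (auto simp: \<xi>_def)
    then show ?thesis using linear_subspace_zero[OF linear_subspace_fibre[OF z]] by simp
  next
    case False
    have "(\<lambda>j. f j z) \<in> {v. (z, v) \<in> F}" using fF False q(3) z by auto
    from linear_subspace_scale[OF linear_subspace_fibre[OF z] this, of "inverse (q y) * q z"]
    show ?thesis using \<xi>[OF z False] by simp
  qed
  moreover have "\<xi> y = \<omega>" using \<xi>[OF y q(2)] q(2) c(2) by (simp add: f_def)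
  ultimately show ?thesis by blast
qed

end

text \<open>
  A dominating spray on a bundle presented as above.
\<close>
locale spray_chart = bundle_chart Y m \<psi> E pr n F \<phi> \<theta>
  for Y :: "'y fspace" and m :: nat and \<psi> :: "'y \<Rightarrow> nat \<Rightarrow> real"
    and E :: "'e fspace" and pr and n :: nat and F \<phi> \<theta> +
  fixes zero :: "'y \<Rightarrow> 'e" and s :: "'e \<Rightarrow> 'y"
  assumes zero_point: "y \<in> points Y \<Longrightarrow> zero y \<in> points E"
    and phi_zero: "y \<in> points Y \<Longrightarrow> \<phi> (zero y) = (y, \<lambda>_. 0)"
    and s_regular: "regular_map E Y s"
    and s_zero: "y \<in> points Y \<Longrightarrow> s (zero y) = y"
    and s_dominating: "y \<in> points Y \<Longrightarrow> submersion_at (fibre_space y) Y s (zero y)"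
begin

lemma pr_zero: "y \<in> points Y \<Longrightarrow> pr (zero y) = y"
  using fst_phi[OF zero_point] phi_zero by simp

lemma theta_zero: "y \<in> points Y \<Longrightarrow> \<theta> (y, \<lambda>_. 0) = zero y"
  using theta_phi[OF zero_point] phi_zero by simp

lemma zero_in_F: "y \<in> points Y \<Longrightarrow> (y, \<lambda>_. 0) \<in> F"
  using phi_in_F[OF zero_point] phi_zero by simp

definition vector_fields :: "(nat \<Rightarrow> 'y \<Rightarrow> nat \<Rightarrow> real) \<Rightarrow> bool" where
  "vector_fields \<xi> \<longleftrightarrow> (\<forall>l<m. (\<forall>j<n. (\<lambda>z. \<xi> l z j) \<in> sections Y (points Y)) \<and> (\<forall>z\<in>points Y. (z, \<xi> l z) \<in> F))"

definition combination :: "(nat \<Rightarrow> 'y \<Rightarrow> nat \<Rightarrow> real) \<Rightarrow> 'y \<Rightarrow> (nat \<Rightarrow> real) \<Rightarrow> nat \<Rightarrow> real" where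
  "combination \<xi> y a = (\<lambda>j. \<Sum>l<m. a l * \<xi> l y j)"

text \<open>
  The spray applied to a linear combination of the fields \<open>\<xi>\<close>: a family of regular self-maps of \<open>Y\<close>
  with parameter \<open>a\<close>, which is the identity for \<open>a = 0\<close>.
\<close>
definition correction :: "(nat \<Rightarrow> 'y \<Rightarrow> nat \<Rightarrow> real) \<Rightarrow> 'y \<Rightarrow> (nat \<Rightarrow> real) \<Rightarrow> 'y" where
  "correction \<xi> y a = s (\<theta> (y, combination \<xi> y a))"

lemma combination_in_F:
  assumes "vector_fields \<xi>" "y \<in> points Y"
  shows "(y, combination \<xi> y a) \<in> F"
  using linear_subspace_sum[OF linear_subspace_fibre[OF assms(2)], of "{..<m}" "\<lambda>l. \<xi> l y" a] assms
  by (auto simp: vector_fields_def combination_def)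

lemma correction_zero:
  assumes "y \<in> points Y" "\<And>l. l < m \<Longrightarrow> a l = 0"
  shows "correction \<xi> y a = y"
  using assms by (simp add: correction_def combination_def theta_zero s_zero)

lemma correction_regular:
  assumes X: "sheaf_of_real_functions X" "nonvanishing_invertible X" and \<xi>: "vector_fields \<xi>"
    and g: "regular_map X Y g" and a: "\<And>l. l < m \<Longrightarrow> (\<lambda>x. a x l) \<in> sections X (points X)"
  shows "regular_map X Y (\<lambda>x. correction \<xi> (g x) (a x))"
proof -
  have F: "(g x, combination \<xi> (g x) (a x)) \<in> F" if "x \<in> points X" for x
    by (rule combination_in_F[OF \<xi> regular_map_points[OF g that]])
  have "regular_map X (affine_space n) (\<lambda>x. combination \<xi> (g x) (a x))"
  proof (rule regular_map_into_affine[OF X])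
    fix j assume j: "j < n"
    show "(\<lambda>x. combination \<xi> (g x) (a x) j) \<in> sections X (points X)"
      unfolding combination_def
    proof (intro sections_sum[OF X(1) openin_topspace] sections_mult[OF X(1) openin_topspace] a)
      fix l assume "l \<in> {..<m}"
      then have "(\<lambda>z. \<xi> l z j) \<in> sections Y (points Y)" using \<xi> j by (simp add: vector_fields_def)
      then show "(\<lambda>x. \<xi> l (g x) j) \<in> sections X (points X)" by (rule regular_map_global_sections[OF g])
    qed simp
  next
    fix x assume "x \<in> points X"
    then show "combination \<xi> (g x) (a x) \<in> Rn n" using F F_subset by blast
  qed
  then have "regular_map X YR (\<lambda>x. (g x, combination \<xi> (g x) (a x)))"
    by (rule regular_map_into_prod[OF X sheaf g])
  then have "regular_map X (subspace_of YR F) (\<lambda>x. (g x, combination \<xi> (g x) (a x)))"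
    by (rule regular_map_into_subspace[OF X(1) _ F])
  from regular_map_compose[OF regular_map_compose[OF this theta] s_regular]
  show ?thesis by (simp add: correction_def)
qed

lemma spray_coordinate_section:
  assumes "k < m"
  shows "(\<lambda>p. \<psi> (s (\<theta> p)) k) \<in> sections (subspace_of YR F) F"
  using regular_map_global_sections[OF regular_map_compose[OF theta s_regular] coordinate_section[OF assms]]
  unfolding points_F .

abbreviation nearA :: "(nat \<Rightarrow> real) \<Rightarrow> (nat \<Rightarrow> real) filter" where
  "nearA \<equiv> near UNIV m (\<lambda>a. a)"

lemma tendsto_vector_field:
  assumes "vector_fields \<xi>" "l < m" "j < n" "y \<in> points Y"
  shows "((\<lambda>z. \<xi> l z j) \<longlongrightarrow> \<xi> l y j) (nearY y)"
  using assms by (intro tendsto_section[OF openin_topspace]) (auto simp: vector_fields_def)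

lemma filterlim_combination:
  assumes \<xi>: "vector_fields \<xi>" and y: "y \<in> points Y"
  shows "filterlim (\<lambda>p. (fst p, combination \<xi> (fst p) (snd p)))
    (inf (nearY y \<times>\<^sub>F near (Rn n) n (\<lambda>v. v) (combination \<xi> y a)) (principal F)) (nearY y \<times>\<^sub>F nearA a)"
proof -
  have ev: "eventually (\<lambda>p. fst p \<in> points Y) (nearY y \<times>\<^sub>F nearA a)"
    by (rule eventually_compose_filterlim[OF eventually_near_mem filterlim_fst])
  have F: "eventually (\<lambda>p. (fst p, combination \<xi> (fst p) (snd p)) \<in> F) (nearY y \<times>\<^sub>F nearA a)"
    using ev by (rule eventually_mono) (rule combination_in_F[OF \<xi>])
  have "filterlim (\<lambda>p. combination \<xi> (fst p) (snd p)) (near (Rn n) n (\<lambda>v. v) (combination \<xi> y a)) (nearY y \<times>\<^sub>F nearA a)"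
  proof (rule filterlim_near)
    show "eventually (\<lambda>p. combination \<xi> (fst p) (snd p) \<in> Rn n) (nearY y \<times>\<^sub>F nearA a)"
      using F by (rule eventually_mono) (use F_subset in blast)
    fix j assume j: "j < n"
    show "((\<lambda>p. combination \<xi> (fst p) (snd p) j) \<longlongrightarrow> combination \<xi> y a j) (nearY y \<times>\<^sub>F nearA a)"
      unfolding combination_def
    proof (intro tendsto_sum tendsto_mult)
      fix l assume "l \<in> {..<m}"
      then have l: "l < m" by simp
      show "((\<lambda>p. snd p l) \<longlongrightarrow> a l) (nearY y \<times>\<^sub>F nearA a)"
        by (rule filterlim_compose[OF tendsto_near_coordinate[OF l] filterlim_snd])
      show "((\<lambda>p. \<xi> l (fst p) j) \<longlongrightarrow> \<xi> l y j) (nearY y \<times>\<^sub>F nearA a)"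
        by (rule filterlim_compose[OF tendsto_vector_field[OF \<xi> l j y] filterlim_fst])
    qed
  qed
  then show ?thesis
    unfolding filterlim_inf filterlim_principal using F by (auto intro: filterlim_Pair filterlim_fst)
qed

lemma tendsto_correction:
  assumes \<xi>: "vector_fields \<xi>" and y: "y \<in> points Y" and k: "k < m"
  shows "((\<lambda>p. \<psi> (correction \<xi> (fst p) (snd p)) k) \<longlongrightarrow> \<psi> (correction \<xi> y a) k) (nearY y \<times>\<^sub>F nearA a)"
proof -
  have yF: "(y, combination \<xi> y a) \<in> F" by (rule combination_in_F[OF \<xi> y])
  interpret P: bundle_chart_point Y m \<psi> E pr n F \<phi> \<theta> "\<theta> (y, combination \<xi> y a)"
    by standard (rule theta_points[OF yF])
  have b: "\<phi> (\<theta> (y, combination \<xi> y a)) = (y, combination \<xi> y a)" by (rule phi_theta[OF yF])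
  have pr: "pr (\<theta> (y, combination \<xi> y a)) = y" using P.fst_base b by simp
  have "((\<lambda>p. \<psi> (s (\<theta> p)) k) \<longlongrightarrow> \<psi> (s (\<theta> (y, combination \<xi> y a))) k)
    (inf (nearY y \<times>\<^sub>F near (Rn n) n (\<lambda>v. v) (combination \<xi> y a)) (principal F))"
    using P.section_on_F[OF spray_coordinate_section[OF k]] unfolding b pr snd_conv by blast
  from filterlim_compose[OF this filterlim_combination[OF \<xi> y]]
  show ?thesis by (simp add: correction_def)
qed

text \<open>
  Domination lifts the derivations of \<open>tangent_frame\<close> to derivations \<open>\<delta>\<close> of the fibre at the zero
  vector.  The values of \<open>\<delta>\<close> on the fibre coordinates form a vector \<open>\<omega>\<close>; it satisfies every linear
  relation that holds on the fibre, hence lies in the fibre and extends to a global field.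
  The covector \<open>\<rho> k\<close> is the differential along the fibre of the \<open>k\<close>-th chart coordinate of the
  spray, so its value on \<open>\<omega>\<close> is the prescribed one.
\<close>
lemma dominating_vector_fields:
  assumes y: "y \<in> points Y"
  shows "\<exists>\<xi> \<mu> \<rho>. vector_fields \<xi> \<and> (\<forall>k<m. \<mu> k \<in> null_covectors y) \<and>
    (\<forall>k<m. \<forall>l<m. (\<Sum>j<n. \<rho> k j * \<xi> l y j) = (if k = l then 1 else 0) - \<mu> k l) \<and>
    (\<forall>k<m. \<forall>\<epsilon>>0. eventually (\<lambda>p. snd p \<in> Rn n \<longrightarrow> p \<in> F \<longrightarrow>
       \<bar>\<psi> (s (\<theta> p)) k - \<psi> (fst p) k - (\<Sum>j<n. \<rho> k j * snd p j)\<bar> \<le> \<epsilon> * (\<Sum>j<n. \<bar>snd p j\<bar>))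
       (nearY y \<times>\<^sub>F near (Rn n) n (\<lambda>v. v) (\<lambda>_. 0)))"
proof -
  interpret P: bundle_chart_point Y m \<psi> E pr n F \<phi> \<theta> "zero y"
    by standard (rule zero_point[OF y])
  note b = phi_zero[OF y] and pr = pr_zero[OF y]
  let ?Z = "fibre_space y"
  let ?H = "\<lambda>k p. \<psi> (s (\<theta> p)) k"
  obtain \<mu> where \<mu>: "\<forall>k<m. \<mu> k \<in> null_covectors y"
    "\<forall>l<m. \<exists>D\<in>tangent_vectors Y y. \<forall>k<m. D (\<lambda>z. \<psi> z k) = (if k = l then 1 else 0) - \<mu> k l"
    using tangent_frame[OF y] by blast
  define Q where "Q = (\<lambda>k l. strictly_diff n snd (inf P.pairsF (principal (F \<times> F))) (y, \<lambda>_. 0) (?H k) l \<and>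
    (\<forall>D\<in>tangent_vectors ?Z (zero y). D (\<lambda>u. ?H k (\<phi> u)) = (\<Sum>j<n. l j * D (\<lambda>u. snd (\<phi> u) j))))"
  have "\<exists>l. Q k l" if "k < m" for k
    using P.section_on_F[OF spray_coordinate_section[OF that]] unfolding b pr Q_def by blast
  then have "\<forall>k. \<exists>l. k < m \<longrightarrow> Q k l" by blast
  then obtain \<rho> where \<rho>: "\<And>k. k < m \<Longrightarrow> Q k (\<rho> k)" using choice[of "\<lambda>k l. k < m \<longrightarrow> Q k l"] by blast
  have lift: "\<exists>\<omega>. (y, \<omega>) \<in> F \<and> (\<forall>k<m. (\<Sum>j<n. \<rho> k j * \<omega> j) = (if k = l then 1 else 0) - \<mu> k l)" if l: "l < m" for l
  proof -
    obtain D where D: "D \<in> tangent_vectors Y y" "\<forall>k<m. D (\<lambda>z. \<psi> z k) = (if k = l then 1 else 0) - \<mu> k l"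
      using \<mu>(2) l by blast
    obtain \<delta> where \<delta>: "\<delta> \<in> tangent_vectors ?Z (zero y)" "\<forall>f\<in>regular_at Y y. D f = \<delta> (f \<circ> s)"
      using s_dominating[OF y] D(1) unfolding submersion_at_def s_zero[OF y] by blast
    note Zs = P.Z_sheaf[unfolded pr] and Zb = P.base_Z[unfolded pr] and Zr = P.regular_at_Z[unfolded pr]
    have \<delta>s: "\<delta> (\<lambda>u. \<psi> (s u) k) = (if k = l then 1 else 0) - \<mu> k l" if k: "k < m" for k
    proof -
      have "(\<lambda>z. \<psi> z k) \<in> regular_at Y y" by (rule regular_atI[OF openin_topspace y coordinate_section[OF k]])
      then show ?thesis using \<delta>(2) D(2) k by (auto simp: o_def)
    qed
    have \<delta>H: "\<delta> (\<lambda>u. ?H k (\<phi> u)) = \<delta> (\<lambda>u. \<psi> (s u) k)" if k: "k < m" for k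
    proof -
      have r: "(\<lambda>u. \<psi> (s u) k) \<in> regular_at ?Z (zero y)"
        by (rule Zr[OF regular_map_global_sections[OF s_regular coordinate_section[OF k]]])
      have eq: "?H k (\<phi> u) = \<psi> (s u) k" if "u \<in> points ?Z" for u
        using that theta_phi P.points_Z[unfolded pr] by simp
      show ?thesis
        by (rule tangent_vectors_cong[OF \<delta>(1) regular_at_cong[OF Zs r openin_topspace Zb eq] r openin_topspace Zb eq])
    qed
    \<comment> \<open>A projection onto the fibre expresses all its linear relations.\<close>
    obtain \<nu> where \<nu>: "\<forall>j<n. \<nu> j \<in> {v. (y, v) \<in> F}" "\<forall>v\<in>{v. (y, v) \<in> F}. \<forall>i. v i = (\<Sum>j<n. v j * \<nu> j i)"
      using projection_matrix[OF linear_subspace_fibre[OF y], of n] F_subset by blast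
    define \<omega> where "\<omega> = (\<lambda>i. \<Sum>j<n. \<delta> (\<lambda>u. snd (\<phi> u) j) * \<nu> j i)"
    have "\<omega> \<in> {v. (y, v) \<in> F}"
      unfolding \<omega>_def using \<nu>(1) by (intro linear_subspace_sum[OF linear_subspace_fibre[OF y]]) auto
    moreover have \<omega>j: "\<omega> i = \<delta> (\<lambda>u. snd (\<phi> u) i)" if i: "i < n" for i
    proof -
      have c: "(\<lambda>u. snd (\<phi> u) j) \<in> regular_at ?Z (zero y)" if "j \<in> {..<n}" for j
        using that by (intro Zr P.coordinate_section_E) simp
      have eq: "snd (\<phi> u) i = (\<Sum>j<n. snd (\<phi> u) j * \<nu> j i)" if u: "u \<in> points ?Z" for u
      proof -
        have uE: "u \<in> points E" "pr u = y" using u P.points_Z[unfolded pr] by auto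
        have "\<phi> u = (y, snd (\<phi> u))" using fst_phi[OF uE(1)] uE(2) by (simp add: prod_eq_iff)
        then have "snd (\<phi> u) \<in> {v. (y, v) \<in> F}" using phi_in_F[OF uE(1)] by simp
        then show ?thesis using \<nu>(2) by blast
      qed
      have "\<delta> (\<lambda>u. snd (\<phi> u) i) = \<delta> (\<lambda>u. \<Sum>j<n. snd (\<phi> u) j * \<nu> j i)"
        by (rule tangent_vectors_cong[OF \<delta>(1) c regular_at_sum[OF Zs Zb c] openin_topspace Zb eq]) (use i in auto)
      also have "\<dots> = \<omega> i" unfolding \<omega>_def by (rule tangent_vectors_sum[OF Zs Zb \<delta>(1) c])
      finally show ?thesis by simp
    qed
    moreover have "(\<Sum>j<n. \<rho> k j * \<omega> j) = (if k = l then 1 else 0) - \<mu> k l" if k: "k < m" for k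
    proof -
      have "(\<Sum>j<n. \<rho> k j * \<omega> j) = (\<Sum>j<n. \<rho> k j * \<delta> (\<lambda>u. snd (\<phi> u) j))" using \<omega>j by (intro sum.cong) auto
      also have "\<dots> = \<delta> (\<lambda>u. ?H k (\<phi> u))"
        using \<rho>[OF k, unfolded Q_def, THEN conjunct2, rule_format, OF \<delta>(1)] by (rule sym)
      finally show ?thesis using \<delta>H[OF k] \<delta>s[OF k] by simp
    qed
    ultimately show ?thesis by blast
  qed
  define R where "R = (\<lambda>l \<xi>. (\<forall>j<n. (\<lambda>z. \<xi> z j) \<in> sections Y (points Y)) \<and> (\<forall>z\<in>points Y. (z, \<xi> z) \<in> F) \<and>
      (\<forall>k<m. (\<Sum>j<n. \<rho> k j * \<xi> y j) = (if k = l then 1 else 0) - \<mu> k l))"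
  have "\<exists>\<xi>. R l \<xi>" if l: "l < m" for l
  proof -
    obtain \<omega> where \<omega>: "(y, \<omega>) \<in> F" "\<forall>k<m. (\<Sum>j<n. \<rho> k j * \<omega> j) = (if k = l then 1 else 0) - \<mu> k l"
      using lift[OF l] by blast
    obtain \<xi> where "\<forall>j<n. (\<lambda>z. \<xi> z j) \<in> sections Y (points Y)" "\<forall>z\<in>points Y. (z, \<xi> z) \<in> F" "\<xi> y = \<omega>"
      using vector_field_extension[OF y \<omega>(1)] by blast
    then show ?thesis using \<omega>(2) by (intro exI[of _ \<xi>]) (simp add: R_def)
  qed
  then have "\<forall>l. \<exists>\<xi>. l < m \<longrightarrow> R l \<xi>" by blast
  then obtain \<xi> where \<xi>: "\<And>l. l < m \<Longrightarrow> R l (\<xi> l)" using choice[of "\<lambda>l \<xi>. l < m \<longrightarrow> R l \<xi>"] by blast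
  have est: "eventually (\<lambda>p. snd p \<in> Rn n \<longrightarrow> p \<in> F \<longrightarrow>
       \<bar>\<psi> (s (\<theta> p)) k - \<psi> (fst p) k - (\<Sum>j<n. \<rho> k j * snd p j)\<bar> \<le> \<epsilon> * (\<Sum>j<n. \<bar>snd p j\<bar>))
       (nearY y \<times>\<^sub>F near (Rn n) n (\<lambda>v. v) (\<lambda>_. 0))" if k: "k < m" and \<epsilon>: "\<epsilon> > 0" for k \<epsilon>
  proof -
    have "(\<lambda>w. ?H k (fst w) - ?H k (snd w) - (\<Sum>j<n. \<rho> k j * (snd (fst w) j - snd (snd w) j)))
        \<in> o[inf P.pairsF (principal (F \<times> F))](\<lambda>w. \<Sum>j<n. \<bar>snd (fst w) j - snd (snd w) j\<bar>)"
      using \<rho>[OF k, unfolded Q_def, THEN conjunct1] unfolding strictly_diff_def by blast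
    from landau_o.smallD[OF this \<epsilon>]
    have "eventually (\<lambda>p. (p \<in> F \<and> (fst p, \<lambda>_. 0) \<in> F) \<longrightarrow>
        \<bar>?H k p - ?H k (fst p, \<lambda>_. 0) - (\<Sum>j<n. \<rho> k j * (snd p j - 0))\<bar> \<le> \<epsilon> * \<bar>\<Sum>j<n. \<bar>snd p j - 0\<bar>\<bar>)
       (nearY y \<times>\<^sub>F near (Rn n) n (\<lambda>v. v) (\<lambda>_. 0))"
      unfolding eventually_inf_principal P.eventually_pairsF b pr by simp
    then show ?thesis
    proof (rule eventually_mono, intro impI)
      fix p assume h: "(p \<in> F \<and> (fst p, \<lambda>_. 0) \<in> F) \<longrightarrow>
        \<bar>?H k p - ?H k (fst p, \<lambda>_. 0) - (\<Sum>j<n. \<rho> k j * (snd p j - 0))\<bar> \<le> \<epsilon> * \<bar>\<Sum>j<n. \<bar>snd p j - 0\<bar>\<bar>"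
        and p: "p \<in> F"
      have fp: "fst p \<in> points Y" using p F_subset by auto
      show "\<bar>\<psi> (s (\<theta> p)) k - \<psi> (fst p) k - (\<Sum>j<n. \<rho> k j * snd p j)\<bar> \<le> \<epsilon> * (\<Sum>j<n. \<bar>snd p j\<bar>)"
        using h p zero_in_F[OF fp] theta_zero[OF fp] s_zero[OF fp] by (simp add: sum_nonneg)
    qed
  qed
  have vf: "vector_fields \<xi>" using \<xi> by (simp add: vector_fields_def R_def)
  have frame: "\<forall>k<m. \<forall>l<m. (\<Sum>j<n. \<rho> k j * \<xi> l y j) = (if k = l then 1 else 0) - \<mu> k l"
    using \<xi> by (simp add: R_def)
  show ?thesis
    by (rule exI[of _ \<xi>], rule exI[of _ \<mu>], rule exI[of _ \<rho>], intro conjI vf \<mu>(1) frame)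
      (intro allI impI, rule est)
qed

text \<open>
  To first order, \<open>correction \<xi> y a\<close> is displaced from \<open>y\<close> by \<open>a - \<mu> a\<close> in the chart.  For
  \<open>a = t (\<psi> z - \<psi> y)\<close> the vector \<open>\<mu> a\<close> is \<open>t\<close> times an \<open>o\<close> of the distance, since the rows of \<open>\<mu>\<close> are
  null covectors.  So the remaining distance is \<open>1 - t\<close> times the old one, up to an error that is
  a small multiple of \<open>t\<close> times the old one.
\<close>
lemma correction_contracts:
  assumes y0: "y0 \<in> points Y"
  shows "\<exists>\<xi>. vector_fields \<xi> \<and> (\<exists>\<eta>>0. \<forall>y\<in>points Y. \<forall>z\<in>points Y. \<forall>t.
     chart_dist y y0 < \<eta> \<and> chart_dist z y0 < \<eta> \<and> 0 \<le> t \<and> t \<le> 1 \<longrightarrow>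
     chart_dist (correction \<xi> y (\<lambda>l. t * (\<psi> z l - \<psi> y l))) z \<le> (1 - t / 2) * chart_dist y z)"
proof -
  obtain \<xi> \<mu> \<rho> where \<xi>: "vector_fields \<xi>" and \<mu>: "\<forall>k<m. \<mu> k \<in> null_covectors y0"
    and frame: "\<forall>k<m. \<forall>l<m. (\<Sum>j<n. \<rho> k j * \<xi> l y0 j) = (if k = l then 1 else 0) - \<mu> k l"
    and est: "\<forall>k<m. \<forall>\<epsilon>>0. eventually (\<lambda>p. snd p \<in> Rn n \<longrightarrow> p \<in> F \<longrightarrow>
       \<bar>\<psi> (s (\<theta> p)) k - \<psi> (fst p) k - (\<Sum>j<n. \<rho> k j * snd p j)\<bar> \<le> \<epsilon> * (\<Sum>j<n. \<bar>snd p j\<bar>))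
       (nearY y0 \<times>\<^sub>F near (Rn n) n (\<lambda>v. v) (\<lambda>_. 0))"
    using dominating_vector_fields[OF y0] by blast
  \<comment> \<open>Near \<open>y0\<close>, combinations of the fields are bounded by \<open>C\<close> times the coefficients.\<close>
  define C where "C = (\<Sum>j<n. \<Sum>l<m. \<bar>\<xi> l y0 j\<bar> + 1)"
  have C0: "C \<ge> 0" unfolding C_def by (intro sum_nonneg) simp
  \<comment> \<open>Each of the \<open>m\<close> coordinates contributes an error of at most \<open>\<epsilon> (C + 2)\<close> times \<open>t\<close> times the distance; together at most half of the latter.\<close>
  define \<epsilon> where "\<epsilon> = 1 / (2 * (real m + 1) * (C + 2))"
  have \<epsilon>: "\<epsilon> > 0" unfolding \<epsilon>_def using C0 by (intro divide_pos_pos mult_pos_pos) auto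
  have small: "real m * (\<epsilon> * (C + 2)) \<le> 1 / 2"
  proof -
    have e: "\<epsilon> * (C + 2) = 1 / (2 * (real m + 1))" 
    proof -
      have "C + 2 \<noteq> 0" using C0 by linarith
      then show ?thesis by (simp add: \<epsilon>_def)
    qed
    show ?thesis unfolding e by (simp add: field_simps)
  qed
  let ?NA = "nearY y0 \<times>\<^sub>F nearA (\<lambda>_. 0)"
  define bound where "bound = (\<lambda>k p. \<bar>\<psi> (correction \<xi> (fst p) (snd p)) k - \<psi> (fst p) k - (snd p k - (\<Sum>l<m. snd p l * \<mu> k l))\<bar>
      \<le> \<epsilon> * (C + 1) * (\<Sum>l<m. \<bar>snd p l\<bar>))"
  have c0: "combination \<xi> y0 (\<lambda>_. 0) = (\<lambda>_. 0)" by (simp add: combination_def)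
  have ev1: "eventually (bound k) ?NA" if k: "k < m" for k
  proof -
    have fl: "filterlim (\<lambda>p. (fst p, combination \<xi> (fst p) (snd p))) (nearY y0 \<times>\<^sub>F near (Rn n) n (\<lambda>v. v) (\<lambda>_. 0)) ?NA"
      using filterlim_combination[OF \<xi> y0, of "\<lambda>_. 0"] unfolding c0 filterlim_inf by blast
    have e1: "eventually (\<lambda>p. combination \<xi> (fst p) (snd p) \<in> Rn n \<longrightarrow> (fst p, combination \<xi> (fst p) (snd p)) \<in> F \<longrightarrow>
       \<bar>\<psi> (correction \<xi> (fst p) (snd p)) k - \<psi> (fst p) k - (\<Sum>j<n. \<rho> k j * combination \<xi> (fst p) (snd p) j)\<bar>
         \<le> \<epsilon> * (\<Sum>j<n. \<bar>combination \<xi> (fst p) (snd p) j\<bar>)) ?NA"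
      using eventually_compose_filterlim[OF est[rule_format, OF k \<epsilon>] fl] by (simp add: correction_def)
    have e2: "eventually (\<lambda>p. fst p \<in> points Y) ?NA"
      by (rule eventually_compose_filterlim[OF eventually_near_mem filterlim_fst])
    have "eventually (\<lambda>z. \<bar>\<xi> l z j\<bar> < \<bar>\<xi> l y0 j\<bar> + 1) (nearY y0)" if "l < m" "j < n" for l j
      by (rule order_tendstoD(2)[OF tendsto_rabs[OF tendsto_vector_field[OF \<xi> that y0]]]) simp
    then have "eventually (\<lambda>z. \<forall>j\<in>{..<n}. \<forall>l\<in>{..<m}. \<bar>\<xi> l z j\<bar> < \<bar>\<xi> l y0 j\<bar> + 1) (nearY y0)"
      by (intro eventually_ball_finite finite_lessThan ballI) auto
    from eventually_compose_filterlim[OF this filterlim_fst]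
    have e3: "eventually (\<lambda>p. \<forall>j\<in>{..<n}. \<forall>l\<in>{..<m}. \<bar>\<xi> l (fst p) j\<bar> < \<bar>\<xi> l y0 j\<bar> + 1) ?NA" .
    have "eventually (\<lambda>z. \<bar>(\<Sum>j<n. \<rho> k j * \<xi> l z j) - (\<Sum>j<n. \<rho> k j * \<xi> l y0 j)\<bar> < \<epsilon>) (nearY y0)" if l: "l < m" for l
    proof -
      have "((\<lambda>z. \<Sum>j<n. \<rho> k j * \<xi> l z j) \<longlongrightarrow> (\<Sum>j<n. \<rho> k j * \<xi> l y0 j)) (nearY y0)"
        using tendsto_vector_field[OF \<xi> l _ y0] by (intro tendsto_sum tendsto_mult tendsto_const) auto
      from tendstoD[OF this \<epsilon>] show ?thesis by (simp add: dist_real_def)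
    qed
    then have "eventually (\<lambda>z. \<forall>l\<in>{..<m}. \<bar>(\<Sum>j<n. \<rho> k j * \<xi> l z j) - (\<Sum>j<n. \<rho> k j * \<xi> l y0 j)\<bar> < \<epsilon>) (nearY y0)"
      by (intro eventually_ball_finite finite_lessThan ballI) auto
    from eventually_compose_filterlim[OF this filterlim_fst]
    have e4: "eventually (\<lambda>p. \<forall>l\<in>{..<m}. \<bar>(\<Sum>j<n. \<rho> k j * \<xi> l (fst p) j) - (\<Sum>j<n. \<rho> k j * \<xi> l y0 j)\<bar> < \<epsilon>) ?NA" .
    show ?thesis using e1 e2 e3 e4
    proof eventually_elim
      case (elim p)
      define y a A where "y = fst p" and "a = snd p" and "A = (\<Sum>l<m. \<bar>a l\<bar>)"
      let ?v = "combination \<xi> y a"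
      have F: "(y, ?v) \<in> F" using combination_in_F[OF \<xi> elim(2)] by (simp add: y_def a_def)
      then have "?v \<in> Rn n" using F_subset by auto
      then have 1: "\<bar>\<psi> (correction \<xi> y a) k - \<psi> y k - (\<Sum>j<n. \<rho> k j * ?v j)\<bar> \<le> \<epsilon> * (\<Sum>j<n. \<bar>?v j\<bar>)"
        using elim(1) F by (simp add: y_def a_def)
      have al: "\<bar>a l\<bar> \<le> A" if "l < m" for l unfolding A_def using that by (intro member_le_sum) auto
      have "(\<Sum>j<n. \<bar>?v j\<bar>) \<le> (\<Sum>j<n. \<Sum>l<m. A * (\<bar>\<xi> l y0 j\<bar> + 1))"
      proof (rule sum_mono)
        fix j assume j: "j \<in> {..<n}"
        have "\<bar>?v j\<bar> \<le> (\<Sum>l<m. \<bar>a l * \<xi> l y j\<bar>)" unfolding combination_def by (rule sum_abs)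
        also have "\<dots> \<le> (\<Sum>l<m. A * (\<bar>\<xi> l y0 j\<bar> + 1))"
        proof (rule sum_mono)
          fix l assume l: "l \<in> {..<m}"
          have "\<bar>\<xi> l y j\<bar> \<le> \<bar>\<xi> l y0 j\<bar> + 1" using elim(3)[rule_format, OF j l] by (simp add: y_def)
          then show "\<bar>a l * \<xi> l y j\<bar> \<le> A * (\<bar>\<xi> l y0 j\<bar> + 1)"
            unfolding abs_mult using al l by (intro mult_mono) (auto simp: A_def sum_nonneg)
        qed
        finally show "\<bar>?v j\<bar> \<le> (\<Sum>l<m. A * (\<bar>\<xi> l y0 j\<bar> + 1))" .
      qed
      also have "\<dots> = A * C" by (simp add: C_def sum_distrib_left)
      finally have "(\<Sum>j<n. \<bar>?v j\<bar>) \<le> A * C" .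
      then have 2: "\<epsilon> * (\<Sum>j<n. \<bar>?v j\<bar>) \<le> \<epsilon> * (A * C)" using \<epsilon> by (intro mult_left_mono) auto
      have "(\<Sum>j<n. \<rho> k j * ?v j) = (\<Sum>j<n. \<Sum>l<m. a l * (\<rho> k j * \<xi> l y j))"
        by (simp add: combination_def sum_distrib_left algebra_simps)
      also have "\<dots> = (\<Sum>l<m. a l * (\<Sum>j<n. \<rho> k j * \<xi> l y j))"
        by (subst sum.swap) (simp add: sum_distrib_left)
      finally have s: "(\<Sum>j<n. \<rho> k j * ?v j) = (\<Sum>l<m. a l * (\<Sum>j<n. \<rho> k j * \<xi> l y j))" .
      have t: "a k - (\<Sum>l<m. a l * \<mu> k l) = (\<Sum>l<m. a l * (\<Sum>j<n. \<rho> k j * \<xi> l y0 j))"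
      proof -
        have "(\<Sum>l<m. a l * (\<Sum>j<n. \<rho> k j * \<xi> l y0 j)) = (\<Sum>l<m. a l * (if k = l then 1 else 0) - a l * \<mu> k l)"
          using frame k by (intro sum.cong) (auto simp: right_diff_distrib)
        also have "\<dots> = (\<Sum>l<m. a l * (if k = l then 1 else 0)) - (\<Sum>l<m. a l * \<mu> k l)" by (rule sum_subtractf)
        also have "(\<Sum>l<m. a l * (if k = l then 1 else 0)) = a k"
          using k by (simp add: if_distrib[of "\<lambda>x. _ * x"] cong: if_cong)
        finally show ?thesis by simp
      qed
      have "\<bar>(\<Sum>j<n. \<rho> k j * ?v j) - (a k - (\<Sum>l<m. a l * \<mu> k l))\<bar>
          = \<bar>\<Sum>l<m. a l * ((\<Sum>j<n. \<rho> k j * \<xi> l y j) - (\<Sum>j<n. \<rho> k j * \<xi> l y0 j))\<bar>"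
        unfolding s t by (simp add: right_diff_distrib sum_subtractf)
      also have "\<dots> \<le> (\<Sum>l<m. \<bar>a l * ((\<Sum>j<n. \<rho> k j * \<xi> l y j) - (\<Sum>j<n. \<rho> k j * \<xi> l y0 j))\<bar>)" by (rule sum_abs)
      also have "\<dots> \<le> (\<Sum>l<m. \<bar>a l\<bar> * \<epsilon>)"
      proof (rule sum_mono)
        fix l assume l: "l \<in> {..<m}"
        have "\<bar>(\<Sum>j<n. \<rho> k j * \<xi> l y j) - (\<Sum>j<n. \<rho> k j * \<xi> l y0 j)\<bar> \<le> \<epsilon>"
          using elim(4)[rule_format, OF l] by (simp add: y_def)
        then show "\<bar>a l * ((\<Sum>j<n. \<rho> k j * \<xi> l y j) - (\<Sum>j<n. \<rho> k j * \<xi> l y0 j))\<bar> \<le> \<bar>a l\<bar> * \<epsilon>"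
          unfolding abs_mult by (rule mult_left_mono) simp
      qed
      also have "\<dots> = \<epsilon> * A" by (simp add: A_def sum_distrib_left mult.commute)
      finally have 3: "\<bar>(\<Sum>j<n. \<rho> k j * ?v j) - (a k - (\<Sum>l<m. a l * \<mu> k l))\<bar> \<le> \<epsilon> * A" .
      have "\<bar>\<psi> (correction \<xi> y a) k - \<psi> y k - (a k - (\<Sum>l<m. a l * \<mu> k l))\<bar> \<le> \<epsilon> * (A * C) + \<epsilon> * A"
        using 1 2 3 by linarith
      also have "\<dots> = \<epsilon> * (C + 1) * A" by (simp add: algebra_simps)
      finally show ?case by (simp add: bound_def y_def a_def A_def)
    qed
  qed
  then have "eventually (\<lambda>p. \<forall>k\<in>{..<m}. bound k p) ?NA"
    by (intro eventually_ball_finite finite_lessThan ballI) auto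
  from eventually_near_prodD[OF this] obtain \<eta>1 where \<eta>1: "\<eta>1 > 0"
    "\<forall>y\<in>points Y. \<forall>a. chart_dist y y0 < \<eta>1 \<longrightarrow> (\<Sum>l<m. \<bar>a l\<bar>) < \<eta>1 \<longrightarrow> (\<forall>k\<in>{..<m}. bound k (y, a))"
    unfolding chart_dist_def by auto
  have "eventually (\<lambda>w. \<bar>\<Sum>j<m. \<mu> k j * (\<psi> (fst w) j - \<psi> (snd w) j)\<bar> \<le> \<epsilon> * (\<Sum>j<m. \<bar>\<psi> (fst w) j - \<psi> (snd w) j\<bar>)) (pairsY y0)"
    if "k < m" for k
  proof -
    have "(\<lambda>w. \<Sum>j<m. \<mu> k j * (\<psi> (fst w) j - \<psi> (snd w) j)) \<in> o[pairsY y0](\<lambda>w. \<Sum>j<m. \<bar>\<psi> (fst w) j - \<psi> (snd w) j\<bar>)"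
      using \<mu> that unfolding null_covectors_def by blast
    from landau_o.smallD[OF this \<epsilon>] show ?thesis by (simp add: sum_nonneg)
  qed
  then have "eventually (\<lambda>w. \<forall>k\<in>{..<m}. \<bar>\<Sum>j<m. \<mu> k j * (\<psi> (fst w) j - \<psi> (snd w) j)\<bar> \<le> \<epsilon> * (\<Sum>j<m. \<bar>\<psi> (fst w) j - \<psi> (snd w) j\<bar>)) (pairsY y0)"
    by (intro eventually_ball_finite finite_lessThan ballI) auto
  from eventually_near_prodD[OF this] obtain \<eta>2 where \<eta>2: "\<eta>2 > 0"
    "\<forall>z\<in>points Y. \<forall>y\<in>points Y. chart_dist z y0 < \<eta>2 \<longrightarrow> chart_dist y y0 < \<eta>2 \<longrightarrow>
      (\<forall>k\<in>{..<m}. \<bar>\<Sum>j<m. \<mu> k j * (\<psi> z j - \<psi> y j)\<bar> \<le> \<epsilon> * chart_dist z y)"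
    unfolding chart_dist_def by auto
  have main: "chart_dist (correction \<xi> y (\<lambda>l. t * (\<psi> z l - \<psi> y l))) z \<le> (1 - t / 2) * chart_dist y z"
    if y: "y \<in> points Y" and z: "z \<in> points Y" and dy: "chart_dist y y0 < min (\<eta>1 / 2) \<eta>2"
      and dz: "chart_dist z y0 < min (\<eta>1 / 2) \<eta>2" and t: "0 \<le> t" "t \<le> 1" for y z t
  proof -
    define a d where "a = (\<lambda>l. t * (\<psi> z l - \<psi> y l))" and "d = chart_dist y z"
    have d0: "0 \<le> d" by (simp add: d_def)
    have A: "(\<Sum>l<m. \<bar>a l\<bar>) = t * d"
      using t by (simp add: a_def d_def chart_dist_def abs_mult sum_distrib_left abs_minus_commute)
    have "d < \<eta>1" using chart_dist_triangle[of y z y0] dy dz chart_dist_commute[of y0 z] by (simp add: d_def)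
    moreover have "t * d \<le> 1 * d" using t d0 by (intro mult_right_mono) auto
    ultimately have Al: "(\<Sum>l<m. \<bar>a l\<bar>) < \<eta>1" unfolding A by simp
    have k: "\<bar>\<psi> (correction \<xi> y a) k - \<psi> y k - a k\<bar> \<le> t * d * (\<epsilon> * (C + 2))" if k: "k < m" for k
    proof -
      have "chart_dist y y0 < \<eta>1" using dy \<eta>1(1) by simp
      then have 1: "\<bar>\<psi> (correction \<xi> y a) k - \<psi> y k - (a k - (\<Sum>l<m. a l * \<mu> k l))\<bar> \<le> \<epsilon> * (C + 1) * (t * d)"
        using \<eta>1(2) y Al k unfolding bound_def A[symmetric] by auto
      have "(\<Sum>l<m. a l * \<mu> k l) = t * (\<Sum>j<m. \<mu> k j * (\<psi> z j - \<psi> y j))"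
        by (simp add: a_def sum_distrib_left algebra_simps)
      then have "\<bar>\<Sum>l<m. a l * \<mu> k l\<bar> = t * \<bar>\<Sum>j<m. \<mu> k j * (\<psi> z j - \<psi> y j)\<bar>" using t by (simp add: abs_mult)
      also have "\<dots> \<le> t * (\<epsilon> * chart_dist z y)" using \<eta>2(2) y z dy dz k t by (intro mult_left_mono) auto
      finally have 2: "\<bar>\<Sum>l<m. a l * \<mu> k l\<bar> \<le> t * (\<epsilon> * d)" by (simp add: d_def chart_dist_commute)
      have "\<bar>\<psi> (correction \<xi> y a) k - \<psi> y k - a k\<bar> \<le> \<epsilon> * (C + 1) * (t * d) + t * (\<epsilon> * d)" using 1 2 by linarith
      also have "\<dots> = t * d * (\<epsilon> * (C + 2))" by (simp add: algebra_simps)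
      finally show ?thesis .
    qed
    have "chart_dist (correction \<xi> y a) z \<le> (\<Sum>k<m. t * d * (\<epsilon> * (C + 2)) + (1 - t) * \<bar>\<psi> y k - \<psi> z k\<bar>)"
      unfolding chart_dist_def
    proof (rule sum_mono)
      fix k assume "k \<in> {..<m}"
      then have kk: "\<bar>\<psi> (correction \<xi> y a) k - \<psi> y k - a k\<bar> \<le> t * d * (\<epsilon> * (C + 2))" using k by simp
      have "\<psi> (correction \<xi> y a) k - \<psi> z k = (\<psi> (correction \<xi> y a) k - \<psi> y k - a k) + (1 - t) * (\<psi> y k - \<psi> z k)"
        by (simp add: a_def algebra_simps)
      then have "\<bar>\<psi> (correction \<xi> y a) k - \<psi> z k\<bar> \<le> \<bar>\<psi> (correction \<xi> y a) k - \<psi> y k - a k\<bar> + \<bar>(1 - t) * (\<psi> y k - \<psi> z k)\<bar>"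
        using abs_triangle_ineq[of "\<psi> (correction \<xi> y a) k - \<psi> y k - a k" "(1 - t) * (\<psi> y k - \<psi> z k)"] by presburger
      also have "\<bar>(1 - t) * (\<psi> y k - \<psi> z k)\<bar> = (1 - t) * \<bar>\<psi> y k - \<psi> z k\<bar>" using t by (simp add: abs_mult)
      finally show "\<bar>\<psi> (correction \<xi> y a) k - \<psi> z k\<bar> \<le> t * d * (\<epsilon> * (C + 2)) + (1 - t) * \<bar>\<psi> y k - \<psi> z k\<bar>" using kk by linarith
    qed
    also have "\<dots> = t * d * (real m * (\<epsilon> * (C + 2))) + (1 - t) * d"
      by (simp add: sum.distrib sum_distrib_left d_def chart_dist_def)
    also have "\<dots> \<le> t * d * (1 / 2) + (1 - t) * d"
      using small t d0 by (intro add_right_mono mult_left_mono) auto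
    also have "\<dots> = (1 - t / 2) * d" by (simp add: algebra_simps)
    finally show ?thesis by (simp add: a_def d_def)
  qed
  have "min (\<eta>1 / 2) \<eta>2 > 0" using \<eta>1(1) \<eta>2(1) by simp
  then show ?thesis using \<xi> main by blast
qed

end

section \<open>Approximation along a homotopy\<close>

lemma malleable_spray_chart:
  fixes Y :: "'y fspace"
  assumes Y: "real_algebraic_variety Y" "nonsingular Y" "malleable TYPE('e) Y"
  shows "\<exists>m \<psi> (E :: 'e fspace) pr n F \<phi> \<theta> zero s. spray_chart Y m \<psi> E pr n F \<phi> \<theta> zero s"
proof -
  obtain m \<psi> where c: "affine_chart Y m \<psi>" using affine_chart_exists[OF variety_sheaf[OF Y(1)] Y(2)] by blast
  obtain B :: "('e, 'y) vbundle" and s where sp: "spray Y B s" "dominating Y B s"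
    using Y(3) unfolding malleable_def by blast
  have vb: "algebraic_vector_bundle Y B" and sr: "regular_map (total B) Y s" and s0: "\<forall>y\<in>points Y. s (vzero B y) = y"
    using sp(1) unfolding spray_def by auto
  have E: "real_algebraic_variety (total B)" using vb unfolding algebraic_vector_bundle_def by (elim conjE)
  have z: "\<forall>y\<in>points Y. vzero B y \<in> fibre B y" using vb unfolding algebraic_vector_bundle_def by simp
  obtain n F \<phi> where F: "algebraic_subbundle Y n F"
    "biregular (total B) (subspace_of (prod_fspace Y (affine_space n)) F) \<phi>"
    "\<forall>v\<in>points (total B). fst (\<phi> v) = proj B v" "\<forall>y\<in>points Y. snd (\<phi> (vzero B y)) = (\<lambda>_. 0)"
    using vb unfolding algebraic_vector_bundle_def by fast
  let ?F = "subspace_of (prod_fspace Y (affine_space n)) F"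
  obtain \<theta> where \<theta>: "regular_map (total B) ?F \<phi>" "regular_map ?F (total B) \<theta>"
    "\<forall>u\<in>points (total B). \<theta> (\<phi> u) = u" "\<forall>p\<in>points ?F. \<phi> (\<theta> p) = p"
    using F(2) unfolding biregular_def by blast
  have "F \<subseteq> points Y \<times> Rn n" using F(1) by (simp add: algebraic_subbundle_def)
  then have pF: "points ?F = F" by (auto simp: points_prod[OF variety_sheaf[OF Y(1)]])
  have bc: "bundle_chart Y m \<psi> (total B) (proj B) n F \<phi> \<theta>"
    using c variety_sheaf[OF E] variety_nonvanishing_invertible[OF E] F(1,3) \<theta> pF
    by (simp add: bundle_chart_def bundle_chart_axioms_def)
  interpret bundle_chart Y m \<psi> "total B" "proj B" n F \<phi> \<theta> by (rule bc)
  have "spray_chart Y m \<psi> (total B) (proj B) n F \<phi> \<theta> (vzero B) s"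
  proof
    fix y assume y: "y \<in> points Y"
    have zf: "vzero B y \<in> points (total B)" "proj B (vzero B y) = y" using z y by (auto simp: fibre_def)
    show "vzero B y \<in> points (total B)" by (rule zf)
    show "\<phi> (vzero B y) = (y, \<lambda>_. 0)" using F(3,4) zf y by (simp add: prod_eq_iff)
    show "s (vzero B y) = y" using s0 y by simp
    show "submersion_at (fibre_space y) Y s (vzero B y)"
      using sp(2) y unfolding dominating_def fibre_space_def fibre_def by blast
  qed (rule sr)
  then show ?thesis by blast
qed

text \<open>
  A Lebesgue number for the single open set \<open>W\<close>.
\<close>
lemma (in affine_chart) compact_image_neighbourhood:
  assumes K: "compactin T K" and f: "continuous_map (subtopology T K) (euclidean_topology Y) f"
    and W: "openin (euclidean_topology Y) W" and sub: "f ` K \<subseteq> W"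
  shows "\<exists>\<epsilon>>0. \<forall>x\<in>K. \<forall>z\<in>points Y. chart_dist z (f x) < \<epsilon> \<longrightarrow> z \<in> W"
proof -
  have topK: "topspace (subtopology T K) = K" using compactin_subset_topspace[OF K] by auto
  have "\<exists>\<eta>>0. \<forall>z\<in>points Y. chart_dist z (f x) < \<eta> \<longrightarrow> z \<in> W" if "x \<in> K" for x
    using euclidean_open_chart_ball[OF W] sub that by blast
  then obtain \<eta> where \<eta>: "\<And>x. x \<in> K \<Longrightarrow> \<eta> x > 0 \<and> (\<forall>z\<in>points Y. chart_dist z (f x) < \<eta> x \<longrightarrow> z \<in> W)" by metis
  define N where "N = (\<lambda>x. {x' \<in> topspace (subtopology T K). chart_dist (f x') (f x) \<in> {..<\<eta> x / 2}})"
  have fc: "continuous_map (subtopology T K) (euclidean_topology Y) (\<lambda>_. f x)" if "x \<in> K" for x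
    using f that topK by (auto simp: continuous_map_def)
  have oN: "openin (subtopology T K) (N x)" if "x \<in> K" for x
    unfolding N_def by (rule openin_continuous_map_preimage[OF continuous_map_chart_dist[OF f fc[OF that]]]) auto
  have "K \<subseteq> \<Union>(N ` K)" using \<eta> topK by (auto simp: N_def)
  moreover have "compactin (subtopology T K) K" using K by simp
  ultimately obtain I where I: "finite I" "I \<subseteq> K" "K \<subseteq> \<Union>(N ` I)"
    using oN unfolding compactin_def by (metis (no_types, lifting) finite_subset_image imageE)
  define \<epsilon> where "\<epsilon> = Min (insert 1 ((\<lambda>x. \<eta> x / 2) ` I))"
  have \<epsilon>: "\<epsilon> > 0" unfolding \<epsilon>_def using I \<eta> by (subst Min_gr_iff) auto
  have "z \<in> W" if x: "x \<in> K" and z: "z \<in> points Y" "chart_dist z (f x) < \<epsilon>" for x z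
  proof -
    obtain i where i: "i \<in> I" "x \<in> N i" using I(3) x by blast
    have "\<epsilon> \<le> \<eta> i / 2" unfolding \<epsilon>_def using I(1) i(1) by (intro Min_le) auto
    then have "chart_dist z (f i) < \<eta> i"
      using chart_dist_triangle[of z "f i" "f x"] z(2) i(2) by (simp add: N_def)
    then show ?thesis using \<eta> i(1) I(2) z(1) by blast
  qed
  then show ?thesis using \<epsilon> by blast
qed

text \<open>
  The approximation problem on one compact subset \<open>K\<close> of \<open>X\<close>.
\<close>
locale relative_approximation = spray_chart Y m \<psi> E pr n F \<phi> \<theta> zero s
  for Y :: "'y fspace" and m :: nat and \<psi> :: "'y \<Rightarrow> nat \<Rightarrow> real"
    and E :: "'e fspace" and pr and n :: nat and F \<phi> \<theta> zero s +
  fixes X :: "'x fspace" and K A :: "'x set" and f0 :: "'x \<Rightarrow> 'y"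
  assumes X_variety: "real_algebraic_variety X"
    and K_compact: "compactin (euclidean_topology X) K"
    and A_closed: "closedin (zariski X) A"
    and f0_regular: "regular_map X Y f0"
begin

abbreviation TK :: "'x topology" where "TK \<equiv> subtopology (euclidean_topology X) K"

definition admissible :: "('x \<Rightarrow> 'y) \<Rightarrow> bool" where
  "admissible g \<longleftrightarrow> regular_map X Y g \<and> (\<forall>x\<in>A. g x = f0 x)"

definition target :: "('x \<Rightarrow> 'y) \<Rightarrow> bool" where
  "target h \<longleftrightarrow> continuous_map TK (euclidean_topology Y) h \<and> (\<forall>x\<in>K \<inter> A. h x = f0 x)"

lemma X_sheaf: "sheaf_of_real_functions X"
  by (rule variety_sheaf[OF X_variety])

lemma X_inv: "nonvanishing_invertible X"
  by (rule variety_nonvanishing_invertible[OF X_variety])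

lemma K_points: "K \<subseteq> points X"
  using compactin_subset_topspace[OF K_compact] topspace_euclidean_topology[OF X_sheaf] by simp

lemma A_points: "A \<subseteq> points X"
  using A_closed closedin_subset by blast

lemma topspace_TK: "topspace TK = K"
  using compactin_subset_topspace[OF K_compact] by auto

lemma compact_TK: "compactin TK K"
  using K_compact by simp

lemma finite_subcover_K:
  assumes "\<And>x. x \<in> K \<Longrightarrow> openin TK (N x) \<and> x \<in> N x"
  obtains I where "finite I" "I \<subseteq> K" "K \<subseteq> \<Union>(N ` I)"
proof -
  have "K \<subseteq> \<Union>(N ` K)" "\<forall>U\<in>N ` K. openin TK U" using assms by auto
  then obtain \<F> where "finite \<F>" "\<F> \<subseteq> N ` K" "K \<subseteq> \<Union>\<F>" using compact_TK unfolding compactin_def by meson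
  then obtain I where "I \<subseteq> K" "finite I" "\<F> = N ` I" by (meson finite_subset_image)
  then show thesis using that \<open>K \<subseteq> \<Union>\<F>\<close> by blast
qed

lemma admissible_continuous:
  assumes "admissible g"
  shows "continuous_map TK (euclidean_topology Y) g"
  using assms regular_map_euclidean_continuous[OF X_sheaf sheaf]
  unfolding admissible_def by (blast intro: continuous_map_from_subtopology)

lemma admissible_points: "admissible g \<Longrightarrow> x \<in> points X \<Longrightarrow> g x \<in> points Y"
  unfolding admissible_def by (elim conjE) (rule regular_map_points)

lemma target_points:
  assumes "target h" "x \<in> K"
  shows "h x \<in> points Y"
proof -
  have "h x \<in> topspace (euclidean_topology Y)"
    using assms topspace_TK unfolding target_def continuous_map_def by auto
  then show ?thesis by (simp add: topspace_euclidean_topology[OF sheaf])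
qed

lemma continuous_map_TK_coordinate:
  assumes "continuous_map TK (euclidean_topology Y) h" "l < m"
  shows "continuous_map TK euclideanreal (\<lambda>x. \<psi> (h x) l)"
  using continuous_map_compose[OF assms(1) continuous_map_chart_coordinate[OF assms(2)]] by (simp add: o_def)

lemma continuous_map_TK_const: "y \<in> points Y \<Longrightarrow> continuous_map TK (euclidean_topology Y) (\<lambda>_. y)"
  by (simp add: topspace_euclidean_topology[OF sheaf])

text \<open>
  The coefficients \<open>a\<close> are approximated by regular functions that vanish on \<open>A\<close>, where the correction
  therefore changes nothing.  A finite subcover of \<open>K\<close> makes the continuity of the correction
  in its coefficients uniform.
\<close>
lemma approximate_correction:
  assumes g: "admissible g" and \<xi>: "vector_fields \<xi>"
    and a: "\<And>l. l < m \<Longrightarrow> continuous_map TK euclideanreal (\<lambda>x. a x l)"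
    and aA: "\<And>x l. x \<in> K \<Longrightarrow> x \<in> A \<Longrightarrow> l < m \<Longrightarrow> a x l = 0" and \<epsilon>: "\<epsilon> > 0"
  shows "\<exists>g'. admissible g' \<and> (\<forall>x\<in>K. chart_dist (g' x) (correction \<xi> (g x) (a x)) < \<epsilon>)"
proof -
  note gc = admissible_continuous[OF g]
  define D where "D = (\<lambda>x b. \<Sum>l<m. \<bar>b l - a x l\<bar>)"
  define P where "P = (\<lambda>x \<eta>. \<eta> > 0 \<and> (\<forall>y\<in>points Y. \<forall>b. chart_dist y (g x) < \<eta> \<longrightarrow> D x b < \<eta> \<longrightarrow>
      chart_dist (correction \<xi> y b) (correction \<xi> (g x) (a x)) < \<epsilon> / 2))"
  have "\<exists>\<eta>. P x \<eta>" if x: "x \<in> K" for x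
  proof -
    have y: "g x \<in> points Y" using admissible_points[OF g] x K_points by blast
    have "((\<lambda>p. chart_dist (correction \<xi> (fst p) (snd p)) (correction \<xi> (g x) (a x))) \<longlongrightarrow>
        (\<Sum>k<m. \<bar>\<psi> (correction \<xi> (g x) (a x)) k - \<psi> (correction \<xi> (g x) (a x)) k\<bar>)) (nearY (g x) \<times>\<^sub>F nearA (a x))"
      unfolding chart_dist_def
      by (intro tendsto_sum tendsto_rabs tendsto_diff tendsto_const tendsto_correction[OF \<xi> y]) simp
    then have "((\<lambda>p. chart_dist (correction \<xi> (fst p) (snd p)) (correction \<xi> (g x) (a x))) \<longlongrightarrow> 0) (nearY (g x) \<times>\<^sub>F nearA (a x))"
      by simp
    from order_tendstoD(2)[OF this, of "\<epsilon> / 2"] \<epsilon>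
    have "eventually (\<lambda>p. chart_dist (correction \<xi> (fst p) (snd p)) (correction \<xi> (g x) (a x)) < \<epsilon> / 2) (nearY (g x) \<times>\<^sub>F nearA (a x))"
      by simp
    from eventually_near_prodD[OF this] show ?thesis
      unfolding P_def D_def chart_dist_def[of _ "g x"] by simp
  qed
  then have "\<forall>x. \<exists>\<eta>. x \<in> K \<longrightarrow> P x \<eta>" by blast
  then obtain \<eta> where \<eta>: "\<And>x. x \<in> K \<Longrightarrow> P x (\<eta> x)" using choice[of "\<lambda>x \<eta>. x \<in> K \<longrightarrow> P x \<eta>"] by blast
  have \<eta>0: "\<eta> x > 0" if "x \<in> K" for x using \<eta>[OF that] by (simp add: P_def)
  define N where "N = (\<lambda>x. {x' \<in> topspace TK. chart_dist (g x') (g x) \<in> {..<\<eta> x / 2}} \<inter> {x' \<in> topspace TK. D x (a x') \<in> {..<\<eta> x / 2}})"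
  have "openin TK (N x) \<and> x \<in> N x" if x: "x \<in> K" for x
  proof
    have "g x \<in> points Y" using admissible_points[OF g] x K_points by blast
    then have 1: "continuous_map TK euclideanreal (\<lambda>x'. chart_dist (g x') (g x))"
      by (intro continuous_map_chart_dist gc continuous_map_TK_const)
    have 2: "continuous_map TK euclideanreal (\<lambda>x'. D x (a x'))"
      unfolding D_def by (intro continuous_map_sum continuous_map_real_abs continuous_map_diff a) auto
    show "openin TK (N x)"
      unfolding N_def by (intro openin_Int openin_continuous_map_preimage[OF 1] openin_continuous_map_preimage[OF 2]) auto
    show "x \<in> N x" using x topspace_TK \<eta>0[OF x] by (simp add: N_def D_def)
  qed
  then obtain I where I: "finite I" "I \<subseteq> K" "K \<subseteq> \<Union>(N ` I)" by (rule finite_subcover_K)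
  define r where "r = Min (insert 1 ((\<lambda>x. \<eta> x / 2) ` I))"
  have r0: "r > 0" unfolding r_def using I \<eta>0 by (subst Min_gr_iff) auto
  have rI: "r \<le> \<eta> i / 2" if "i \<in> I" for i unfolding r_def using I(1) that by (intro Min_le) auto
  define Q where "Q = (\<lambda>l q. q \<in> sections X (points X) \<and> (\<forall>x\<in>A. q x = 0) \<and> (\<forall>x\<in>K. \<bar>q x - a x l\<bar> < r / (real m + 1)))"
  have "\<exists>q. Q l q" if l: "l < m" for l
    using sections_approximation_relative[OF X_variety K_compact A_closed a[OF l], of "r / (real m + 1)"] aA l r0
    unfolding Q_def by auto
  then have "\<forall>l. \<exists>q. l < m \<longrightarrow> Q l q" by blast
  then obtain q where q: "\<And>l. l < m \<Longrightarrow> Q l (q l)" using choice[of "\<lambda>l q. l < m \<longrightarrow> Q l q"] by blast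
  define a' where "a' = (\<lambda>x l. q l x)"
  define g' where "g' = (\<lambda>x. correction \<xi> (g x) (a' x))"
  have "admissible g'"
    unfolding admissible_def
  proof (intro conjI ballI)
    show "regular_map X Y g'"
      unfolding g'_def
    proof (rule correction_regular[OF X_sheaf X_inv \<xi>])
      show "regular_map X Y g" using g by (simp add: admissible_def)
      show "(\<lambda>x. a' x l) \<in> sections X (points X)" if "l < m" for l using q[OF that] by (simp add: Q_def a'_def)
    qed
    fix x assume x: "x \<in> A"
    have "g' x = g x"
      unfolding g'_def
    proof (rule correction_zero)
      show "g x \<in> points Y" using admissible_points[OF g] x A_points by blast
      show "a' x l = 0" if "l < m" for l using q[OF that] x by (simp add: Q_def a'_def)
    qed
    then show "g' x = f0 x" using g x by (simp add: admissible_def)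
  qed
  moreover have "chart_dist (g' x) (correction \<xi> (g x) (a x)) < \<epsilon>" if x: "x \<in> K" for x
  proof -
    obtain i where i: "i \<in> I" "x \<in> N i" using I(3) x by blast
    have iK: "i \<in> K" using i I by blast
    have y: "g x \<in> points Y" using admissible_points[OF g] x K_points by blast
    have d: "chart_dist (g x) (g i) < \<eta> i" "D i (a x) < \<eta> i / 2" using i(2) \<eta>0[OF iK] by (auto simp: N_def)
    have "D i (a' x) \<le> (\<Sum>l<m. \<bar>a' x l - a x l\<bar>) + D i (a x)"
      unfolding D_def sum.distrib[symmetric] by (intro sum_mono) linarith
    also have "(\<Sum>l<m. \<bar>a' x l - a x l\<bar>) \<le> (\<Sum>l<m. r / (real m + 1))"
      using q x by (intro sum_mono) (auto simp: Q_def a'_def intro: less_imp_le)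
    also have "\<dots> < r" using r0 by (simp add: field_simps)
    finally have "D i (a' x) < \<eta> i" using d(2) rI[OF i(1)] by linarith
    then have "chart_dist (g' x) (correction \<xi> (g i) (a i)) < \<epsilon> / 2"
      using \<eta>[OF iK] y d(1) unfolding P_def g'_def by blast
    moreover have "chart_dist (correction \<xi> (g x) (a x)) (correction \<xi> (g i) (a i)) < \<epsilon> / 2"
      using \<eta>[OF iK] y d \<eta>0[OF iK] unfolding P_def by simp
    ultimately show ?thesis
      using chart_dist_triangle[of "g' x" "correction \<xi> (g x) (a x)" "correction \<xi> (g i) (a i)"]
        chart_dist_commute[of "correction \<xi> (g i) (a i)" "correction \<xi> (g x) (a x)"] by linarith
  qed
  ultimately show ?thesis by blast
qed

text \<open>
  Up to \<open>\<epsilon>\<close>, the distance to \<open>h\<close> grows nowhere and is halved where \<open>h\<close> takes values in \<open>S\<close>.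
\<close>
definition improves :: "('x \<Rightarrow> 'y) \<Rightarrow> ('y \<Rightarrow> bool) \<Rightarrow> real \<Rightarrow> ('x \<Rightarrow> 'y) \<Rightarrow> ('x \<Rightarrow> 'y) \<Rightarrow> bool" where
  "improves h S \<epsilon> g g' \<longleftrightarrow> (\<forall>x\<in>K. chart_dist (g' x) (h x) < chart_dist (g x) (h x) + \<epsilon> \<and>
     (S (h x) \<longrightarrow> chart_dist (g' x) (h x) < chart_dist (g x) (h x) / 2 + \<epsilon>))"

text \<open>
  The radius \<open>r\<close> does not depend on the target \<open>h\<close>; this uniformity is what allows one radius for all
  stages of a homotopy.
\<close>
definition improvable :: "('y \<Rightarrow> bool) \<Rightarrow> real \<Rightarrow> bool" where
  "improvable S r \<longleftrightarrow> r > 0 \<and> (\<forall>h g \<epsilon>. target h \<and> admissible g \<and>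
     (\<forall>x\<in>K. chart_dist (g x) (h x) < r) \<and> \<epsilon> > 0 \<longrightarrow> (\<exists>g'. admissible g' \<and> improves h S \<epsilon> g g'))"

lemma improvableD:
  assumes "improvable S r" "target h" "admissible g" "\<forall>x\<in>K. chart_dist (g x) (h x) < r" "\<epsilon> > 0"
  shows "\<exists>g'. admissible g' \<and> improves h S \<epsilon> g g'"
  using assms unfolding improvable_def by blast

text \<open>
  If \<open>h x\<close> is within \<open>2 r\<close> of \<open>y\<^sub>0\<close> and \<open>g x\<close> within \<open>r\<close> of \<open>h x\<close>, both lie in the ball of radius
  \<open>\<eta> = 3 r\<close> on which corrections contract.  The cutoff \<open>t\<close> is \<open>1\<close> where \<open>h\<close> is within \<open>r\<close> of \<open>y\<^sub>0\<close> and
  \<open>0\<close> where its distance from \<open>y\<^sub>0\<close> is at least \<open>2 r\<close>.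
\<close>
lemma local_improvement:
  assumes y0: "y0 \<in> points Y"
  shows "\<exists>r. improvable (\<lambda>z. chart_dist z y0 < r) r"
proof -
  obtain \<xi> \<eta> where \<xi>: "vector_fields \<xi>" and \<eta>: "\<eta> > 0" "\<forall>y\<in>points Y. \<forall>z\<in>points Y. \<forall>t.
     chart_dist y y0 < \<eta> \<and> chart_dist z y0 < \<eta> \<and> 0 \<le> t \<and> t \<le> 1 \<longrightarrow>
     chart_dist (correction \<xi> y (\<lambda>l. t * (\<psi> z l - \<psi> y l))) z \<le> (1 - t / 2) * chart_dist y z"
    using correction_contracts[OF y0] by blast
  define r where "r = \<eta> / 3"
  have r0: "r > 0" using \<eta>(1) by (simp add: r_def)
  have "\<exists>g'. admissible g' \<and> improves h (\<lambda>z. chart_dist z y0 < r) \<epsilon> g g'"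
    if h: "target h" and g: "admissible g" and close: "\<forall>x\<in>K. chart_dist (g x) (h x) < r" and \<epsilon>: "\<epsilon> > 0" for h g \<epsilon>
  proof -
    have hc: "continuous_map TK (euclidean_topology Y) h" using h by (simp add: target_def)
    note gc = admissible_continuous[OF g]
    define t where "t = (\<lambda>x. max 0 (min 1 (2 - chart_dist (h x) y0 / r)))"
    have t01: "0 \<le> t x" "t x \<le> 1" for x by (auto simp: t_def)
    have tc: "continuous_map TK euclideanreal t"
      unfolding t_def using r0
      by (intro continuous_map_real_max continuous_map_real_min continuous_map_diff continuous_map_real_divide
          continuous_map_chart_dist hc continuous_map_TK_const y0) auto
    define a where "a = (\<lambda>x l. t x * (\<psi> (h x) l - \<psi> (g x) l))"
    have "\<exists>g'. admissible g' \<and> (\<forall>x\<in>K. chart_dist (g' x) (correction \<xi> (g x) (a x)) < \<epsilon>)"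
    proof (rule approximate_correction[OF g \<xi> _ _ \<epsilon>])
      show "continuous_map TK euclideanreal (\<lambda>x. a x l)" if "l < m" for l
        unfolding a_def using that by (intro continuous_map_real_mult tc continuous_map_diff continuous_map_TK_coordinate hc gc)
      show "a x l = 0" if "x \<in> K" "x \<in> A" for x l
        using h g that by (simp add: a_def target_def admissible_def)
    qed
    then obtain g' where g': "admissible g'" "\<forall>x\<in>K. chart_dist (g' x) (correction \<xi> (g x) (a x)) < \<epsilon>" by blast
    have "chart_dist (g' x) (h x) < chart_dist (g x) (h x) + \<epsilon> \<and>
      (chart_dist (h x) y0 < r \<longrightarrow> chart_dist (g' x) (h x) < chart_dist (g x) (h x) / 2 + \<epsilon>)" if x: "x \<in> K" for x
    proof -
      have gp: "g x \<in> points Y" using admissible_points[OF g] x K_points by blast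
      note hp = target_points[OF h x]
      have c: "chart_dist (correction \<xi> (g x) (a x)) (h x) \<le> (1 - t x / 2) * chart_dist (g x) (h x)"
      proof (cases "chart_dist (h x) y0 < 2 * r")
        case True
        have "chart_dist (g x) y0 < \<eta>" "chart_dist (h x) y0 < \<eta>"
          using True close x chart_dist_triangle[of "g x" y0 "h x"] r0 unfolding r_def by fastforce+
        then show ?thesis using \<eta>(2) gp hp t01 unfolding a_def by blast
      next
        case False
        then have "2 \<le> chart_dist (h x) y0 / r" using r0 by (simp add: field_simps)
        then have "t x = 0" by (simp add: t_def)
        then show ?thesis using correction_zero[OF gp, of "a x" \<xi>] by (simp add: a_def)
      qed
      have tr: "chart_dist (g' x) (h x) < \<epsilon> + chart_dist (correction \<xi> (g x) (a x)) (h x)"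
        using g'(2) x chart_dist_triangle[of "g' x" "h x" "correction \<xi> (g x) (a x)"] by fastforce
      have "(1 - t x / 2) * chart_dist (g x) (h x) \<le> 1 * chart_dist (g x) (h x)"
        using t01(1)[of x] by (intro mult_right_mono) auto
      moreover have "t x = 1" if "chart_dist (h x) y0 < r"
      proof -
        have "chart_dist (h x) y0 / r < 1" using that r0 by simp
        then show ?thesis by (simp add: t_def)
      qed
      ultimately show ?thesis using c tr by auto
    qed
    then show ?thesis using g'(1) unfolding improves_def by blast
  qed
  then show ?thesis using r0 unfolding improvable_def by blast
qed

text \<open>
  The corrections at the different centres are performed one after another.  Each of them increases
  the distance to \<open>h\<close> by at most a prescribed amount, so up to that amount it preserves what the others achieved.
\<close>
lemma finite_improvement:
  assumes I: "finite I" and \<rho>: "\<And>y. y \<in> I \<Longrightarrow> improvable (\<lambda>z. chart_dist z y < \<rho> y) (\<rho> y)"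
  shows "\<exists>r. improvable (\<lambda>z. \<exists>y\<in>I. chart_dist z y < \<rho> y) r"
  using assms
proof (induction I)
  case empty
  have "admissible g \<and> improves h (\<lambda>z. \<exists>y\<in>{}. chart_dist z y < \<rho> y) \<epsilon> g g" if "admissible g" "\<epsilon> > 0" for h g \<epsilon>
    using that by (simp add: improves_def)
  then show ?case unfolding improvable_def using zero_less_one by meson
next
  case (insert y I)
  obtain r where r: "improvable (\<lambda>z. \<exists>y\<in>I. chart_dist z y < \<rho> y) r"
    using insert.IH insert.prems by auto
  have \<rho>y: "improvable (\<lambda>z. chart_dist z y < \<rho> y) (\<rho> y)" using insert.prems by simp
  have pos: "r > 0" "\<rho> y > 0" using r \<rho>y by (auto simp: improvable_def)
  define r0 where "r0 = min r (\<rho> y / 2)"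
  have r0: "r0 > 0" "r0 \<le> r" "2 * r0 \<le> \<rho> y" using pos by (auto simp: r0_def)
  have "\<exists>g'. admissible g' \<and> improves h (\<lambda>z. \<exists>y\<in>insert y I. chart_dist z y < \<rho> y) \<epsilon> g g'"
    if h: "target h" and g: "admissible g" and close: "\<forall>x\<in>K. chart_dist (g x) (h x) < r0" and \<epsilon>: "\<epsilon> > 0" for h g \<epsilon>
  proof -
    \<comment> \<open>Half of \<open>\<epsilon>\<close> for each of the two corrections; the bound by \<open>r0\<close> keeps the intermediate map in the range of the second one.\<close>
    define \<epsilon>' where "\<epsilon>' = min (\<epsilon> / 2) r0"
    have \<epsilon>': "\<epsilon>' > 0" "2 * \<epsilon>' \<le> \<epsilon>" "\<epsilon>' \<le> r0" using \<epsilon> r0 by (auto simp: \<epsilon>'_def)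
    obtain g1 where g1: "admissible g1" "improves h (\<lambda>z. \<exists>y\<in>I. chart_dist z y < \<rho> y) \<epsilon>' g g1"
      using improvableD[OF r h g _ \<epsilon>'(1)] close r0(2) by force
    have "\<forall>x\<in>K. chart_dist (g1 x) (h x) < \<rho> y"
      using g1(2) close r0(3) \<epsilon>'(3) unfolding improves_def by fastforce
    then obtain g2 where g2: "admissible g2" "improves h (\<lambda>z. chart_dist z y < \<rho> y) \<epsilon>' g1 g2"
      using improvableD[OF \<rho>y h g1(1) _ \<epsilon>'(1)] by blast
    have "improves h (\<lambda>z. \<exists>y\<in>insert y I. chart_dist z y < \<rho> y) \<epsilon> g g2"
      unfolding improves_def
    proof (intro ballI conjI impI)
      fix x assume x: "x \<in> K"
      have a: "chart_dist (g1 x) (h x) < chart_dist (g x) (h x) + \<epsilon>'"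
        "(\<exists>y\<in>I. chart_dist (h x) y < \<rho> y) \<Longrightarrow> chart_dist (g1 x) (h x) < chart_dist (g x) (h x) / 2 + \<epsilon>'"
        using g1(2) x unfolding improves_def by auto
      have b: "chart_dist (g2 x) (h x) < chart_dist (g1 x) (h x) + \<epsilon>'"
        "chart_dist (h x) y < \<rho> y \<Longrightarrow> chart_dist (g2 x) (h x) < chart_dist (g1 x) (h x) / 2 + \<epsilon>'"
        using g2(2) x unfolding improves_def by auto
      show "chart_dist (g2 x) (h x) < chart_dist (g x) (h x) + \<epsilon>" using a(1) b(1) \<epsilon>'(2) by linarith
      assume "\<exists>y\<in>insert y I. chart_dist (h x) y < \<rho> y"
      then consider "chart_dist (h x) y < \<rho> y" | "\<exists>y\<in>I. chart_dist (h x) y < \<rho> y" by auto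
      then show "chart_dist (g2 x) (h x) < chart_dist (g x) (h x) / 2 + \<epsilon>"
      proof cases
        case 1
        from b(2)[OF 1] show ?thesis using a(1) \<epsilon>'(1,2) by linarith
      next
        case 2
        from a(2)[OF 2] show ?thesis using b(1) \<epsilon>'(2) by linarith
      qed
    qed
    then show ?thesis using g2(1) by blast
  qed
  then show ?case using r0(1) unfolding improvable_def by blast
qed

definition approximable :: "('x \<Rightarrow> 'y) \<Rightarrow> real \<Rightarrow> bool" where
  "approximable h \<epsilon> \<longleftrightarrow> (\<exists>g. admissible g \<and> (\<forall>x\<in>K. chart_dist (g x) (h x) < \<epsilon>))"

lemma approximable_mono: "approximable h \<epsilon> \<Longrightarrow> \<epsilon> \<le> \<delta> \<Longrightarrow> approximable h \<delta>"
  unfolding approximable_def by (meson order_less_le_trans)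

lemma approximable_near:
  assumes "approximable h \<epsilon>" "\<forall>x\<in>K. chart_dist (h x) (k x) < \<delta>"
  shows "approximable k (\<epsilon> + \<delta>)"
proof -
  obtain g where g: "admissible g" "\<forall>x\<in>K. chart_dist (g x) (h x) < \<epsilon>" using assms(1) unfolding approximable_def by blast
  have "chart_dist (g x) (k x) < \<epsilon> + \<delta>" if "x \<in> K" for x
    using chart_dist_triangle[of "g x" "k x" "h x"] g(2) assms(2) that by fastforce
  then show ?thesis using g(1) unfolding approximable_def by blast
qed

text \<open>
  Finitely many centres cover \<open>C\<close>, so the distance can be reduced by the factor \<open>3/4\<close> on all of \<open>K\<close>;
  this is iterated.
\<close>
lemma uniform_bootstrap:
  assumes C: "compactin (euclidean_topology Y) C"
  shows "\<exists>r>0. \<forall>h. target h \<and> h ` K \<subseteq> C \<and> approximable h r \<longrightarrow> (\<forall>\<epsilon>>0. approximable h \<epsilon>)"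
proof -
  have CY: "C \<subseteq> points Y" using compactin_subset_topspace[OF C] topspace_euclidean_topology[OF sheaf] by simp
  have "\<exists>\<rho>. \<forall>y\<in>C. improvable (\<lambda>z. chart_dist z y < \<rho> y) (\<rho> y)"
    by (rule bchoice) (use local_improvement CY in blast)
  then obtain \<rho> where \<rho>: "\<And>y. y \<in> C \<Longrightarrow> improvable (\<lambda>z. chart_dist z y < \<rho> y) (\<rho> y)" by blast
  define N where "N = (\<lambda>y. {z \<in> topspace (euclidean_topology Y). chart_dist z y \<in> {..<\<rho> y}})"
  have oN: "openin (euclidean_topology Y) (N y)" if "y \<in> C" for y
    unfolding N_def
    by (rule openin_continuous_map_preimage[OF continuous_map_chart_dist])
      (use that CY topspace_euclidean_topology[OF sheaf] in auto)
  have "C \<subseteq> \<Union>(N ` C)" using \<rho> CY by (auto simp: N_def improvable_def topspace_euclidean_topology[OF sheaf])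
  moreover have "\<forall>U\<in>N ` C. openin (euclidean_topology Y) U" using oN by blast
  ultimately obtain \<F> where \<F>: "finite \<F>" "\<F> \<subseteq> N ` C" "C \<subseteq> \<Union>\<F>" using C unfolding compactin_def by meson
  then obtain I where I: "I \<subseteq> C" "finite I" "\<F> = N ` I" by (meson finite_subset_image)
  obtain r where r: "improvable (\<lambda>z. \<exists>y\<in>I. chart_dist z y < \<rho> y) r"
    using finite_improvement[OF I(2) \<rho>] I(1) by blast
  have r0: "r > 0" using r by (simp add: improvable_def)
  have step: "approximable h (3 / 4 * \<epsilon>)"
    if h: "target h" "h ` K \<subseteq> C" and a: "approximable h \<epsilon>" and \<epsilon>: "0 < \<epsilon>" "\<epsilon> \<le> r" for h \<epsilon>
  proof -
    obtain g where g: "admissible g" "\<forall>x\<in>K. chart_dist (g x) (h x) < \<epsilon>" using a unfolding approximable_def by blast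
    have "\<forall>x\<in>K. chart_dist (g x) (h x) < r" using g(2) \<epsilon>(2) by force
    then obtain g' where g': "admissible g'" "improves h (\<lambda>z. \<exists>y\<in>I. chart_dist z y < \<rho> y) (\<epsilon> / 4) g g'"
      using improvableD[OF r h(1) g(1), of "\<epsilon> / 4"] \<epsilon>(1) by auto
    have "chart_dist (g' x) (h x) < 3 / 4 * \<epsilon>" if x: "x \<in> K" for x
    proof -
      have "\<exists>y\<in>I. chart_dist (h x) y < \<rho> y" using h(2) x \<F>(3) unfolding I(3) N_def by blast
      then have "chart_dist (g' x) (h x) < chart_dist (g x) (h x) / 2 + \<epsilon> / 4"
        using g'(2) x unfolding improves_def by blast
      then show ?thesis using g(2) x by fastforce
    qed
    then show ?thesis using g'(1) unfolding approximable_def by blast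
  qed
  have "approximable h \<epsilon>" if h: "target h" "h ` K \<subseteq> C" and a: "approximable h r" and \<epsilon>: "0 < \<epsilon>" for h \<epsilon>
  proof -
    have it: "approximable h ((3 / 4) ^ k * r)" for k
    proof (induction k)
      case 0 show ?case using a by simp
    next
      case (Suc k)
      have "(3 / 4 :: real) ^ k * r \<le> 1 * r" using r0 by (intro mult_right_mono power_le_one) auto
      then show ?case using step[OF h Suc] r0 by (simp add: mult.assoc)
    qed
    have "(\<lambda>k. (3 / 4 :: real) ^ k * r) \<longlonglongrightarrow> 0 * r" by (intro tendsto_mult LIMSEQ_power_zero tendsto_const) simp
    then have "eventually (\<lambda>k. (3 / 4 :: real) ^ k * r < \<epsilon>) sequentially" using \<epsilon> by (intro order_tendstoD(2)[of _ 0]) auto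
    then obtain k where "(3 / 4 :: real) ^ k * r < \<epsilon>" unfolding eventually_sequentially by blast
    then show ?thesis using approximable_mono[OF it[of k]] by simp
  qed
  then show ?thesis using r0 by blast
qed

text \<open>
  By the tube lemma, stages with neighbouring parameters are \<open>r/2\<close>-close on \<open>K\<close>; by the bootstrap,
  if one of them can be approximated to every accuracy, so can the other.  Connectedness of \<open>[0,1]\<close>
  carries this from \<open>f\<^sub>0\<close> to the end of the homotopy.
\<close>
lemma homotopy_approximation:
  assumes H: "continuous_map (prod_topology (top_of_set {0..1::real}) TK) (euclidean_topology Y) H"
    and HA: "\<And>t x. t \<in> {0..1} \<Longrightarrow> x \<in> K \<inter> A \<Longrightarrow> H (t, x) = f0 x"
    and H0: "\<And>x. x \<in> K \<Longrightarrow> H (0, x) = f0 x" and \<epsilon>: "\<epsilon> > 0"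
  shows "approximable (\<lambda>x. H (1, x)) \<epsilon>"
proof -
  let ?I = "top_of_set {0..1::real}"
  define C where "C = H ` ({0..1} \<times> K)"
  have "compactin (prod_topology ?I TK) ({0..1} \<times> K)"
    using compact_TK by (simp add: compactin_Times)
  then have C: "compactin (euclidean_topology Y) C" unfolding C_def by (rule image_compactin[OF _ H])
  obtain r where r: "r > 0" "\<And>h \<epsilon>. target h \<Longrightarrow> h ` K \<subseteq> C \<Longrightarrow> approximable h r \<Longrightarrow> 0 < \<epsilon> \<Longrightarrow> approximable h \<epsilon>"
    using uniform_bootstrap[OF C] by blast
  have Ht: "target (\<lambda>x. H (t, x))" "(\<lambda>x. H (t, x)) ` K \<subseteq> C" if t: "t \<in> {0..1}" for t
  proof -
    have "continuous_map TK (prod_topology ?I TK) (\<lambda>x. (t, x))"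
      using t by (simp add: continuous_map_pairwise o_def)
    from continuous_map_compose[OF this H] show "target (\<lambda>x. H (t, x))"
      using HA[OF t] by (simp add: target_def o_def)
    show "(\<lambda>x. H (t, x)) ` K \<subseteq> C" using t by (auto simp: C_def)
  qed
  define R where "R = (\<lambda>t u. (\<forall>\<epsilon>>0. approximable (\<lambda>x. H (t, x)) \<epsilon>) \<longleftrightarrow> (\<forall>\<epsilon>>0. approximable (\<lambda>x. H (u, x)) \<epsilon>))"
  have transfer: "\<forall>\<epsilon>>0. approximable (\<lambda>x. H (u, x)) \<epsilon>"
    if "\<forall>\<epsilon>>0. approximable (\<lambda>x. H (t, x)) \<epsilon>" "u \<in> {0..1}" "\<forall>x\<in>K. chart_dist (H (t, x)) (H (u, x)) < r / 2" for t u
  proof -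
    have "approximable (\<lambda>x. H (u, x)) (r / 2 + r / 2)" using that(1,3) r(1) by (intro approximable_near) auto
    then show ?thesis using r(2)[OF Ht[OF that(2)]] by simp
  qed
  have "R 0 1"
  proof (rule connected_equivalence_relation[of "{0..1::real}"])
    show "connected {0..1::real}" by simp
    show "(0::real) \<in> {0..1}" "(1::real) \<in> {0..1}" by auto
    show "R u t" if "R t u" for t u using that by (simp add: R_def)
    show "R t v" if "R t u" "R u v" for t u v using that by (simp add: R_def)
    fix t :: real assume t: "t \<in> {0..1}"
    define W where "W = {p \<in> topspace (prod_topology ?I TK). chart_dist (H (t, snd p)) (H p) \<in> {..<r / 2}}"
    have "continuous_map (prod_topology ?I TK) TK snd" by (rule continuous_map_snd)
    from continuous_map_compose[OF this Ht(1)[OF t, unfolded target_def, THEN conjunct1]]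
    have "continuous_map (prod_topology ?I TK) (euclidean_topology Y) (\<lambda>p. H (t, snd p))" by (simp add: o_def)
    then have "openin (prod_topology ?I TK) W"
      unfolding W_def by (intro openin_continuous_map_preimage[OF continuous_map_chart_dist[OF _ H]]) auto
    moreover have "{t} \<times> K \<subseteq> W" using t topspace_TK r(1) by (auto simp: W_def)
    ultimately obtain U V where UV: "openin ?I U" "t \<in> U" "K \<subseteq> V" "U \<times> V \<subseteq> W"
      using tube_lemma_right[OF _ compact_TK, of ?I W t] t by auto
    have "R t u" if u: "u \<in> U" for u
    proof -
      have uI: "u \<in> {0..1}" using openin_subset[OF UV(1)] u by auto
      have d: "chart_dist (H (t, x)) (H (u, x)) < r / 2" if "x \<in> K" for x
      proof -
        have "(u, x) \<in> W" using UV(3,4) u that by blast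
        then show ?thesis by (simp add: W_def)
      qed
      show ?thesis unfolding R_def using transfer[of t u] transfer[of u t] d t uI chart_dist_commute by auto
    qed
    then show "\<exists>T. openin ?I T \<and> t \<in> T \<and> (\<forall>u\<in>T. R t u)" using UV(1,2) by blast
  qed
  moreover have "approximable (\<lambda>x. H (0, x)) \<epsilon>" if "\<epsilon> > 0" for \<epsilon>
    unfolding approximable_def
    by (rule exI[of _ f0]) (use H0 that f0_regular in \<open>simp add: admissible_def\<close>)
  ultimately show ?thesis using \<epsilon> unfolding R_def by blast
qed

end

theorem theorem1p14:
  fixes X :: "'x fspace" and Y :: "'y fspace"
    and D A :: "'x set" and f f\<^sub>0 :: "'x \<Rightarrow> 'y"
  assumes "real_algebraic_variety Y" and "nonsingular Y" and "malleable TYPE('e) Y"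
    and "real_algebraic_variety X"
    and "D \<subseteq> points X"
    and "continuous_map (subtopology (euclidean_topology X) D) (euclidean_topology Y) f"
    and "closedin (zariski X) A"
    and "regular_map X Y f\<^sub>0"
    and "\<forall>x\<in>D \<inter> A. f\<^sub>0 x = f x"
    and "homotopic_with (\<lambda>g. \<forall>x\<in>D \<inter> A. g x = f x)
           (subtopology (euclidean_topology X) D) (euclidean_topology Y) f\<^sub>0 f"
  shows "approximable_by_regular_maps X Y D f (\<lambda>g. \<forall>x\<in>A. g x = f\<^sub>0 x)"
proof -
  obtain m \<psi> and E :: "'e fspace" and pr n F \<phi> \<theta> zero s where sc: "spray_chart Y m \<psi> E pr n F \<phi> \<theta> zero s"
    using malleable_spray_chart[OF assms(1-3)] by blast
  interpret spray_chart Y m \<psi> E pr n F \<phi> \<theta> zero s by (rule sc)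
  let ?TD = "subtopology (euclidean_topology X) D" and ?TY = "euclidean_topology Y"
  note X_sheaf = variety_sheaf[OF assms(4)]
  have topD: "topspace ?TD = D" using assms(5) topspace_euclidean_topology[OF X_sheaf] by auto
  obtain H where H: "continuous_map (prod_topology (top_of_set {0..1::real}) ?TD) ?TY H"
    "\<forall>x. H (0, x) = f\<^sub>0 x" "\<forall>x. H (1, x) = f x" "\<forall>t\<in>{0..1}. \<forall>x\<in>D \<inter> A. H (t, x) = f x"
    using assms(10) unfolding homotopic_with_def by auto
  show ?thesis
    unfolding approximable_by_regular_maps_def
  proof (intro allI impI, elim conjE)
    fix \<U> assume \<U>: "openin (compact_open_topology ?TD ?TY) \<U>" "restrict f D \<in> \<U>"
    obtain \<T> where \<T>: "finite \<T>" "\<T> \<subseteq> {{g \<in> continuous_maps ?TD ?TY. g ` K \<subseteq> W} | K W. compactin ?TD K \<and> openin ?TY W}"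
      "restrict f D \<in> \<Inter>\<T>" "\<Inter>\<T> \<subseteq> \<U>"
      using generated_topology_nhd[OF \<U>(1)[unfolded compact_open_topology_def] \<U>(2)] by auto
    define P where "P = (\<lambda>B KW. B = {g \<in> continuous_maps ?TD ?TY. g ` fst KW \<subseteq> snd KW} \<and> compactin ?TD (fst KW) \<and> openin ?TY (snd KW))"
    have "\<exists>KW. P B KW" if "B \<in> \<T>" for B using subsetD[OF \<T>(2) that] unfolding P_def by auto
    then have "\<forall>B. \<exists>KW. B \<in> \<T> \<longrightarrow> P B KW" by blast
    then obtain KW where KW: "\<And>B. B \<in> \<T> \<Longrightarrow> P B (KW B)" using choice[of "\<lambda>B KW. B \<in> \<T> \<longrightarrow> P B KW"] by blast
    \<comment> \<open>A basic neighbourhood in the compact-open topology only involves finitely many compact sets.\<close>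
    define K where "K = (\<Union>B\<in>\<T>. fst (KW B))"
    have KB: "compactin ?TD (fst (KW B))" if "B \<in> \<T>" for B using KW[OF that] by (simp add: P_def)
    have "compactin ?TD K" unfolding K_def using \<T>(1) KB by (intro compactin_Union) auto
    then have K: "compactin (euclidean_topology X) K" "K \<subseteq> D" by (auto simp: compactin_subtopology)
    interpret relative_approximation Y m \<psi> E pr n F \<phi> \<theta> zero s X K A f\<^sub>0
      by standard (rule assms K)+
    have TKD: "TK = subtopology ?TD K" using K(2) by (simp add: subtopology_subtopology inf.absorb2)
    have "continuous_map (subtopology (prod_topology (top_of_set {0..1::real}) ?TD) ({0..1} \<times> K)) ?TY H"
      by (rule continuous_map_from_subtopology[OF H(1)])
    then have HK: "continuous_map (prod_topology (top_of_set {0..1::real}) TK) ?TY H"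
      unfolding TKD prod_topology_subtopology by (simp add: subtopology_subtopology)
    have "\<exists>\<epsilon>>0. \<forall>x\<in>fst (KW B). \<forall>z\<in>points Y. chart_dist z (f x) < \<epsilon> \<longrightarrow> z \<in> snd (KW B)" if B: "B \<in> \<T>" for B
    proof (rule compact_image_neighbourhood[OF KB[OF B]])
      show "continuous_map (subtopology ?TD (fst (KW B))) ?TY f" by (rule continuous_map_from_subtopology[OF assms(6)])
      show "openin ?TY (snd (KW B))" using KW[OF B] by (simp add: P_def)
      have "restrict f D \<in> B" using \<T>(3) B by blast
      moreover have "B = {g \<in> continuous_maps ?TD ?TY. g ` fst (KW B) \<subseteq> snd (KW B)}" using KW[OF B] by (simp add: P_def)
      ultimately have "restrict f D \<in> {g \<in> continuous_maps ?TD ?TY. g ` fst (KW B) \<subseteq> snd (KW B)}" by (rule subst[rotated])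
      then have "restrict f D ` fst (KW B) \<subseteq> snd (KW B)" by blast
      moreover have "fst (KW B) \<subseteq> D" using K(2) B unfolding K_def by blast
      ultimately show "f ` fst (KW B) \<subseteq> snd (KW B)" by (auto simp: image_subset_iff subset_eq)
    qed
    then obtain \<epsilon> where \<epsilon>: "\<And>B. B \<in> \<T> \<Longrightarrow> \<epsilon> B > 0 \<and> (\<forall>x\<in>fst (KW B). \<forall>z\<in>points Y. chart_dist z (f x) < \<epsilon> B \<longrightarrow> z \<in> snd (KW B))"
      by metis
    define \<delta> where "\<delta> = Min (insert 1 (\<epsilon> ` \<T>))"
    have \<delta>: "\<delta> > 0" unfolding \<delta>_def using \<T>(1) \<epsilon> by (subst Min_gr_iff) auto
    have \<delta>B: "\<delta> \<le> \<epsilon> B" if "B \<in> \<T>" for B unfolding \<delta>_def using \<T>(1) that by (intro Min_le) auto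
    have "approximable (\<lambda>x. H (1, x)) \<delta>"
      by (rule homotopy_approximation[OF HK _ _ \<delta>]) (use H(2,4) K(2) assms(9) in auto)
    then obtain g where g: "admissible g" "\<forall>x\<in>K. chart_dist (g x) (f x) < \<delta>"
      using H(3) unfolding approximable_def by auto
    have gr: "regular_map X Y g" "\<forall>x\<in>A. g x = f\<^sub>0 x" using g(1) by (auto simp: admissible_def)
    have "continuous_map ?TD ?TY (restrict g D)"
      by (rule continuous_map_eq[OF continuous_map_from_subtopology[OF regular_map_euclidean_continuous[OF X_sheaf sheaf gr(1)]]])
        (simp add: topD)
    then have gD: "restrict g D \<in> continuous_maps ?TD ?TY" unfolding continuous_maps_def topD by simp
    have "restrict g D \<in> B" if B: "B \<in> \<T>" for B
    proof -
      have "restrict g D x \<in> snd (KW B)" if x: "x \<in> fst (KW B)" for x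
      proof -
        have xK: "x \<in> K" "x \<in> D" using x B K(2) unfolding K_def by auto
        have "chart_dist (g x) (f x) < \<epsilon> B" using g(2) xK(1) \<delta>B[OF B] by force
        then have "g x \<in> snd (KW B)"
          using \<epsilon>[OF B] x regular_map_points[OF gr(1)] K_points xK(1) by blast
        then show ?thesis using xK(2) by simp
      qed
      then show ?thesis using gD KW[OF B] unfolding P_def by blast
    qed
    then have "restrict g D \<in> \<U>" using \<T>(4) by blast
    then show "\<exists>g. regular_map X Y g \<and> (\<forall>x\<in>A. g x = f\<^sub>0 x) \<and> restrict g D \<in> \<U>" using gr by blast
  qed
qed

end
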